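(* Let be given an arquile map $f_\infty:\mathcal A_\circ^m\to\mathcal A^k$, $y(t)\mapsto f(t,y(t))$, induced by the substitution of the $\mathrm y$-variables by a vector $y(t)$ of power series in a given power series vector $f\in\mathcal B^k$. Assume that $k\le m$ and let $g$ be a $(k\times k)$-minor of the relative Jacobian matrix $\partial_{\mathrm y}f$ of $f$. Set $\mathcal S_d=\{y\in\mathcal A_\circ^m:\ g(y)\ne0,\ \mathrm{ord}\,g(y)=d\}$. There then exists, for each $d\in\mathbb N$, a textile isomorphism $$\chi_d:\mathcal Z_d\times\mathcal V_d\xrightarrow{\ \cong\ }\mathcal S_d$$ over $\mathcal Z_d$ from the cartesian product of the quasi-affine algebraic variety $\mathcal Z_d=\{z\in(\mathbf k_\circ[t]_{\le d})^m:\ \mathrm{ord}\,g(z)=d\}$ with the $\mathcal A_\circ$-module $\mathcal V_d=\langle t\rangle^d\cdot\mathcal A_\circ^m$ such that the composition $$f_\infty\circ\chi_d:\mathcal Z_d\times\mathcal V_d\xrightarrow{\ \cong\ }\mathcal S_d\xrightarrow{\ f_\infty\ }\mathcal A^k$$ is linear in the second component and of the form $$(f_\infty\circ\chi_d)(z,v)=f(z)+\partial_{\mathrm y}f(z)\cdot v .$$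
   Context: $\mathbf k$ is a perfect field of arbitrary characteristic (equipped with a valuation when convergent series are considered). Fix one of three qualities: $\mathcal A=\mathbf k[[t]]$ (formal), $\mathbf k\{t\}$ (convergent), or $\mathbf k\langle t\rangle$ (algebraic: the algebraic closure of $\mathbf k[t]$ in $\mathbf k[[t]]$) in one variable $t$; correspondingly $\mathcal B=\mathbf k[[t,\mathrm y]]$, $\mathbf k\{t,\mathrm y\}$ or $\mathbf k\langle t,\mathrm y\rangle$, $\mathrm y=(\mathrm y_1,\dots,\mathrm y_m)$. $\mathcal A_\circ\subset\mathcal A$ is the set of series without constant term; $\langle t\rangle^d=t^d\cdot\mathcal A_\circ$, and $\langle t\rangle^d\cdot\mathcal A_\circ^m$ denotes the submodule $t^d\mathcal A_\circ^m$ of $\mathcal A_\circ^m$ generated in each component by $t^d$. $\mathbf k_\circ[t]_{\le d}$ is the space of polynomials in $t$ of degree $\le d$ without constant term. For $y\in\mathcal A_\circ^m$ and $h\in\mathcal B$ put $h(y)=h(t,y(t))$; $\mathrm{ord}$ is the order in $t$. $\partial_{\mathrm y}f=(\partial f_i/\partial\mathrm y_j)$ is a $(k\times m)$-matrix, and $v$ is taken as a column. "Over $\mathcal Z_d$" means that $\chi_d$ is compatible with the projection $\mathcal Z_d\times\mathcal V_d\to\mathcal Z_d$ and the map $\mathcal S_d\to\mathcal Z_d$ sending $y=v+z$ (with $v\in\mathcal V_d$, $z\in(\mathbf k_\circ[t]_{\le d})^m$) to $z$. A map between subsets of spaces of the form $\mathcal A_\circ^n$ or $\mathcal A^n$ is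 textile if each coefficient of the image is a polynomial in finitely many coefficients of the argument. A textile isomorphism is a bijective textile map whose inverse is textile.
   Formalization: Textile here allows coefficients P/q^e, P a polynomial and q the nonvanishing t^d-coefficient of g(z) (or g(y)); with polynomials only the claim fails, e.g. f=y^2/2, g=y, d=1 over an infinite field of characteristic not 2. *)

theory Defs
  imports "HOL-Analysis.Analysis" "HOL-Computational_Algebra.Computational_Algebra"
begin

section \<open>Formal power series in several variables\<close>

text \<open>
  A monomial in the variables \<open>'v\<close> is a finite multiset of variables (\<open>count \<alpha> x\<close> is the exponent
  of \<open>x\<close>, \<open>size \<alpha>\<close> the total degree, \<open>+\<close> the product of monomials); a power series
  is an arbitrary family of coefficients indexed by the monomials.
\<close>

typedef ('v, 'a) mps = "UNIV :: ('v multiset \<Rightarrow> 'a) set"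
  morphisms mps_nth Abs_mps ..

setup_lifting type_definition_mps

lemma mps_nth_Abs [simp]: "mps_nth (Abs_mps f) = f"
  by (simp add: Abs_mps_inverse)

lemma mps_eqI: "(\<And>\<alpha>. mps_nth f \<alpha> = mps_nth g \<alpha>) \<Longrightarrow> f = g"
  by (metis ext mps_nth_inverse)

definition splits :: "'v multiset \<Rightarrow> ('v multiset \<times> 'v multiset) set" where
  "splits \<gamma> = {(\<alpha>, \<beta>). \<alpha> + \<beta> = \<gamma>}"

lemma finite_splits [simp]: "finite (splits \<gamma>)"
proof -
  have "splits \<gamma> \<subseteq> (\<lambda>\<alpha>. (\<alpha>, \<gamma> - \<alpha>)) ` {\<alpha>. \<alpha> \<subseteq># \<gamma>}"
    by (auto simp: splits_def)
  moreover have "finite {\<alpha>. \<alpha> \<subseteq># \<gamma>}"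
  proof (induction \<gamma>)
    case (add x \<gamma>)
    have "{\<alpha>. \<alpha> \<subseteq># add_mset x \<gamma>} \<subseteq> {\<alpha>. \<alpha> \<subseteq># \<gamma>} \<union> add_mset x ` {\<alpha>. \<alpha> \<subseteq># \<gamma>}"
    proof
      fix \<alpha> assume "\<alpha> \<in> {\<alpha>. \<alpha> \<subseteq># add_mset x \<gamma>}"
      then have "\<alpha> - {#x#} \<subseteq># \<gamma>"
        by (simp add: subset_eq_diff_conv)
      then show "\<alpha> \<in> {\<alpha>. \<alpha> \<subseteq># \<gamma>} \<union> add_mset x ` {\<alpha>. \<alpha> \<subseteq># \<gamma>}"
        by (cases "x \<in># \<alpha>") (auto simp: image_iff dest!: multi_member_split)
    qed
    with add.IH show ?case
      by (meson finite_UnI finite_imageI finite_subset)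
  qed simp
  ultimately show ?thesis
    using finite_subset by blast
qed

lemma splits_empty [simp]: "splits {#} = {({#}, {#})}"
  by (auto simp: splits_def)

instantiation mps :: (type, comm_ring_1) comm_ring_1
begin

definition zero_mps :: "('a, 'b) mps" where "zero_mps = Abs_mps (\<lambda>_. 0)"

definition one_mps :: "('a, 'b) mps" where
  "one_mps = Abs_mps (\<lambda>\<alpha>. if \<alpha> = {#} then 1 else 0)"

definition plus_mps :: "('a, 'b) mps \<Rightarrow> ('a, 'b) mps \<Rightarrow> ('a, 'b) mps" where
  "plus_mps f g = Abs_mps (\<lambda>\<alpha>. mps_nth f \<alpha> + mps_nth g \<alpha>)"

definition minus_mps :: "('a, 'b) mps \<Rightarrow> ('a, 'b) mps \<Rightarrow> ('a, 'b) mps" where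
  "minus_mps f g = Abs_mps (\<lambda>\<alpha>. mps_nth f \<alpha> - mps_nth g \<alpha>)"

definition uminus_mps :: "('a, 'b) mps \<Rightarrow> ('a, 'b) mps" where
  "uminus_mps f = Abs_mps (\<lambda>\<alpha>. - mps_nth f \<alpha>)"

definition times_mps :: "('a, 'b) mps \<Rightarrow> ('a, 'b) mps \<Rightarrow> ('a, 'b) mps" where
  "times_mps f g = Abs_mps (\<lambda>\<gamma>. \<Sum>(\<alpha>, \<beta>)\<in>splits \<gamma>. mps_nth f \<alpha> * mps_nth g \<beta>)"

instance
proof
  fix a b c :: "('a, 'b) mps"
  show "a * b * c = a * (b * c)"
  proof (rule mps_eqI)
    fix \<gamma>
    let ?t = "\<lambda>\<alpha> \<beta> \<delta>. mps_nth a \<alpha> * mps_nth b \<beta> * mps_nth c \<delta>"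
    have "mps_nth (a * b * c) \<gamma>
        = (\<Sum>(\<epsilon>, \<delta>)\<in>splits \<gamma>. \<Sum>(\<alpha>, \<beta>)\<in>splits \<epsilon>. ?t \<alpha> \<beta> \<delta>)"
      by (simp add: times_mps_def sum_distrib_right case_prod_unfold)
    also have "\<dots> = (\<Sum>((\<epsilon>, \<delta>), (\<alpha>, \<beta>))\<in>Sigma (splits \<gamma>) (\<lambda>(\<epsilon>, \<delta>). splits \<epsilon>). ?t \<alpha> \<beta> \<delta>)"
      by (subst sum.Sigma [symmetric]) (auto simp: case_prod_unfold)
    also have "\<dots> = (\<Sum>((\<alpha>, \<epsilon>), (\<beta>, \<delta>))\<in>Sigma (splits \<gamma>) (\<lambda>(\<alpha>, \<epsilon>). splits \<epsilon>). ?t \<alpha> \<beta> \<delta>)"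
      by (rule sum.reindex_bij_witness
            [of _ "\<lambda>((\<alpha>, \<epsilon>), (\<beta>, \<delta>)). ((\<alpha> + \<beta>, \<delta>), (\<alpha>, \<beta>))"
                  "\<lambda>((\<epsilon>, \<delta>), (\<alpha>, \<beta>)). ((\<alpha>, \<beta> + \<delta>), (\<beta>, \<delta>))"])
         (auto simp: splits_def add.assoc)
    also have "\<dots> = (\<Sum>(\<alpha>, \<epsilon>)\<in>splits \<gamma>. \<Sum>(\<beta>, \<delta>)\<in>splits \<epsilon>. ?t \<alpha> \<beta> \<delta>)"
      by (subst sum.Sigma [symmetric]) (auto simp: case_prod_unfold)
    also have "\<dots> = mps_nth (a * (b * c)) \<gamma>"
      by (simp add: times_mps_def sum_distrib_left case_prod_unfold mult.assoc)
    finally show "mps_nth (a * b * c) \<gamma> = mps_nth (a * (b * c)) \<gamma>" .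
  qed
  show "a * b = b * a"
  proof (rule mps_eqI)
    fix \<gamma>
    show "mps_nth (a * b) \<gamma> = mps_nth (b * a) \<gamma>"
      unfolding times_mps_def mps_nth_Abs
      by (rule sum.reindex_bij_witness [of _ "\<lambda>(\<alpha>, \<beta>). (\<beta>, \<alpha>)" "\<lambda>(\<alpha>, \<beta>). (\<beta>, \<alpha>)"])
         (auto simp: splits_def add.commute mult.commute)
  qed
  show "1 * a = a"
  proof (rule mps_eqI)
    fix \<gamma>
    have "mps_nth (1 * a) \<gamma>
        = (\<Sum>(\<alpha>, \<beta>)\<in>splits \<gamma>. (if \<alpha> = {#} then 1 else 0) * mps_nth a \<beta>)"
      by (simp add: times_mps_def one_mps_def)
    also have "\<dots> = (\<Sum>(\<alpha>, \<beta>)\<in>{({#} :: 'a multiset, \<gamma>)}. (if \<alpha> = {#} then 1 else 0) * mps_nth a \<beta>)"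
      by (rule sum.mono_neutral_right [OF finite_splits])
         (auto simp: splits_def split: if_splits)
    finally show "mps_nth (1 * a) \<gamma> = mps_nth a \<gamma>" by simp
  qed
  show "(a + b) * c = a * c + b * c"
    by (rule mps_eqI)
       (simp add: times_mps_def plus_mps_def case_prod_unfold distrib_right sum.distrib)
  show "a + b + c = a + (b + c)" "a + b = b + a" "0 + a = a" "- a + a = 0" "a - b = a + - b"
    by (auto intro!: mps_eqI
          simp: plus_mps_def zero_mps_def uminus_mps_def minus_mps_def algebra_simps)
  show "(0 :: ('a, 'b) mps) \<noteq> 1"
  proof
    assume "(0 :: ('a, 'b) mps) = 1"
    then have "mps_nth (0 :: ('a, 'b) mps) {#} = mps_nth 1 {#}" by simp
    then show False by (simp add: zero_mps_def one_mps_def)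
  qed
qed

end

definition mps_deriv :: "'v \<Rightarrow> ('v, 'a::comm_ring_1) mps \<Rightarrow> ('v, 'a) mps" where
  "mps_deriv x f = Abs_mps (\<lambda>\<alpha>. of_nat (Suc (count \<alpha> x)) * mps_nth f (add_mset x \<alpha>))"

text \<open>
  Substitution of univariate power series without constant term for the variables of \<open>f\<close>.
  For such \<open>s\<close> the monomial \<open>s\<^sup>\<alpha>\<close> has order at least \<open>size \<alpha>\<close>, so that only the finitely many
  monomials with \<open>size \<alpha> \<le> n\<close> contribute to the coefficient of \<open>t\<^sup>n\<close>. For other \<open>s\<close> the value is
  meaningless.
\<close>

definition mps_subst :: "('v::finite, 'a::comm_ring_1) mps \<Rightarrow> ('v \<Rightarrow> 'a fps) \<Rightarrow> 'a fps" where
  "mps_subst f s = Abs_fps (\<lambda>n. \<Sum>\<alpha> | size \<alpha> \<le> n.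
     mps_nth f \<alpha> * fps_nth (prod_mset (image_mset s \<alpha>)) n)"

text \<open>
  Polynomials are the power series with finitely many nonzero coefficients; here the set of
  variables may be infinite.
\<close>

definition mps_is_poly :: "('v, 'a::comm_ring_1) mps \<Rightarrow> bool" where
  "mps_is_poly p \<longleftrightarrow> finite {\<alpha>. mps_nth p \<alpha> \<noteq> 0}"

definition mps_poly_eval :: "('v, 'a::comm_ring_1) mps \<Rightarrow> ('v \<Rightarrow> 'a) \<Rightarrow> 'a" where
  "mps_poly_eval p x = (\<Sum>\<alpha> | mps_nth p \<alpha> \<noteq> 0. mps_nth p \<alpha> * prod_mset (image_mset x \<alpha>))"

section \<open>Ground field and the three qualities of power series\<close>

definition perfect_field :: "'a::field itself \<Rightarrow> bool" where
  "perfect_field _ \<longleftrightarrow> CHAR('a) = 0 \<or> surj (\<lambda>x::'a. x ^ CHAR('a))"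

definition is_valuation :: "('a::field \<Rightarrow> real) \<Rightarrow> bool" where
  "is_valuation av \<longleftrightarrow>
     (\<forall>x. 0 \<le> av x) \<and> (\<forall>x. av x = 0 \<longleftrightarrow> x = 0) \<and>
     (\<forall>x y. av (x * y) = av x * av y) \<and> (\<forall>x y. av (x + y) \<le> av x + av y)"

datatype 'a quality = Formal | Convergent "'a \<Rightarrow> real" | Algebraic

fun series1 :: "'a::field quality \<Rightarrow> 'a fps set" where
  "series1 Formal = UNIV"
| "series1 (Convergent av) = {h. \<exists>r>0. summable (\<lambda>n. av (fps_nth h n) * r ^ n)}"
| "series1 Algebraic = {h. \<exists>P :: 'a poly poly. P \<noteq> 0 \<and> poly (map_poly fps_of_poly P) h = 0}"

fun series :: "'a::field quality \<Rightarrow> ('v::finite, 'a) mps set" where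
  "series Formal = UNIV"
| "series (Convergent av) =
     {h. \<exists>r>0. (\<lambda>\<alpha>. av (mps_nth h \<alpha>) * r ^ size \<alpha>) summable_on UNIV}"
| "series Algebraic =
     {h. \<exists>P :: ('v, 'a) mps poly. P \<noteq> 0 \<and> (\<forall>i. mps_is_poly (coeff P i)) \<and> poly P h = 0}"

definition series1_0 :: "'a::field quality \<Rightarrow> 'a fps set" where
  "series1_0 Q = {h \<in> series1 Q. fps_nth h 0 = 0}"

definition vecs_in :: "'b set \<Rightarrow> ('b ^ 'n) set" where
  "vecs_in S = {y. \<forall>j. y $ j \<in> S}"

text \<open>
  The elements of \<open>\<B>\<close> are series in the variables \<^typ>\<open>'m option\<close>: \<^term>\<open>None\<close> stands for \<open>t\<close>
  and \<^term>\<open>Some j\<close> for the \<open>j\<close>-th \<open>y\<close>-variable.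
\<close>

definition at_arc :: "('m::finite option, 'a::field) mps \<Rightarrow> 'a fps ^ 'm \<Rightarrow> 'a fps" where
  "at_arc h y = mps_subst h (case_option fps_X (\<lambda>j. y $ j))"

definition arquile ::
    "('m::finite option, 'a::field) mps ^ 'k \<Rightarrow> 'a fps ^ 'm \<Rightarrow> 'a fps ^ 'k" where
  "arquile f y = (\<chi> i. at_arc (f $ i) y)"

definition rel_jacobian ::
    "('m::finite option, 'a::field) mps ^ 'k \<Rightarrow> ('m option, 'a) mps ^ 'm ^ 'k" where
  "rel_jacobian f = (\<chi> i j. mps_deriv (Some j) (f $ i))"

definition mat_at_arc ::
    "('m::finite option, 'a::field) mps ^ 'n ^ 'k \<Rightarrow> 'a fps ^ 'm \<Rightarrow> 'a fps ^ 'n ^ 'k" where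
  "mat_at_arc M y = (\<chi> i j. at_arc (M $ i $ j) y)"

text \<open>
  A maximal minor is given by an injective choice \<open>\<sigma>\<close> of columns. As the index type carries no
  order, each minor is obtained together with its negative.
\<close>

definition is_maximal_minor :: "'r::comm_ring_1 \<Rightarrow> 'r ^ 'm ^ 'k \<Rightarrow> bool" where
  "is_maximal_minor g M \<longleftrightarrow> (\<exists>\<sigma> :: 'k \<Rightarrow> 'm. inj \<sigma> \<and> g = det (\<chi> i l. M $ i $ \<sigma> l))"

text \<open>The order of \<open>0\<close> is infinite, whereas \<open>subdegree 0 = 0\<close>.\<close>

definition has_ord :: "'a::field fps \<Rightarrow> nat \<Rightarrow> bool" where
  "has_ord h d \<longleftrightarrow> h \<noteq> 0 \<and> subdegree h = d"

definition S_set :: "'a::field quality \<Rightarrow> ('m::finite option, 'a) mps \<Rightarrow> nat \<Rightarrow> ('a fps ^ 'm) set"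
  where "S_set Q g d = {y \<in> vecs_in (series1_0 Q). has_ord (at_arc g y) d}"

definition poly_0 :: "nat \<Rightarrow> 'a::field fps set" where
  "poly_0 d = {fps_of_poly p | p. degree p \<le> d \<and> coeff p 0 = 0}"

definition Z_set :: "('m::finite option, 'a::field) mps \<Rightarrow> nat \<Rightarrow> ('a fps ^ 'm) set" where
  "Z_set g d = {z \<in> vecs_in (poly_0 d). has_ord (at_arc g z) d}"

definition V_set :: "'a::field quality \<Rightarrow> nat \<Rightarrow> ('a fps ^ 'm) set" where
  "V_set Q d = vecs_in ((\<lambda>h. fps_X ^ d * h) ` series1_0 Q)"

section \<open>Textile maps\<close>

definition coeffs_vec :: "'a fps ^ 'n \<Rightarrow> 'n \<times> nat \<Rightarrow> 'a" where
  "coeffs_vec y = (\<lambda>(j, n). fps_nth (y $ j) n)"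

definition coeffs_pair ::
    "('a fps ^ 'n) \<times> ('a fps ^ 'p) \<Rightarrow> 'n \<times> nat + 'p \<times> nat \<Rightarrow> 'a" where
  "coeffs_pair x = case_sum (coeffs_vec (fst x)) (coeffs_vec (snd x))"

definition quasi_affine_in :: "('a::field fps ^ 'n) set \<Rightarrow> ('a fps ^ 'n) set \<Rightarrow> bool" where
  "quasi_affine_in W Z \<longleftrightarrow>
     (\<exists>E F :: ('n \<times> nat, 'a) mps set. (\<forall>p \<in> E \<union> F. mps_is_poly p) \<and>
        Z = {z \<in> W. (\<forall>p\<in>E. mps_poly_eval p (coeffs_vec z) = 0) \<and>
                    (\<exists>p\<in>F. mps_poly_eval p (coeffs_vec z) \<noteq> 0)})"

text \<open>
  \<open>cX\<close> and \<open>cY\<close> read off the coefficients of the arguments and of the images. With \<open>q = (\<lambda>_. 1)\<close>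
  this is the textile property verbatim: each coefficient of the image is on \<open>X\<close> a polynomial in
  (automatically finitely many) coefficients of the argument.

  On a domain which is the part of a closed set where one polynomial \<open>q\<close> in the coefficients
  does not vanish, the polynomial functions have to be taken in the sense of quasi-affine varieties,
  i.e. \<open>1/q\<close> is a regular function as well. This cannot be dispensed with:
  in characteristic other than 2, for \<open>f = y\<^sup>2 / 2\<close>, \<open>g = y\<close> and \<open>d = 1\<close>, the requirements on \<open>\<chi>\<close> force
  \<open>\<chi> (z, v) = z + w\<close> with \<open>v = w + w\<^sup>2 / (2 z)\<close>, where \<open>z = z\<^sub>1 t\<close> and \<open>z\<^sub>1 \<noteq> 0\<close>; the coefficient
  of \<open>t\<^sup>3\<close> in \<open>v\<close> is \<open>w\<^sub>3 + w\<^sub>2\<^sup>2 / (2 z\<^sub>1)\<close>, not a polynomial in the \<open>z\<^sub>i\<close>, \<open>w\<^sub>i\<close> if the field is infinite.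
\<close>

definition textile_on ::
    "('x \<Rightarrow> 'i \<Rightarrow> 'a::field) \<Rightarrow> ('y \<Rightarrow> 'j \<Rightarrow> 'a) \<Rightarrow> ('x \<Rightarrow> 'a) \<Rightarrow> 'x set \<Rightarrow> ('x \<Rightarrow> 'y) \<Rightarrow> bool"
  where "textile_on cX cY q X F \<longleftrightarrow>
    (\<forall>j. \<exists>p e. mps_is_poly p \<and>
       (\<forall>x\<in>X. cY (F x) j = mps_poly_eval p (cX x) / q x ^ e))"

definition textile_iso_on ::
    "('x \<Rightarrow> 'i \<Rightarrow> 'a::field) \<Rightarrow> ('y \<Rightarrow> 'j \<Rightarrow> 'a) \<Rightarrow> ('x \<Rightarrow> 'a) \<Rightarrow> ('y \<Rightarrow> 'a) \<Rightarrow>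
     'x set \<Rightarrow> 'y set \<Rightarrow> ('x \<Rightarrow> 'y) \<Rightarrow> bool"
  where "textile_iso_on cX cY qX qY X Y F \<longleftrightarrow>
    bij_betw F X Y \<and> textile_on cX cY qX X F \<and> textile_on cY cX qY Y (inv_into X F)"

end

theory Submission
  imports Defs
begin

text \<open>
  Complete \<open>f\<close> by the coordinates outside the minor to a square system \<open>F\<close>, so that \<open>\<partial>F \<cdot> B = g \<cdot> 1\<close> for an
  explicit matrix \<open>B\<close>. With the Taylor error \<open>E(z, w) = F(z + w) - F(z) - \<partial>F(z) w\<close> put
  \<open>v = w + B(z) E(z, w) / g(z)\<close>; then \<open>F(z + w) = F(z) + \<partial>F(z) v\<close>. On \<open>w \<in> t\<^sup>d\<^sup>+\<^sup>1 A\<close> the correction term is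
  \<open>t\<close>-adically contracting, because \<open>E\<close> is quadratic and \<open>g(z)\<close> has order \<open>d\<close>. Hence \<open>w\<close> is obtained from
  \<open>v\<close> by Newton iteration, each coefficient being a polynomial in coefficients of \<open>z\<close>, \<open>v\<close> and
  \<open>1 / g\<^sub>d(z)\<close>, and \<open>z\<close> is the truncation of \<open>z + w\<close>.

  It remains to see that \<open>w\<close> is convergent or algebraic if \<open>z\<close> and \<open>v\<close> are. The convergent case is a
  majorant estimate on truncations. In the algebraic case one deforms the arc \<open>y = z + w\<close> in a second
  variable \<open>s\<close>, such that \<open>F(y + Y(s)) = F(y) + t\<^sup>2\<^sup>d s\<^sup>e\<close> with arbitrary weights \<open>e\<close>. This shows that \<open>t, F\<close>
  are algebraically independent, so the coordinates are algebraic over \<open>k(t, F)\<close>; restricting such a relation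
  to the curve, with weights for which it does not vanish, gives one for \<open>y + Y(s)\<close> over the algebraic
  series in \<open>t\<close>, and its coefficients in \<open>s\<close>, in particular \<open>y\<close>, are then algebraic.
\<close>

section \<open>Power series and polynomial evaluation\<close>

text \<open>For the square system the shape of \<open>v\<close> is forced: F(z + w) = F(z) + dF(z) v
  means dF(z) (v - w) = E(z, w), and dF(z) B(z) = g(z) solves this up to a division by g(z). That
  division is why \<open>w\<close> has to lie in t^(d+1): then E lies in t^(2d+2), the quotient
  still in t^(d+2), and g(z + w) agrees with g(z) up to degree d. So the order d and the coefficient
  g_d, the only denominator, are the same at both ends of the chart.

  The obstacle is that the fixed point is constructed formally, so nothing is known in advance about
  its growth or algebraicity. Norms are therefore taken of truncations, where they are finite, and
  bounded uniformly in the truncation order. In the algebraic case a relation satisfied by a power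
  series may vanish identically when restricted to the arc in question. The variable s removes this
  defect: along suitably weighted powers of s the leading coefficient of the relation survives, and
  s = 0 gives back the arc. The factor t^(2d) there pays for the division by g and leaves t^d for
  the increment.\<close>

lemma mps_nth_zero [simp]: "mps_nth 0 \<alpha> = 0"
  by (simp add: zero_mps_def)

lemma mps_nth_one: "mps_nth 1 \<alpha> = (if \<alpha> = {#} then 1 else 0)"
  by (simp add: one_mps_def)

lemma mps_nth_add [simp]: "mps_nth (f + g) \<alpha> = mps_nth f \<alpha> + mps_nth g \<alpha>"
  by (simp add: plus_mps_def)

lemma mps_nth_diff [simp]: "mps_nth (f - g) \<alpha> = mps_nth f \<alpha> - mps_nth g \<alpha>"
  by (simp add: minus_mps_def)

lemma mps_nth_uminus [simp]: "mps_nth (- f) \<alpha> = - mps_nth f \<alpha>"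
  by (simp add: uminus_mps_def)

lemma mps_nth_mult: "mps_nth (f * g) \<gamma> = (\<Sum>(\<alpha>, \<beta>)\<in>splits \<gamma>. mps_nth f \<alpha> * mps_nth g \<beta>)"
  by (simp add: times_mps_def)

lemma mps_nth_sum: "mps_nth (sum f A) \<alpha> = (\<Sum>i\<in>A. mps_nth (f i) \<alpha>)"
  by (induction A rule: infinite_finite_induct) auto

definition mps_const :: "'a \<Rightarrow> ('v, 'a::comm_ring_1) mps" where
  "mps_const c = Abs_mps (\<lambda>\<alpha>. if \<alpha> = {#} then c else 0)"

definition mps_var :: "'v \<Rightarrow> ('v, 'a::comm_ring_1) mps" where
  "mps_var x = Abs_mps (\<lambda>\<alpha>. if \<alpha> = {#x#} then 1 else 0)"

lemma mps_nth_const: "mps_nth (mps_const c) \<alpha> = (if \<alpha> = {#} then c else 0)"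
  by (simp add: mps_const_def)

lemma mps_nth_var: "mps_nth (mps_var x) \<alpha> = (if \<alpha> = {#x#} then 1 else 0)"
  by (simp add: mps_var_def)

lemma mps_nth_const_mult [simp]:
  fixes f :: "('b, 'a::comm_ring_1) mps"
  shows "mps_nth (mps_const c * f) \<gamma> = c * mps_nth f \<gamma>"
proof -
  have "mps_nth (mps_const c * f) \<gamma>
      = (\<Sum>(\<alpha>, \<beta>)\<in>splits \<gamma>. if \<alpha> = {#} then c * mps_nth f \<beta> else 0)"
    by (auto simp: mps_nth_mult mps_nth_const intro!: sum.cong)
  also have "\<dots> = (\<Sum>(\<alpha>, \<beta>)\<in>{({#} :: 'b multiset, \<gamma>)}. if \<alpha> = {#} then c * mps_nth f \<beta> else 0)"
    by (rule sum.mono_neutral_right[OF finite_splits]) (auto simp: splits_def split: if_splits)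
  finally show ?thesis by simp
qed

lemma mps_nth_mult_var:
  "mps_nth (f * mps_var v) \<gamma> = (if v \<in># \<gamma> then mps_nth f (\<gamma> - {#v#}) else 0)"
proof -
  have "mps_nth (f * mps_var v) \<gamma>
      = (\<Sum>(\<alpha>, \<beta>)\<in>splits \<gamma>. if \<beta> = {#v#} then mps_nth f \<alpha> else 0)"
    by (auto simp: mps_nth_mult mps_nth_var intro!: sum.cong)
  also have "\<dots> = (\<Sum>(\<alpha>, \<beta>)\<in>(if v \<in># \<gamma> then {(\<gamma> - {#v#}, {#v#})} else {}).
                      if \<beta> = {#v#} then mps_nth f \<alpha> else 0)"
    by (rule sum.mono_neutral_right[OF finite_splits]) (auto simp: splits_def split: if_splits)
  finally show ?thesis by simp
qed

lemma mps_const_0 [simp]: "mps_const 0 = 0"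
  by (rule mps_eqI) (simp add: mps_nth_const)

lemma mps_const_1 [simp]: "mps_const 1 = 1"
  by (rule mps_eqI) (simp add: mps_nth_const mps_nth_one)

lemma mps_const_add: "mps_const (a + b) = mps_const a + mps_const b"
  by (rule mps_eqI) (simp add: mps_nth_const)

lemma mps_const_mult: "mps_const (a * b) = mps_const a * mps_const b"
  by (rule mps_eqI) (simp add: mps_nth_const)

lemma mps_nth_deriv: "mps_nth (mps_deriv x f) \<alpha> = of_nat (Suc (count \<alpha> x)) * mps_nth f (add_mset x \<alpha>)"
  by (simp add: mps_deriv_def)

lemma mps_is_poly_add: "mps_is_poly f \<Longrightarrow> mps_is_poly g \<Longrightarrow> mps_is_poly (f + g)"
  unfolding mps_is_poly_def
  by (rule finite_subset[of _ "{\<alpha>. mps_nth f \<alpha> \<noteq> 0} \<union> {\<alpha>. mps_nth g \<alpha> \<noteq> 0}"]) auto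

lemma mps_is_poly_uminus: "mps_is_poly f \<Longrightarrow> mps_is_poly (- f)"
  by (simp add: mps_is_poly_def)

lemma mps_mult_support:
  "{\<gamma>. mps_nth (f * g) \<gamma> \<noteq> 0}
     \<subseteq> (\<lambda>(\<alpha>, \<beta>). \<alpha> + \<beta>) ` ({\<alpha>. mps_nth f \<alpha> \<noteq> 0} \<times> {\<alpha>. mps_nth g \<alpha> \<noteq> 0})"
proof
  fix \<gamma> assume "\<gamma> \<in> {\<gamma>. mps_nth (f * g) \<gamma> \<noteq> 0}"
  then have "(\<Sum>(\<alpha>, \<beta>)\<in>splits \<gamma>. mps_nth f \<alpha> * mps_nth g \<beta>) \<noteq> 0"
    by (simp add: mps_nth_mult)
  then obtain x where "x \<in> splits \<gamma>" "(case x of (\<alpha>, \<beta>) \<Rightarrow> mps_nth f \<alpha> * mps_nth g \<beta>) \<noteq> 0"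
    by (rule sum.not_neutral_contains_not_neutral)
  then show "\<gamma> \<in> (\<lambda>(\<alpha>, \<beta>). \<alpha> + \<beta>) ` ({\<alpha>. mps_nth f \<alpha> \<noteq> 0} \<times> {\<alpha>. mps_nth g \<alpha> \<noteq> 0})"
    by (intro image_eqI[of _ _ x]) (auto simp: splits_def)
qed

lemma mps_is_poly_mult: "mps_is_poly f \<Longrightarrow> mps_is_poly g \<Longrightarrow> mps_is_poly (f * g)"
  unfolding mps_is_poly_def by (rule finite_subset[OF mps_mult_support]) auto

lemma mps_is_poly_const [simp]: "mps_is_poly (mps_const c)"
  unfolding mps_is_poly_def
  by (rule finite_subset[of _ "{{#}}"]) (auto simp: mps_nth_const split: if_splits)

lemma mps_is_poly_var [simp]: "mps_is_poly (mps_var x)"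
  unfolding mps_is_poly_def
  by (rule finite_subset[of _ "{{#x#}}"]) (auto simp: mps_nth_var split: if_splits)

lemma mps_is_poly_0 [simp]: "mps_is_poly 0" and mps_is_poly_1 [simp]: "mps_is_poly 1"
  using mps_is_poly_const[of 0] mps_is_poly_const[of 1] by simp_all

section \<open>Ring homomorphisms and evaluation of polynomials\<close>

locale comm_ring_hom =
  fixes h :: "'a::comm_ring_1 \<Rightarrow> 'b::comm_ring_1"
  assumes hom_add: "h (x + y) = h x + h y"
    and hom_mult: "h (x * y) = h x * h y"
    and hom_one: "h 1 = 1"
begin

lemma hom_zero: "h 0 = 0"
  using hom_add[of 0 0] by simp

lemma hom_uminus: "h (- x) = - h x"
  using hom_add[of x "- x"] hom_zero by (simp add: eq_neg_iff_add_eq_0 add.commute)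

lemma hom_diff: "h (x - y) = h x - h y"
  using hom_add[of x "- y"] hom_uminus[of y] by simp

lemma hom_sum: "h (sum f A) = (\<Sum>i\<in>A. h (f i))"
  by (induction A rule: infinite_finite_induct) (auto simp: hom_zero hom_add)

lemma hom_prod_mset: "h (prod_mset (image_mset f M)) = prod_mset (image_mset (\<lambda>i. h (f i)) M)"
  by (induction M) (auto simp: hom_one hom_mult)

lemma hom_poly: "h (poly p x) = poly (map_poly h p) (h x)"
  by (induction p) (auto simp: hom_zero hom_add hom_mult map_poly_pCons)

end

text \<open>The map \<open>h\<close> carries the coefficients into the target ring, so that one
  definition serves values in the field, in series in one or two variables, and in the power series
  ring itself.\<close>

definition mps_eval :: "('a::comm_ring_1 \<Rightarrow> 'r::comm_ring_1) \<Rightarrow> ('v, 'a) mps \<Rightarrow> ('v \<Rightarrow> 'r) \<Rightarrow> 'r" where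
  "mps_eval h p x = (\<Sum>\<alpha> | mps_nth p \<alpha> \<noteq> 0. h (mps_nth p \<alpha>) * prod_mset (image_mset x \<alpha>))"

lemma mps_poly_eval_mps_eval: "mps_poly_eval p x = mps_eval (\<lambda>c. c) p x"
  by (simp add: mps_poly_eval_def mps_eval_def)

context comm_ring_hom
begin

lemma mps_eval_superset:
  assumes "finite F" "\<And>\<alpha>. mps_nth p \<alpha> \<noteq> 0 \<Longrightarrow> \<alpha> \<in> F"
  shows "mps_eval h p x = (\<Sum>\<alpha>\<in>F. h (mps_nth p \<alpha>) * prod_mset (image_mset x \<alpha>))"
  unfolding mps_eval_def by (rule sum.mono_neutral_left) (use assms in \<open>auto simp: hom_zero\<close>)

lemma mps_eval_0: "mps_eval h 0 x = 0"
  by (simp add: mps_eval_def)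

lemma mps_eval_const: "mps_eval h (mps_const c) x = h c"
  by (subst mps_eval_superset[of "{{#}}"]) (auto simp: mps_nth_const split: if_splits)

lemma mps_eval_1: "mps_eval h 1 x = 1"
  using mps_eval_const[of 1] by (simp add: hom_one)

lemma mps_eval_var: "mps_eval h (mps_var v) x = x v"
  by (subst mps_eval_superset[of "{{#v#}}"]) (auto simp: mps_nth_var hom_one split: if_splits)

lemma mps_eval_add:
  assumes "mps_is_poly p" "mps_is_poly q"
  shows "mps_eval h (p + q) x = mps_eval h p x + mps_eval h q x"
proof -
  define F where "F = {\<alpha>. mps_nth p \<alpha> \<noteq> 0} \<union> {\<alpha>. mps_nth q \<alpha> \<noteq> 0}"
  have "finite F" using assms by (simp add: F_def mps_is_poly_def)
  then show ?thesis
    by (subst (1 2 3) mps_eval_superset[of F])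
       (auto simp: F_def hom_add sum.distrib ring_distribs)
qed

lemma mps_eval_mult:
  assumes "mps_is_poly p" "mps_is_poly q"
  shows "mps_eval h (p * q) x = mps_eval h p x * mps_eval h q x"
proof -
  define P Q where "P = {\<alpha>. mps_nth p \<alpha> \<noteq> 0}" and "Q = {\<alpha>. mps_nth q \<alpha> \<noteq> 0}"
  define F where "F = (\<lambda>(\<alpha>, \<beta>). \<alpha> + \<beta>) ` (P \<times> Q)"
  let ?t = "\<lambda>\<alpha> \<beta>. h (mps_nth p \<alpha>) * h (mps_nth q \<beta>) * prod_mset (image_mset x (\<alpha> + \<beta>))"
  have fin: "finite P" "finite Q" using assms by (simp_all add: P_def Q_def mps_is_poly_def)
  then have finF: "finite F" by (simp add: F_def)
  have "mps_eval h (p * q) x = (\<Sum>\<gamma>\<in>F. h (mps_nth (p * q) \<gamma>) * prod_mset (image_mset x \<gamma>))"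
    by (rule mps_eval_superset[OF finF]) (use mps_mult_support[of p q] in \<open>auto simp: F_def P_def Q_def\<close>)
  also have "\<dots> = (\<Sum>\<gamma>\<in>F. \<Sum>(\<alpha>, \<beta>)\<in>splits \<gamma>. ?t \<alpha> \<beta>)"
    by (intro sum.cong refl)
       (auto simp: mps_nth_mult hom_sum hom_mult sum_distrib_right case_prod_unfold splits_def
             intro!: sum.cong)
  also have "\<dots> = (\<Sum>(\<gamma>, \<alpha>, \<beta>)\<in>Sigma F splits. ?t \<alpha> \<beta>)"
    by (subst sum.Sigma[symmetric]) (auto simp: finF case_prod_unfold)
  also have "\<dots> = (\<Sum>(\<gamma>, \<alpha>, \<beta>)\<in>(\<lambda>(\<alpha>, \<beta>). (\<alpha> + \<beta>, \<alpha>, \<beta>)) ` (P \<times> Q). ?t \<alpha> \<beta>)"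
    by (rule sum.mono_neutral_right, rule finite_SigmaI[OF finF finite_splits])
       (auto simp: F_def splits_def P_def Q_def hom_zero image_iff)
  also have "\<dots> = (\<Sum>(\<alpha>, \<beta>)\<in>P \<times> Q. ?t \<alpha> \<beta>)"
    by (subst sum.reindex) (auto simp: inj_on_def case_prod_unfold)
  also have "\<dots> = mps_eval h p x * mps_eval h q x"
    by (simp add: mps_eval_def P_def Q_def sum_product sum.cartesian_product mult_ac)
  finally show ?thesis .
qed

end

lemma mps_eval_hom:
  assumes "comm_ring_hom \<phi>"
  shows "\<phi> (mps_eval h p x) = mps_eval (\<lambda>c. \<phi> (h c)) p (\<lambda>v. \<phi> (x v))"
proof -
  interpret comm_ring_hom \<phi> by fact
  show ?thesis by (simp add: mps_eval_def hom_sum hom_mult hom_prod_mset)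
qed

lemma hom_mps_const: "comm_ring_hom mps_const"
  by unfold_locales (simp_all add: mps_const_add mps_const_mult)

lemma mps_nth_monom:
  "mps_nth (prod_mset (image_mset mps_var \<alpha>) :: ('v, 'a::comm_ring_1) mps) \<gamma> = (if \<gamma> = \<alpha> then 1 else 0)"
proof (induction \<alpha> arbitrary: \<gamma>)
  case (add v \<alpha>)
  have "mps_nth (prod_mset (image_mset mps_var (add_mset v \<alpha>)) :: ('v, 'a) mps) \<gamma>
     = mps_nth (prod_mset (image_mset mps_var \<alpha>) * mps_var v) \<gamma>"
    by (simp add: mult.commute)
  also have "\<dots> = (if \<gamma> = add_mset v \<alpha> then 1 else 0)"
    by (subst mps_nth_mult_var) (auto simp: add.IH dest!: multi_member_split)
  finally show ?case .
qed (simp add: mps_nth_one)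

lemma mps_eval_var_self:
  assumes "mps_is_poly p"
  shows "mps_eval mps_const p mps_var = p"
proof (rule mps_eqI)
  fix \<gamma>
  have "mps_nth (mps_eval mps_const p mps_var) \<gamma>
      = (\<Sum>\<alpha> | mps_nth p \<alpha> \<noteq> 0. if \<alpha> = \<gamma> then mps_nth p \<alpha> else 0)"
    by (auto simp: mps_eval_def mps_nth_sum mps_nth_monom intro!: sum.cong)
  also have "\<dots> = mps_nth p \<gamma>"
    using assms by (subst sum.delta) (auto simp: mps_is_poly_def)
  finally show "mps_nth (mps_eval mps_const p mps_var) \<gamma> = mps_nth p \<gamma>" .
qed

lemma finite_size_le: "finite {\<alpha> :: 'v::finite multiset. size \<alpha> \<le> n}"
proof (induction n)
  case (Suc n)
  have "{\<alpha> :: 'v multiset. size \<alpha> \<le> Suc n}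
     \<subseteq> insert {#} ((\<lambda>(x, \<alpha>). add_mset x \<alpha>) ` (UNIV \<times> {\<alpha>. size \<alpha> \<le> n}))"
  proof
    fix \<alpha> :: "'v multiset" assume "\<alpha> \<in> {\<alpha>. size \<alpha> \<le> Suc n}"
    then show "\<alpha> \<in> insert {#} ((\<lambda>(x, \<alpha>). add_mset x \<alpha>) ` (UNIV \<times> {\<alpha>. size \<alpha> \<le> n}))"
      by (cases \<alpha>) auto
  qed
  moreover have "finite (insert {#} ((\<lambda>(x, \<alpha>). add_mset x \<alpha>) ` (UNIV \<times> {\<alpha> :: 'v multiset. size \<alpha> \<le> n})))"
    using Suc by simp
  ultimately show ?case by (rule finite_subset)
qed simp

text \<open>Two increments \<open>a\<close> and \<open>b\<close> are compared, instead of one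
  increment with 0: the second-order error is then small of the size of the increments times the
  size of their difference. This Lipschitz form is what makes the later iterations
  contracting.\<close>

lemma monom_taylor_dvd:
  fixes z a b :: "'v::finite \<Rightarrow> 'r::comm_ring_1"
  assumes ua: "\<And>j. u dvd a j" and ub: "\<And>j. u dvd b j" and u': "\<And>j. u' dvd a j - b j"
  shows "u * u' dvd prod_mset (image_mset (\<lambda>j. z j + a j) \<alpha>) - prod_mset (image_mset (\<lambda>j. z j + b j) \<alpha>)
     - (\<Sum>j\<in>UNIV. of_nat (count \<alpha> j) * prod_mset (image_mset z (\<alpha> - {#j#})) * (a j - b j))"
proof (induction \<alpha>)
  case (add x \<alpha>)
  let ?m = "\<lambda>y \<alpha>. prod_mset (image_mset y \<alpha>)"
  let ?A = "?m (\<lambda>j. z j + a j) \<alpha>" and ?B = "?m (\<lambda>j. z j + b j) \<alpha>"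
  let ?D = "\<lambda>\<alpha>. \<Sum>j\<in>UNIV. of_nat (count \<alpha> j) * ?m z (\<alpha> - {#j#}) * (a j - b j)"
  have *: "of_nat (count (add_mset x \<alpha>) j) * ?m z (add_mset x \<alpha> - {#j#})
      = z x * (of_nat (count \<alpha> j) * ?m z (\<alpha> - {#j#})) + (if j = x then ?m z \<alpha> else 0)" for j
  proof (cases "j \<in># \<alpha>")
    case True
    then obtain \<beta> where "\<alpha> = add_mset j \<beta>" by (auto dest: multi_member_split)
    then show ?thesis by (auto simp: algebra_simps)
  qed (auto simp: not_in_iff)
  have "?D (add_mset x \<alpha>) = (\<Sum>j\<in>UNIV. z x * (of_nat (count \<alpha> j) * ?m z (\<alpha> - {#j#}) * (a j - b j))
      + (if j = x then ?m z \<alpha> * (a j - b j) else 0))"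
    unfolding * by (intro sum.cong refl) (simp add: algebra_simps)
  also have "\<dots> = z x * ?D \<alpha> + ?m z \<alpha> * (a x - b x)"
    by (simp add: sum.distrib sum_distrib_left)
  finally have D: "?D (add_mset x \<alpha>) = z x * ?D \<alpha> + ?m z \<alpha> * (a x - b x)" .
  \<comment> \<open>The first-order version, applied below to \<open>a\<close> against 0 and to
    \<open>a\<close> against \<open>b\<close>.\<close>
  have gen: "w dvd ?m (\<lambda>j. z j + c j) \<alpha> - ?m (\<lambda>j. z j + c' j) \<alpha>"
    if "\<And>j. w dvd c j - c' j" for w c c'
  proof (induction \<alpha>)
    case (add y \<beta>)
    have "?m (\<lambda>j. z j + c j) (add_mset y \<beta>) - ?m (\<lambda>j. z j + c' j) (add_mset y \<beta>)
       = (c y - c' y) * ?m (\<lambda>j. z j + c j) \<beta> + (z y + c' y) * (?m (\<lambda>j. z j + c j) \<beta> - ?m (\<lambda>j. z j + c' j) \<beta>)"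
      by (simp add: algebra_simps)
    then show ?case using that[of y] add by simp
  qed simp
  have 1: "u dvd ?A - ?m z \<alpha>" using gen[of u a "\<lambda>_. 0"] ua by simp
  have 2: "u' dvd ?A - ?B" using gen[of u' a b] u' by simp
  have "?m (\<lambda>j. z j + a j) (add_mset x \<alpha>) - ?m (\<lambda>j. z j + b j) (add_mset x \<alpha>) - ?D (add_mset x \<alpha>)
     = z x * (?A - ?B - ?D \<alpha>) + (?A - ?m z \<alpha>) * (a x - b x) + b x * (?A - ?B)"
    unfolding D by (simp add: algebra_simps)
  also have "u * u' dvd \<dots>"
    using add 1 2 u'[of x] ub[of x] by (intro dvd_add dvd_mult mult_dvd_mono) auto
  finally show ?case .
qed simp

lemma (in comm_ring_hom) mps_eval_deriv:
  fixes p :: "('v, 'a) mps"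
  assumes "mps_is_poly p"
  shows "mps_eval h (mps_deriv j p) z
     = (\<Sum>\<alpha> | mps_nth p \<alpha> \<noteq> 0. h (mps_nth p \<alpha>) * (of_nat (count \<alpha> j) * prod_mset (image_mset z (\<alpha> - {#j#}))))"
proof -
  have hnat: "h (of_nat n) = of_nat n" for n
    by (induction n) (auto simp: hom_zero hom_one hom_add)
  define P where "P = {\<alpha>. mps_nth p \<alpha> \<noteq> 0}"
  have fin: "finite P" using assms by (simp add: P_def mps_is_poly_def)
  define G where "G = {\<beta>. add_mset j \<beta> \<in> P}"
  have Gi: "add_mset j ` G = {\<alpha>\<in>P. j \<in># \<alpha>}"
    by (auto simp: G_def image_iff dest: multi_member_split)
  have finG: "finite G"
    by (rule finite_imageD[of "add_mset j"]) (use fin Gi in \<open>auto simp: inj_on_def\<close>)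
  have "mps_eval h (mps_deriv j p) z
      = (\<Sum>\<beta>\<in>G. h (mps_nth (mps_deriv j p) \<beta>) * prod_mset (image_mset z \<beta>))"
    by (rule mps_eval_superset[OF finG]) (auto simp: G_def P_def mps_nth_deriv)
  also have "\<dots> = (\<Sum>\<alpha>\<in>add_mset j ` G. h (mps_nth p \<alpha>) * (of_nat (count \<alpha> j) * prod_mset (image_mset z (\<alpha> - {#j#}))))"
    by (subst sum.reindex) (auto simp: inj_on_def mps_nth_deriv hom_mult hom_add hom_one hnat algebra_simps intro!: sum.cong)
  also have "\<dots> = (\<Sum>\<alpha>\<in>P. h (mps_nth p \<alpha>) * (of_nat (count \<alpha> j) * prod_mset (image_mset z (\<alpha> - {#j#}))))"
    unfolding Gi by (rule sum.mono_neutral_left) (auto simp: fin not_in_iff)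
  finally show ?thesis by (simp add: P_def)
qed

text \<open>Kept as an identity, since the monomial errors on the right are later estimated in two
  ways: by divisibility and by truncated norms.\<close>

lemma (in comm_ring_hom) mps_eval_taylor_sum:
  fixes p :: "('v::finite, 'a) mps"
  assumes "mps_is_poly p"
  shows "mps_eval h p (\<lambda>j. z j + a j) - mps_eval h p (\<lambda>j. z j + b j)
       - (\<Sum>j\<in>UNIV. mps_eval h (mps_deriv j p) z * (a j - b j))
     = (\<Sum>\<alpha> | mps_nth p \<alpha> \<noteq> 0. h (mps_nth p \<alpha>) *
         (prod_mset (image_mset (\<lambda>j. z j + a j) \<alpha>) - prod_mset (image_mset (\<lambda>j. z j + b j) \<alpha>) -
          (\<Sum>j\<in>UNIV. of_nat (count \<alpha> j) * prod_mset (image_mset z (\<alpha> - {#j#})) * (a j - b j))))"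
proof -
  let ?m = "\<lambda>y \<alpha>. prod_mset (image_mset y \<alpha>)"
  have "(\<Sum>j\<in>UNIV. mps_eval h (mps_deriv j p) z * (a j - b j))
     = (\<Sum>j\<in>UNIV. \<Sum>\<alpha> | mps_nth p \<alpha> \<noteq> 0. h (mps_nth p \<alpha>) * (of_nat (count \<alpha> j) * ?m z (\<alpha> - {#j#}) * (a j - b j)))"
    by (simp add: mps_eval_deriv[OF assms(1)] sum_distrib_right mult.assoc)
  also have "\<dots> = (\<Sum>\<alpha> | mps_nth p \<alpha> \<noteq> 0. h (mps_nth p \<alpha>) * (\<Sum>j\<in>UNIV. of_nat (count \<alpha> j) * ?m z (\<alpha> - {#j#}) * (a j - b j)))"
    by (subst sum.swap) (simp add: sum_distrib_left)
  finally show ?thesis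
    by (simp add: mps_eval_def sum_subtractf right_diff_distrib)
qed

lemma (in comm_ring_hom) mps_eval_taylor_dvd:
  fixes p :: "('v::finite, 'a) mps"
  assumes "mps_is_poly p"
    and "\<And>j. u dvd a j" and "\<And>j. u dvd b j" and "\<And>j. u' dvd a j - b j"
  shows "u * u' dvd mps_eval h p (\<lambda>j. z j + a j) - mps_eval h p (\<lambda>j. z j + b j)
     - (\<Sum>j\<in>UNIV. mps_eval h (mps_deriv j p) z * (a j - b j))"
  unfolding mps_eval_taylor_sum[OF assms(1)]
  by (intro dvd_sum dvd_mult monom_taylor_dvd assms)

section \<open>Algebraic dependence over subrings\<close>

definition subring_set :: "'r::comm_ring_1 set \<Rightarrow> bool" where
  "subring_set S \<longleftrightarrow> 1 \<in> S \<and> (\<forall>x\<in>S. \<forall>y\<in>S. x - y \<in> S \<and> x * y \<in> S)"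

context
  fixes S :: "'r::comm_ring_1 set"
  assumes S: "subring_set S"
begin

lemma subring_set_1: "1 \<in> S"
  and subring_set_diff: "x \<in> S \<Longrightarrow> y \<in> S \<Longrightarrow> x - y \<in> S"
  and subring_set_mult: "x \<in> S \<Longrightarrow> y \<in> S \<Longrightarrow> x * y \<in> S"
  using S by (auto simp: subring_set_def)

lemma subring_set_0: "0 \<in> S"
  using subring_set_diff[OF subring_set_1 subring_set_1] by simp

lemma subring_set_uminus: "x \<in> S \<Longrightarrow> - x \<in> S"
  using subring_set_diff[OF subring_set_0, of x] by simp

lemma subring_set_add: "x \<in> S \<Longrightarrow> y \<in> S \<Longrightarrow> x + y \<in> S"
  using subring_set_diff[of x "- y"] subring_set_uminus by simp

lemma subring_set_sum: "(\<And>i. i \<in> A \<Longrightarrow> f i \<in> S) \<Longrightarrow> sum f A \<in> S"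
  by (induction A rule: infinite_finite_induct) (auto simp: subring_set_0 subring_set_add)

lemma subring_set_prod: "(\<And>i. i \<in> A \<Longrightarrow> f i \<in> S) \<Longrightarrow> prod f A \<in> S"
  by (induction A rule: infinite_finite_induct) (auto simp: subring_set_1 subring_set_mult)

lemma subring_set_power: "x \<in> S \<Longrightarrow> x ^ n \<in> S"
  by (induction n) (auto simp: subring_set_1 subring_set_mult)

lemma subring_set_prod_mset: "(\<And>i. i \<in># A \<Longrightarrow> f i \<in> S) \<Longrightarrow> prod_mset (image_mset f A) \<in> S"
  by (induction A) (auto simp: subring_set_1 subring_set_mult)

lemma subring_set_poly: "(\<And>i. coeff p i \<in> S) \<Longrightarrow> x \<in> S \<Longrightarrow> poly p x \<in> S"
  unfolding poly_altdef by (intro subring_set_sum subring_set_mult subring_set_power) auto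

text \<open>Elimination of one unknown at a time, without division.\<close>

lemma homogeneous_system_solution:
  assumes idom: "\<And>x y :: 'r. x * y = 0 \<Longrightarrow> x = 0 \<or> y = 0"
    and "finite I" "finite X" "card I < card X"
    and "\<And>i x. i \<in> I \<Longrightarrow> x \<in> X \<Longrightarrow> a i x \<in> S"
  shows "\<exists>c. (\<forall>x\<in>X. c x \<in> S) \<and> (\<exists>x\<in>X. c x \<noteq> 0) \<and> (\<forall>i\<in>I. (\<Sum>x\<in>X. a i x * c x) = 0)"
  using assms(2-)
proof (induction I arbitrary: X a rule: finite_induct)
  case empty
  then have "X \<noteq> {}" by auto
  then show ?case by (intro exI[of _ "\<lambda>_. 1"]) (auto simp: subring_set_1)
next
  case (insert e I)
  show ?case
  proof (cases "\<forall>x\<in>X. a e x = 0")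
    case True
    then show ?thesis using insert.IH[of X a] insert.prems insert.hyps by auto
  next
    case False
    then obtain p where p: "p \<in> X" "a e p \<noteq> 0" by blast
    define b where "b i x = a e p * a i x - a i p * a e x" for i x
    have "\<exists>c. (\<forall>x\<in>X - {p}. c x \<in> S) \<and> (\<exists>x\<in>X - {p}. c x \<noteq> 0) \<and>
          (\<forall>i\<in>I. (\<Sum>x\<in>X - {p}. b i x * c x) = 0)"
      using insert.prems insert.hyps p
      by (intro insert.IH) (auto simp: b_def intro!: subring_set_diff subring_set_mult)
    then obtain c where c: "\<And>x. x \<in> X - {p} \<Longrightarrow> c x \<in> S" "\<exists>x\<in>X - {p}. c x \<noteq> 0"
      "\<And>i. i \<in> I \<Longrightarrow> (\<Sum>x\<in>X - {p}. b i x * c x) = 0" by blast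
    define c' where "c' x = (if x = p then - (\<Sum>x\<in>X - {p}. a e x * c x) else a e p * c x)" for x
    have split: "(\<Sum>x\<in>X. a i x * c' x)
        = a e p * (\<Sum>x\<in>X - {p}. a i x * c x) - a i p * (\<Sum>x\<in>X - {p}. a e x * c x)" for i
    proof -
      have "(\<Sum>x\<in>X. a i x * c' x) = a i p * c' p + (\<Sum>x\<in>X - {p}. a i x * c' x)"
        using insert.prems p by (simp add: sum.remove)
      also have "(\<Sum>x\<in>X - {p}. a i x * c' x) = a e p * (\<Sum>x\<in>X - {p}. a i x * c x)"
        by (auto simp: sum_distrib_left c'_def mult_ac intro!: sum.cong)
      finally show ?thesis by (simp add: c'_def)
    qed
    show ?thesis
    proof (intro exI[of _ c'] conjI ballI)
      show "c' x \<in> S" if "x \<in> X" for x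
        using that c(1) p insert.prems
        by (auto simp: c'_def intro!: subring_set_uminus subring_set_sum subring_set_mult)
      show "\<exists>x\<in>X. c' x \<noteq> 0"
        using c(2) p idom by (auto simp: c'_def)
      fix i assume i: "i \<in> insert e I"
      show "(\<Sum>x\<in>X. a i x * c' x) = 0"
      proof (cases "i = e")
        case True then show ?thesis by (simp add: split)
      next
        case False
        then have "(\<Sum>x\<in>X - {p}. b i x * c x) = 0" using c(3) i by auto
        then show ?thesis
          unfolding split b_def
          by (simp add: left_diff_distrib sum_subtractf sum_distrib_left mult.assoc)
      qed
    qed
  qed
qed

end

text \<open>The leading coefficient is arbitrary, so this is algebraicity over the fraction field of
  \<open>S\<close>, expressed without forming fractions.\<close>

definition alg_over :: "'r::idom set \<Rightarrow> 'r \<Rightarrow> bool" where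
  "alg_over S x \<longleftrightarrow> (\<exists>P. P \<noteq> 0 \<and> (\<forall>i. coeff P i \<in> S) \<and> poly P x = 0)"

lemma alg_over_mono: "alg_over S x \<Longrightarrow> S \<subseteq> T \<Longrightarrow> alg_over T x"
  unfolding alg_over_def by blast

lemma alg_over_self:
  assumes "subring_set S" "x \<in> S" shows "alg_over S x"
  unfolding alg_over_def
  by (intro exI[of _ "[:- x, 1:]"])
     (auto simp: coeff_pCons split: nat.splits intro: subring_set_uminus subring_set_1 subring_set_0 assms)

text \<open>The elements of \<open>R\<close> which become linear combinations of the \<open>B i\<close> over the fraction field of \<open>S\<close>.\<close>

definition frac_span :: "'r::idom set \<Rightarrow> 'i set \<Rightarrow> ('i \<Rightarrow> 'r) \<Rightarrow> 'r set" where
  "frac_span S I B = {x. \<exists>D\<in>S. D \<noteq> 0 \<and> (\<exists>s. (\<forall>i\<in>I. s i \<in> S) \<and> D * x = (\<Sum>i\<in>I. s i * B i))}"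

context
  fixes S :: "'r::idom set" and I :: "'i set" and B :: "'i \<Rightarrow> 'r"
  assumes S: "subring_set S" and I: "finite I"
begin

lemma frac_span_base: "i \<in> I \<Longrightarrow> B i \<in> frac_span S I B"
  unfolding frac_span_def using I
  by (auto intro!: bexI[of _ 1] exI[of _ "\<lambda>j. if j = i then 1 else 0"]
      simp: subring_set_1[OF S] subring_set_0[OF S] if_distrib[of "\<lambda>x. x * _"] sum.delta cong: if_cong)

lemma frac_span_0: "0 \<in> frac_span S I B"
  unfolding frac_span_def
  by (auto intro!: bexI[of _ 1] exI[of _ "\<lambda>j. 0"] simp: subring_set_1[OF S] subring_set_0[OF S])

lemma frac_span_add:
  assumes "x \<in> frac_span S I B" "y \<in> frac_span S I B" shows "x + y \<in> frac_span S I B"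
proof -
  obtain D s where 1: "D \<in> S" "D \<noteq> 0" "\<And>i. i \<in> I \<Longrightarrow> s i \<in> S" "D * x = (\<Sum>i\<in>I. s i * B i)"
    using assms(1) by (auto simp: frac_span_def)
  obtain D' s' where 2: "D' \<in> S" "D' \<noteq> 0" "\<And>i. i \<in> I \<Longrightarrow> s' i \<in> S" "D' * y = (\<Sum>i\<in>I. s' i * B i)"
    using assms(2) by (auto simp: frac_span_def)
  have "(D * D') * (x + y) = D' * (D * x) + D * (D' * y)" by (simp add: algebra_simps)
  also have "\<dots> = (\<Sum>i\<in>I. (D' * s i + D * s' i) * B i)"
    unfolding 1(4) 2(4) by (simp add: sum_distrib_left sum.distrib[symmetric] algebra_simps)
  finally show ?thesis
    unfolding frac_span_def using 1 2
    by (auto intro!: bexI[of _ "D * D'"] exI[of _ "\<lambda>i. D' * s i + D * s' i"]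
          subring_set_add[OF S] subring_set_mult[OF S])
qed

lemma frac_span_scale:
  assumes "x \<in> frac_span S I B" "c \<in> S" shows "c * x \<in> frac_span S I B"
proof -
  obtain D s where 1: "D \<in> S" "D \<noteq> 0" "\<And>i. i \<in> I \<Longrightarrow> s i \<in> S" "D * x = (\<Sum>i\<in>I. s i * B i)"
    using assms(1) by (auto simp: frac_span_def)
  have "D * (c * x) = c * (D * x)" by (rule mult.left_commute)
  also have "\<dots> = (\<Sum>i\<in>I. (c * s i) * B i)"
    unfolding 1(4) by (simp add: sum_distrib_left mult.assoc)
  finally have "D * (c * x) = (\<Sum>i\<in>I. (c * s i) * B i)" .
  then show ?thesis
    unfolding frac_span_def using 1 assms(2)
    by (auto intro!: bexI[of _ "D"] exI[of _ "\<lambda>i. c * s i"] subring_set_mult[OF S])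
qed

lemma frac_span_cancel:
  assumes "c * x \<in> frac_span S I B" "c \<in> S" "c \<noteq> 0" shows "x \<in> frac_span S I B"
proof -
  obtain D s where 1: "D \<in> S" "D \<noteq> 0" "\<And>i. i \<in> I \<Longrightarrow> s i \<in> S" "D * (c * x) = (\<Sum>i\<in>I. s i * B i)"
    using assms(1) by (auto simp: frac_span_def)
  then show ?thesis
    unfolding frac_span_def using assms(2,3)
    by (auto intro!: bexI[of _ "D * c"] exI[of _ s] subring_set_mult[OF S] simp: mult.assoc)
qed

lemma frac_span_sum: "(\<And>j. j \<in> J \<Longrightarrow> f j \<in> frac_span S I B) \<Longrightarrow> sum f J \<in> frac_span S I B"
  by (induction J rule: infinite_finite_induct) (auto simp: frac_span_0 frac_span_add)

lemma frac_span_minimal: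
  assumes "x \<in> frac_span S I B" and Y: "\<And>i. i \<in> I \<Longrightarrow> z * B i \<in> frac_span S I B"
  shows "z * x \<in> frac_span S I B"
proof -
  obtain D s where 1: "D \<in> S" "D \<noteq> 0" "\<And>i. i \<in> I \<Longrightarrow> s i \<in> S" "D * x = (\<Sum>i\<in>I. s i * B i)"
    using assms(1) by (auto simp: frac_span_def)
  have "D * (z * x) = z * (D * x)" by (rule mult.left_commute)
  also have "\<dots> = (\<Sum>i\<in>I. s i * (z * B i))"
    unfolding 1(4) by (simp add: sum_distrib_left mult.left_commute)
  also have "\<dots> \<in> frac_span S I B"
    by (intro frac_span_sum frac_span_scale 1 Y)
  finally show ?thesis using 1 frac_span_cancel by blast
qed

text \<open>Dimension count in place of the Cayley-Hamilton theorem: the \<open>card I + 1\<close>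
  elements \<open>z ^ n * B i0\<close> lie in a space of dimension at most \<open>card I\<close>
  over the fraction field of \<open>S\<close>, and a linear dependence among them, cancelled by
  \<open>B i0\<close>, is an equation for \<open>z\<close>.\<close>

lemma alg_over_if_stable:
  assumes i0: "i0 \<in> I" "B i0 \<noteq> 0" and Y: "\<And>i. i \<in> I \<Longrightarrow> z * B i \<in> frac_span S I B"
  shows "alg_over S z"
proof -
  have "z ^ n * B i0 \<in> frac_span S I B" for n
  proof (induction n)
    case (Suc n)
    then show ?case using frac_span_minimal[OF Suc Y] by (simp add: mult.assoc)
  qed (simp add: frac_span_base i0)
  then have "\<forall>n. \<exists>D s. D \<in> S \<and> D \<noteq> 0 \<and> (\<forall>i\<in>I. s i \<in> S) \<and> D * (z ^ n * B i0) = (\<Sum>i\<in>I. s i * B i)"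
    unfolding frac_span_def by fast
  then obtain D s where D: "\<And>n. D n \<in> S" "\<And>n. D n \<noteq> 0" "\<And>n i. i \<in> I \<Longrightarrow> s n i \<in> S"
      "\<And>n. D n * (z ^ n * B i0) = (\<Sum>i\<in>I. s n i * B i)"
    by metis
  define N where "N = card I"
  have "\<exists>c. (\<forall>n\<in>{..N}. c n \<in> S) \<and> (\<exists>n\<in>{..N}. c n \<noteq> 0) \<and> (\<forall>i\<in>I. (\<Sum>n\<in>{..N}. s n i * c n) = 0)"
    by (rule homogeneous_system_solution[OF S]) (use I D in \<open>auto simp: N_def\<close>)
  then obtain c where c: "\<And>n. n \<le> N \<Longrightarrow> c n \<in> S" "\<exists>n\<le>N. c n \<noteq> 0"
      "\<And>i. i \<in> I \<Longrightarrow> (\<Sum>n\<in>{..N}. s n i * c n) = 0" by (auto simp: Bex_def)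
  \<comment> \<open>\<open>D n\<close> clears the denominators of \<open>z ^ n * B i0\<close>; a
    dependence \<open>c\<close> of the numerators thus becomes one of the powers of
    \<open>z\<close>, with coefficients \<open>c n * D n\<close>.\<close>
  define P where "P = (\<Sum>n\<le>N. monom (c n * D n) n)"
  have coeffP: "coeff P n = (if n \<le> N then c n * D n else 0)" for n
    by (simp add: P_def coeff_sum)
  have "poly P z * B i0 = (\<Sum>n\<le>N. c n * (D n * (z ^ n * B i0)))"
    by (simp add: P_def poly_sum poly_monom sum_distrib_right mult.assoc)
  also have "\<dots> = (\<Sum>i\<in>I. (\<Sum>n\<le>N. s n i * c n) * B i)"
    unfolding D(4) sum_distrib_left sum_distrib_right by (subst sum.swap) (simp add: mult_ac)
  also have "\<dots> = 0" by (simp add: c(3))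
  finally have "poly P z = 0" using i0 by simp
  moreover have "P \<noteq> 0"
    using c(2) D(2) by (metis coeffP coeff_0 mult_eq_0_iff)
  moreover have "coeff P n \<in> S" for n
    using c D by (auto simp: coeffP subring_set_0[OF S] intro: subring_set_mult[OF S])
  ultimately show ?thesis unfolding alg_over_def by blast
qed

end

section \<open>Simple extensions and transitivity of algebraicity\<close>

definition adjoin :: "'r::comm_ring_1 set \<Rightarrow> 'r \<Rightarrow> 'r set" where
  "adjoin S c = {poly P c | P. \<forall>i. coeff P i \<in> S}"

lemma adjoin_I: "(\<And>i. coeff P i \<in> S) \<Longrightarrow> poly P c \<in> adjoin S c"
  unfolding adjoin_def by blast

lemma subring_set_adjoin:
  assumes S: "subring_set S" shows "subring_set (adjoin S c)"
  unfolding subring_set_def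
proof (intro conjI ballI)
  show "1 \<in> adjoin S c"
    using adjoin_I[of 1 S c] subring_set_1[OF S] subring_set_0[OF S] by (auto simp: coeff_1)
  fix x y assume "x \<in> adjoin S c" "y \<in> adjoin S c"
  then obtain P Q where P: "\<And>i. coeff P i \<in> S" "x = poly P c" and Q: "\<And>i. coeff Q i \<in> S" "y = poly Q c"
    by (auto simp: adjoin_def)
  show "x - y \<in> adjoin S c"
    unfolding P(2) Q(2) poly_diff[symmetric] using P(1) Q(1)
    by (intro adjoin_I) (auto intro!: subring_set_diff[OF S])
  show "x * y \<in> adjoin S c"
    unfolding P(2) Q(2) poly_mult[symmetric] using P(1) Q(1)
    by (intro adjoin_I) (auto simp: coeff_mult intro!: subring_set_sum[OF S] subring_set_mult[OF S])
qed

lemma adjoin_superset: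
  assumes S: "subring_set S" shows "S \<subseteq> adjoin S c"
proof
  fix x assume "x \<in> S"
  then have "coeff [:x:] i \<in> S" for i
    by (cases i) (auto simp: subring_set_0[OF S])
  then show "x \<in> adjoin S c" using adjoin_I[of "[:x:]" S c] by simp
qed

lemma adjoin_self:
  assumes S: "subring_set S" shows "c \<in> adjoin S c"
proof -
  have "coeff [:0, 1:] i \<in> S" for i
    by (auto simp: coeff_pCons subring_set_0[OF S] subring_set_1[OF S] split: nat.splits)
  then show ?thesis using adjoin_I[of "[:0, 1:]" S c] by simp
qed

lemma alg_over_relation:
  assumes "alg_over S c"
  obtains p r s where "p \<in> S" "p \<noteq> 0" "r > 0" "\<And>j. s j \<in> S" "p * c ^ r = (\<Sum>j<r. - s j * c ^ j)"
proof -
  obtain P where P: "P \<noteq> 0" "\<And>i. coeff P i \<in> S" "poly P c = 0"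
    using assms by (auto simp: alg_over_def)
  have "degree P > 0"
    using P by (auto elim!: degree_eq_zeroE intro!: gr0I)
  moreover have "lead_coeff P * c ^ degree P = (\<Sum>j<degree P. - coeff P j * c ^ j)"
    using P(3) unfolding poly_altdef lessThan_Suc_atMost[symmetric]
    by (simp add: sum_negf eq_neg_iff_add_eq_0 add.commute)
  ultimately show ?thesis using that[of "lead_coeff P" "degree P" "coeff P"] P by simp
qed

text \<open>A polynomial of minimal degree has a nonzero constant term, which is a multiple of \<open>x\<close>.\<close>

lemma alg_over_multiple_in_base:
  assumes S: "subring_set S" and "alg_over S x" "x \<noteq> 0"
  obtains y where "y \<in> adjoin S x" "y * x \<in> S" "y * x \<noteq> 0"
proof -
  obtain P where P: "P \<noteq> 0" "\<And>i. coeff P i \<in> S" "poly P x = 0"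
    using assms by (auto simp: alg_over_def)
  then have "\<exists>Q. coeff Q 0 \<noteq> 0 \<and> (\<forall>i. coeff Q i \<in> S) \<and> poly Q x = 0"
  proof (induction "degree P" arbitrary: P rule: less_induct)
    case less
    show ?case
    proof (cases "coeff P 0 = 0")
      case True
      then obtain Q where PQ: "P = pCons 0 Q" by (cases P) auto
      have "Q \<noteq> 0" "degree Q < degree P" using less.prems PQ by auto
      moreover have "coeff Q i \<in> S" for i using less.prems(2)[of "Suc i"] PQ by simp
      moreover have "poly Q x = 0" using less.prems(3) PQ assms(3) by simp
      ultimately show ?thesis using less.hyps by blast
    qed (use less.prems in blast)
  qed
  then obtain Q where Q: "coeff Q 0 \<noteq> 0" "\<And>i. coeff Q i \<in> S" "poly Q x = 0" by blast
  obtain a R where QR: "Q = pCons a R" by (cases Q)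
  show ?thesis
  proof
    show "- poly R x \<in> adjoin S x"
      using Q(2)[of "Suc i" for i] QR adjoin_I[of "- R" S x] subring_set_uminus[OF S] by auto
    have "a = - (x * poly R x)" using Q(3) QR by (simp add: eq_neg_iff_add_eq_0)
    then have "- poly R x * x = a" by (simp add: mult.commute)
    then show "- poly R x * x \<in> S" "- poly R x * x \<noteq> 0" using Q(1) Q(2)[of 0] QR by auto
  qed
qed

text \<open>The relation lowers exponents step by step below \<open>r\<close>; its leading
  coefficient \<open>p\<close> can be cancelled because \<open>frac_span\<close> admits denominators
  from \<open>S\<close>. The extra factor \<open>b\<close> allows the lemma to be used for mixed
  monomials \<open>c ^ n * z ^ j\<close>.\<close>

lemma powers_in_frac_span:
  assumes S: "subring_set S" and "finite I" and p: "p \<in> S" "p \<noteq> 0" "\<And>j. s j \<in> S"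
    and rel: "p * c ^ r = (\<Sum>j<r. - s j * c ^ j)"
    and base: "\<And>n. n < r \<Longrightarrow> c ^ n * b \<in> frac_span S I B"
  shows "c ^ n * b \<in> frac_span S I B"
proof (induction n rule: less_induct)
  case (less n)
  show ?case
  proof (cases "n < r")
    case False
    then have "c ^ n = c ^ r * c ^ (n - r)" by (simp flip: power_add)
    then have "p * (c ^ n * b) = (p * c ^ r) * c ^ (n - r) * b"
      by (simp add: mult.assoc)
    also have "\<dots> = (\<Sum>j<r. - s j * (c ^ (n - r + j) * b))"
      unfolding rel sum_distrib_right by (simp add: power_add mult_ac)
    also have "\<dots> \<in> frac_span S I B"
    proof (rule frac_span_sum[OF S \<open>finite I\<close>], rule frac_span_scale[OF S \<open>finite I\<close>])
      show "c ^ (n - r + j) * b \<in> frac_span S I B" if "j \<in> {..<r}" for j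
        using that False by (intro less) auto
      show "- s j \<in> S" for j by (intro subring_set_uminus[OF S] p)
    qed
    finally show ?thesis using frac_span_cancel[OF S \<open>finite I\<close>] p by blast
  qed (use base in simp)
qed

lemma adjoin_times_in_frac_span:
  assumes S: "subring_set S" and "finite I" and "q \<in> adjoin S c"
    and "\<And>n. c ^ n * b \<in> frac_span S I B"
  shows "q * b \<in> frac_span S I B"
proof -
  obtain P where P: "\<And>i. coeff P i \<in> S" "q = poly P c" using assms(3) by (auto simp: adjoin_def)
  have "q * b = (\<Sum>i\<le>degree P. coeff P i * (c ^ i * b))"
    unfolding P(2) poly_altdef sum_distrib_right by (simp add: mult.assoc)
  also have "\<dots> \<in> frac_span S I B"
    by (intro frac_span_sum[OF S \<open>finite I\<close>] frac_span_scale[OF S \<open>finite I\<close>] assms(4) P(1))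
  finally show ?thesis .
qed

lemma alg_over_adjoin_elem:
  assumes S: "subring_set S" and c: "alg_over S c" and q: "q \<in> adjoin S c"
  shows "alg_over S q"
proof -
  obtain p r s where rel: "p \<in> S" "p \<noteq> 0" "r > 0" "\<And>j. s j \<in> S" "p * c ^ r = (\<Sum>j<r. - s j * c ^ j)"
    by (rule alg_over_relation[OF c], rule that)
  have pow: "c ^ n * 1 \<in> frac_span S {..<r} (\<lambda>i. c ^ i)" for n
    by (rule powers_in_frac_span[OF S _ rel(1,2,4,5)])
       (use frac_span_base[OF S, of "{..<r}" _ "\<lambda>i. c ^ i"] in auto)
  show ?thesis
  proof (rule alg_over_if_stable[OF S, of "{..<r}" 0 "\<lambda>i. c ^ i"])
    show "q * c ^ i \<in> frac_span S {..<r} (\<lambda>i. c ^ i)" for i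
      by (rule adjoin_times_in_frac_span[OF S _ q]) (use pow in \<open>auto simp flip: power_add\<close>)
  qed (use rel in auto)
qed

text \<open>The products \<open>c ^ i * z ^ j\<close> of low powers span a space stable under
  \<open>z\<close>. The difficulty is that the leading coefficient \<open>p'\<close> of the relation
  for \<open>z\<close> lies in \<open>S[c]\<close> and not in \<open>S\<close>; it is first
  multiplied by some \<open>y\<close> into a nonzero element of \<open>S\<close>, which may be
  cancelled.\<close>

lemma alg_over_adjoin_trans:
  assumes S: "subring_set S" and c: "alg_over S c" and z: "alg_over (adjoin S c) z"
  shows "alg_over S z"
proof -
  obtain p r s where rel: "p \<in> S" "p \<noteq> 0" "r > 0" "\<And>j. s j \<in> S" "p * c ^ r = (\<Sum>j<r. - s j * c ^ j)"
    by (rule alg_over_relation[OF c], rule that)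
  obtain p' e s' where rel': "p' \<in> adjoin S c" "p' \<noteq> 0" "e > 0" "\<And>j. s' j \<in> adjoin S c"
      "p' * z ^ e = (\<Sum>j<e. - s' j * z ^ j)"
    by (rule alg_over_relation[OF z], rule that)
  note T = subring_set_adjoin[OF S, of c]
  obtain y where y: "y \<in> adjoin S p'" "y * p' \<in> S" "y * p' \<noteq> 0"
    by (rule alg_over_multiple_in_base[OF S alg_over_adjoin_elem[OF S c rel'(1)] rel'(2)], rule that)
  have y': "y \<in> adjoin S c"
  proof -
    obtain Y where Y: "\<And>i. coeff Y i \<in> S" "y = poly Y p'" using y(1) by (auto simp: adjoin_def)
    show ?thesis unfolding Y(2)
      by (rule subring_set_poly[OF T]) (use Y(1) adjoin_superset[OF S] rel'(1) in auto)
  qed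
  define I where "I = {..<r} \<times> {..<e}"
  define B where "B = (\<lambda>(i, j). c ^ i * z ^ j)"
  have I: "finite I" by (simp add: I_def)
  have low: "c ^ n * z ^ j \<in> frac_span S I B" if "j < e" for n j
    by (rule powers_in_frac_span[OF S I rel(1,2,4,5)])
       (use frac_span_base[OF S I, of "(_, j)" B] that in \<open>auto simp: I_def B_def\<close>)
  have lowq: "q * z ^ j \<in> frac_span S I B" if "j < e" "q \<in> adjoin S c" for q j
    by (rule adjoin_times_in_frac_span[OF S I that(2)]) (use low that in auto)
  have top: "q * z ^ e \<in> frac_span S I B" if q: "q \<in> adjoin S c" for q
  proof -
    have "(y * p') * (q * z ^ e) = y * q * (p' * z ^ e)" by (simp only: mult_ac)
    also have "\<dots> = (\<Sum>j<e. (y * q * - s' j) * z ^ j)"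
      unfolding rel'(5) sum_distrib_left by (simp add: mult.assoc)
    also have "\<dots> \<in> frac_span S I B"
      by (intro frac_span_sum[OF S I] lowq subring_set_mult[OF T] subring_set_uminus[OF T])
         (use y' q rel' in auto)
    finally show ?thesis using frac_span_cancel[OF S I] y by blast
  qed
  show ?thesis
  proof (rule alg_over_if_stable[OF S I, of "(0, 0)" B])
    fix ij assume "ij \<in> I"
    then obtain i j where ij: "ij = (i, j)" "i < r" "j < e" by (auto simp: I_def)
    have "c ^ i \<in> adjoin S c" by (intro subring_set_power[OF T] adjoin_self[OF S])
    then have "c ^ i * z ^ Suc j \<in> frac_span S I B"
      using lowq[of "Suc j"] top ij by (cases "Suc j = e") auto
    then show "z * B ij \<in> frac_span S I B" by (simp add: ij B_def mult_ac)
  qed (use rel rel' in \<open>auto simp: I_def B_def\<close>)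
qed

lemma subring_set_alg_over:
  assumes S: "subring_set S" shows "subring_set {x. alg_over S x}"
proof -
  have *: "alg_over S q" if x: "alg_over S x" and y: "alg_over S y" and q: "q \<in> adjoin (adjoin S x) y" for x y q
  proof -
    have "alg_over (adjoin S x) y" using y adjoin_superset[OF S] alg_over_mono by blast
    then have "alg_over (adjoin S x) q"
      using alg_over_adjoin_elem[OF subring_set_adjoin[OF S]] q by blast
    then show ?thesis using alg_over_adjoin_trans[OF S x] by blast
  qed
  show ?thesis unfolding subring_set_def
  proof (intro conjI ballI)
    show "1 \<in> {x. alg_over S x}" by (simp add: alg_over_self S subring_set_1)
    fix x y assume xy: "x \<in> {x. alg_over S x}" "y \<in> {x. alg_over S x}"
    note T = subring_set_adjoin[OF S, of x]
    have "x \<in> adjoin (adjoin S x) y" "y \<in> adjoin (adjoin S x) y"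
      using adjoin_self[OF T] adjoin_self[OF S] adjoin_superset[OF T] by auto
    then show "x - y \<in> {x. alg_over S x}" "x * y \<in> {x. alg_over S x}"
      using *[of x y] xy subring_set_adjoin[OF T, of y] by (auto simp: subring_set_def)
  qed
qed

lemma alg_over_trans:
  assumes S: "subring_set S" and z: "alg_over {x. alg_over S x} z"
  shows "alg_over S z"
proof -
  obtain P where P: "P \<noteq> 0" "\<And>i. alg_over S (coeff P i)" "poly P z = 0"
    using z by (auto simp: alg_over_def)
  \<comment> \<open>The last premise speaks of all rings \<open>T\<close> above \<open>S\<close> and
    \<open>C\<close>, so that it passes to the extension by one element and the induction on
    \<open>C\<close> goes through. \<open>C\<close> will be the set of coefficients of
    \<open>P\<close>.\<close>
  have *: "alg_over S z"
    if "finite C" "subring_set S" "\<forall>c\<in>C. alg_over S c"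
       "\<And>T. subring_set T \<Longrightarrow> S \<subseteq> T \<Longrightarrow> C \<subseteq> T \<Longrightarrow> alg_over T z" for C S
    using that
  proof (induction C arbitrary: S rule: finite_induct)
    case (insert c C)
    note T = subring_set_adjoin[OF insert.prems(1), of c]
      and sup = adjoin_superset[OF insert.prems(1), of c]
    have "alg_over (adjoin S c) z"
    proof (rule insert.IH[OF T])
      show "\<forall>c'\<in>C. alg_over (adjoin S c) c'"
        using insert.prems(2) alg_over_mono[OF _ sup] by blast
      fix U assume "subring_set U" "adjoin S c \<subseteq> U" "C \<subseteq> U"
      then show "alg_over U z"
        using insert.prems(3) sup adjoin_self[OF insert.prems(1)] by blast
    qed
    then show ?case
      using alg_over_adjoin_trans[OF insert.prems(1), of c z] insert.prems(2) by blast
  qed auto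
  have "finite (range (coeff P))"
    by (rule finite_subset[of _ "insert 0 (coeff P ` {..degree P})"]) (auto intro: coeff_eq_0 leI)
  then show ?thesis
    by (rule *[OF _ S]) (use P in \<open>auto simp: alg_over_def image_subset_iff\<close>)
qed

section \<open>Relative algebraic closure and Steinitz exchange\<close>

definition ring_hull :: "'r::comm_ring_1 set \<Rightarrow> 'r set" where
  "ring_hull X = \<Inter> {S. subring_set S \<and> X \<subseteq> S}"

lemma subring_set_ring_hull: "subring_set (ring_hull X)"
  unfolding ring_hull_def subring_set_def by blast

lemma ring_hull_superset: "X \<subseteq> ring_hull X"
  unfolding ring_hull_def by blast

lemma ring_hull_least: "subring_set S \<Longrightarrow> X \<subseteq> S \<Longrightarrow> ring_hull X \<subseteq> S"
  unfolding ring_hull_def by blast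

lemma ring_hull_mono: "X \<subseteq> Y \<Longrightarrow> ring_hull X \<subseteq> ring_hull Y"
  unfolding ring_hull_def by blast

lemma ring_hull_insert: "ring_hull (insert b X) = adjoin (ring_hull X) b"
proof
  show "ring_hull (insert b X) \<subseteq> adjoin (ring_hull X) b"
    using adjoin_superset[OF subring_set_ring_hull, of X b] adjoin_self[OF subring_set_ring_hull, of b X]
      ring_hull_superset[of X]
    by (intro ring_hull_least subring_set_adjoin subring_set_ring_hull) auto
  show "adjoin (ring_hull X) b \<subseteq> ring_hull (insert b X)"
    using ring_hull_mono[of X "insert b X"] ring_hull_superset[of "insert b X"]
    by (auto simp: adjoin_def intro!: subring_set_poly[OF subring_set_ring_hull])
qed

text \<open>The closure operator of the matroid of algebraic dependence: the next lemmas show that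
  it is extensive, monotone, idempotent and has the exchange property.\<close>

definition alg_closure :: "'r::idom set \<Rightarrow> 'r set" where
  "alg_closure X = {x. alg_over (ring_hull X) x}"

lemma alg_closure_superset: "X \<subseteq> alg_closure X"
  using alg_over_self[OF subring_set_ring_hull] ring_hull_superset by (force simp: alg_closure_def)

lemma alg_closure_mono: "X \<subseteq> Y \<Longrightarrow> alg_closure X \<subseteq> alg_closure Y"
  using alg_over_mono[OF _ ring_hull_mono] by (auto simp: alg_closure_def)

lemma alg_closure_subset:
  assumes "X \<subseteq> alg_closure Y" shows "alg_closure X \<subseteq> alg_closure Y"
proof
  fix x assume "x \<in> alg_closure X"
  have "ring_hull X \<subseteq> {x. alg_over (ring_hull Y) x}"
    using assms by (intro ring_hull_least subring_set_alg_over subring_set_ring_hull)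
      (simp add: alg_closure_def)
  with \<open>x \<in> alg_closure X\<close> have "alg_over {x. alg_over (ring_hull Y) x} x"
    using alg_over_mono by (auto simp: alg_closure_def)
  then show "x \<in> alg_closure Y"
    using alg_over_trans[OF subring_set_ring_hull] by (auto simp: alg_closure_def)
qed

text \<open>A relation for \<open>a\<close> over \<open>S[b]\<close> is a polynomial in two
  unknowns; it is sorted anew by powers of \<open>b\<close>. The result is not zero, since a
  vanishing coefficient \<open>poly (r i) a\<close> with \<open>r i\<close> nonzero would make
  \<open>a\<close> algebraic over \<open>S\<close>.\<close>

lemma alg_closure_exchange:
  assumes "a \<in> alg_closure (insert b X)" "a \<notin> alg_closure X"
  shows "b \<in> alg_closure (insert a X)"
proof -
  define S where "S = ring_hull X"
  have S: "subring_set S" by (simp add: S_def subring_set_ring_hull)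
  obtain P where P: "P \<noteq> 0" "\<And>j. coeff P j \<in> adjoin S b" "poly P a = 0"
    using assms(1) by (auto simp: alg_closure_def ring_hull_insert alg_over_def S_def)
  have "\<forall>j. \<exists>Q. (\<forall>i. coeff Q i \<in> S) \<and> coeff P j = poly Q b"
    using P(2) unfolding adjoin_def by blast
  then obtain Q where Q: "\<And>i j. coeff (Q j) i \<in> S" "\<And>j. coeff P j = poly (Q j) b" by metis
  define N where "N = Max ((\<lambda>j. degree (Q j)) ` {..degree P})"
  have N: "degree (Q j) \<le> N" if "j \<le> degree P" for j
    unfolding N_def using that by (intro Max_ge) auto
  define r where "r i = (\<Sum>j\<le>degree P. monom (coeff (Q j) i) j)" for i
  have coeff_r: "coeff (r i) j = (if j \<le> degree P then coeff (Q j) i else 0)" for i j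
    by (simp add: r_def coeff_sum)
  define R where "R = (\<Sum>i\<le>N. monom (poly (r i) a) i)"
  have coeff_R: "coeff R i = (if i \<le> N then poly (r i) a else 0)" for i
    by (simp add: R_def coeff_sum)
  have "0 = (\<Sum>j\<le>degree P. poly (Q j) b * a ^ j)"
    using P(3) by (simp add: poly_altdef Q(2))
  also have "\<dots> = (\<Sum>j\<le>degree P. \<Sum>i\<le>N. coeff (Q j) i * b ^ i * a ^ j)"
  proof (intro sum.cong refl)
    fix j assume j: "j \<in> {..degree P}"
    have "poly (Q j) b = (\<Sum>i\<le>N. coeff (Q j) i * b ^ i)"
      unfolding poly_altdef using N[of j] j by (intro sum.mono_neutral_left) (auto simp: coeff_eq_0)
    then show "poly (Q j) b * a ^ j = (\<Sum>i\<le>N. coeff (Q j) i * b ^ i * a ^ j)"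
      by (simp add: sum_distrib_right)
  qed
  also have "\<dots> = (\<Sum>i\<le>N. \<Sum>j\<le>degree P. coeff (Q j) i * b ^ i * a ^ j)" by (rule sum.swap)
  also have "\<dots> = poly R b"
    by (simp add: R_def r_def poly_sum poly_monom sum_distrib_right sum_distrib_left mult_ac)
  finally have "poly R b = 0" by simp
  moreover have "coeff R i \<in> adjoin S a" for i
    unfolding coeff_R using Q(1)
    by (auto simp: coeff_r subring_set_0[OF S] intro!: adjoin_I subring_set_0[OF subring_set_adjoin[OF S]])
  moreover have "R \<noteq> 0"
  proof
    assume R0: "R = 0"
    obtain j where j: "coeff P j \<noteq> 0" using P(1) by (metis leading_coeff_0_iff)
    then have "Q j \<noteq> 0" by (auto simp: Q(2))
    then obtain i where i: "coeff (Q j) i \<noteq> 0" by (metis leading_coeff_0_iff)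
    have jd: "j \<le> degree P" using j by (rule le_degree)
    have "i \<le> N" using le_degree[OF i] N[OF jd] by simp
    then have "poly (r i) a = 0" using coeff_R[of i] R0 by simp
    moreover have "r i \<noteq> 0" using i jd coeff_r[of i j] by auto
    moreover have "coeff (r i) l \<in> S" for l using Q(1) by (simp add: coeff_r subring_set_0[OF S])
    ultimately have "alg_over S a" unfolding alg_over_def by blast
    then show False using assms(2) by (simp add: alg_closure_def S_def)
  qed
  ultimately show ?thesis
    by (auto simp: alg_closure_def ring_hull_insert alg_over_def S_def)
qed

text \<open>Elements of \<open>B\<close> are dropped one at a time; the first one whose removal
  takes \<open>a\<close> out of the closure can be exchanged for \<open>a\<close>.\<close>

lemma alg_closure_exchange_set:
  assumes "finite B" "a \<in> alg_closure (Y \<union> B)" "a \<notin> alg_closure Y"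
  shows "\<exists>b\<in>B. b \<in> alg_closure (insert a (Y \<union> (B - {b})))"
  using assms
proof (induction B rule: finite_induct)
  case (insert b B)
  show ?case
  proof (cases "a \<in> alg_closure (Y \<union> B)")
    case True
    then obtain c where c: "c \<in> B" "c \<in> alg_closure (insert a (Y \<union> (B - {c})))"
      using insert by blast
    moreover have "insert a (Y \<union> (B - {c})) \<subseteq> insert a (Y \<union> (insert b B - {c}))" by auto
    ultimately show ?thesis using alg_closure_mono by blast
  next
    case False
    then have "b \<in> alg_closure (insert a (Y \<union> B))"
      using alg_closure_exchange[of a b "Y \<union> B"] insert.prems by simp
    moreover have "insert b B - {b} = B" using insert.hyps by auto
    ultimately show ?thesis by auto
  qed
qed simp

text \<open>An independent set that is as large as a generating set generates as well.
  \<open>C\<close> is a common base, later the constants, that takes no part in the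
  exchange.\<close>

lemma alg_closure_steinitz:
  assumes fin: "finite B" "finite I" and card: "card B \<le> card I"
    and span: "I \<subseteq> alg_closure (C \<union> B)"
    and indep: "\<And>i. i \<in> I \<Longrightarrow> i \<notin> alg_closure (C \<union> (I - {i}))"
  shows "B \<subseteq> alg_closure (C \<union> I)"
proof -
  \<comment> \<open>The elements of \<open>I\<close> enter one by one, each in exchange for an
    element of \<open>B'\<close>; for \<open>J = I\<close> the count leaves \<open>B'\<close>
    empty.\<close>
  have "\<exists>B'\<subseteq>B. card B' + card J = card B \<and> B \<subseteq> alg_closure (C \<union> J \<union> B')"
    if "J \<subseteq> I" for J
    using finite_subset[OF that fin(2)] that
  proof (induction J rule: finite_induct)
    case empty
    then show ?case using alg_closure_superset[of "C \<union> B"] by (intro exI[of _ B]) auto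
  next
    case (insert i J)
    then obtain B' where B': "B' \<subseteq> B" "card B' + card J = card B" "B \<subseteq> alg_closure (C \<union> J \<union> B')"
      by auto
    have finB': "finite B'" using B'(1) fin finite_subset by blast
    have "C \<union> B \<subseteq> alg_closure (C \<union> J \<union> B')"
      using B'(3) alg_closure_superset[of "C \<union> J \<union> B'"] by auto
    then have 1: "i \<in> alg_closure ((C \<union> J) \<union> B')"
      using alg_closure_subset span insert.prems by blast
    have "C \<union> J \<subseteq> C \<union> (I - {i})" using insert by auto
    then have 2: "i \<notin> alg_closure (C \<union> J)"
      using indep[of i] insert.prems alg_closure_mono by blast
    obtain b where b: "b \<in> B'" "b \<in> alg_closure (insert i ((C \<union> J) \<union> (B' - {b})))"
      using alg_closure_exchange_set[OF finB' 1 2] by blast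
    define Z where "Z = C \<union> insert i J \<union> (B' - {b})"
    have Z: "insert i ((C \<union> J) \<union> (B' - {b})) = Z" by (auto simp: Z_def)
    have "C \<union> J \<union> B' \<subseteq> alg_closure Z"
      using b(2) alg_closure_superset[of Z] unfolding Z by (auto simp: Z_def)
    then have "B \<subseteq> alg_closure Z" using alg_closure_subset B'(3) by blast
    moreover have "card (B' - {b}) + card (insert i J) = card B"
      using B'(2) b(1) finB' insert.hyps card_gt_0_iff[of B'] by (auto simp: card_Diff_singleton)
    ultimately show ?case using B'(1) unfolding Z_def by (intro exI[of _ "B' - {b}"]) auto
  qed
  from this[of I] obtain B' where B': "B' \<subseteq> B" "card B' + card I = card B" "B \<subseteq> alg_closure (C \<union> I \<union> B')"
    by auto
  have "finite B'" using B'(1) fin finite_subset by blast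
  moreover have "card B' = 0" using B'(2) card by simp
  ultimately have "B' = {}" by simp
  then show ?thesis using B'(3) by simp
qed

section \<open>Substitution and Taylor expansion\<close>

definition fps_const2 :: "'a::comm_ring_1 \<Rightarrow> 'a fps fps" where
  "fps_const2 c = fps_const (fps_const c)"

lemma fps_const_inject: "fps_const x = fps_const y \<longleftrightarrow> x = y"
  by (auto dest: arg_cong[of _ _ "\<lambda>h. fps_nth h 0"])

lemma hom_fps_const: "comm_ring_hom (fps_const :: 'a::comm_ring_1 \<Rightarrow> _)"
  by unfold_locales auto

lemma hom_fps_const2: "comm_ring_hom (fps_const2 :: 'a::comm_ring_1 \<Rightarrow> _)"
  by unfold_locales (auto simp: fps_const2_def)

interpretation c2: comm_ring_hom "fps_const2 :: 'a::comm_ring_1 \<Rightarrow> 'a fps fps"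
  by (rule hom_fps_const2)

lemma fps_const2_mult_nth [simp]: "fps_nth (fps_nth (fps_const2 c * x) i) n = c * fps_nth (fps_nth x i) n"
  by (simp add: fps_const2_def)

lemma fps2_mult_nth:
  "fps_nth (fps_nth (x * y) i) n
     = (\<Sum>j=0..i. \<Sum>l=0..n. fps_nth (fps_nth x j) l * fps_nth (fps_nth y (i - j)) (n - l))"
  by (simp add: fps_mult_nth fps_sum_nth)

lemma fps2_mult_cong:
  assumes "\<And>j l. j \<le> i \<Longrightarrow> l \<le> n \<Longrightarrow> fps_nth (fps_nth x j) l = fps_nth (fps_nth x' j) l"
    and "\<And>j l. j \<le> i \<Longrightarrow> l \<le> n \<Longrightarrow> fps_nth (fps_nth y j) l = fps_nth (fps_nth y' j) l"
  shows "fps_nth (fps_nth (x * y) i) n = fps_nth (fps_nth (x' * y') i) n"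
  unfolding fps2_mult_nth by (intro sum.cong refl arg_cong2[of _ _ _ _ "(*)"] assms) auto

definition ord2_ge :: "nat \<Rightarrow> 'a::comm_ring_1 fps fps \<Rightarrow> bool" where
  "ord2_ge N x \<longleftrightarrow> (\<forall>i n. i + n < N \<longrightarrow> fps_nth (fps_nth x i) n = 0)"

lemma ord2_ge_mult:
  assumes "ord2_ge M x" "ord2_ge N y" shows "ord2_ge (M + N) (x * y)"
  unfolding ord2_ge_def
proof (intro allI impI)
  fix i n assume *: "i + n < M + N"
  show "fps_nth (fps_nth (x * y) i) n = 0"
    unfolding fps2_mult_nth
  proof (intro sum.neutral ballI)
    fix j l assume "j \<in> {0..i}" "l \<in> {0..n}"
    then have "j + l < M \<or> (i - j) + (n - l) < N" using * by auto
    then show "fps_nth (fps_nth x j) l * fps_nth (fps_nth y (i - j)) (n - l) = 0"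
      using assms by (auto simp: ord2_ge_def)
  qed
qed

lemma ord2_ge_prod_mset:
  assumes "\<And>v. ord2_ge (Suc 0) (S v)" shows "ord2_ge (size \<alpha>) (prod_mset (image_mset S \<alpha>))"
proof (induction \<alpha>)
  case (add v \<alpha>)
  then show ?case using ord2_ge_mult[OF assms[of v] add] by simp
qed (simp add: ord2_ge_def)

text \<open>
  Substitution into power series in two variables: \<^typ>\<open>'a fps fps\<close> is \<open>k[[t]][[s]]\<close>, the coefficients
  being series in \<open>t\<close>.
\<close>

definition mps_subst2 :: "('v::finite, 'a::comm_ring_1) mps \<Rightarrow> ('v \<Rightarrow> 'a fps fps) \<Rightarrow> 'a fps fps" where
  "mps_subst2 f S = Abs_fps (\<lambda>i. Abs_fps (\<lambda>n. \<Sum>\<alpha> | size \<alpha> \<le> i + n.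
     mps_nth f \<alpha> * fps_nth (fps_nth (prod_mset (image_mset S \<alpha>)) i) n))"

definition mps_trunc :: "nat \<Rightarrow> ('v, 'a::comm_ring_1) mps \<Rightarrow> ('v, 'a) mps" where
  "mps_trunc N f = Abs_mps (\<lambda>\<alpha>. if size \<alpha> \<le> N then mps_nth f \<alpha> else 0)"

lemma mps_nth_trunc: "mps_nth (mps_trunc N f) \<alpha> = (if size \<alpha> \<le> N then mps_nth f \<alpha> else 0)"
  by (simp add: mps_trunc_def)

lemma mps_is_poly_trunc [simp]: "mps_is_poly (mps_trunc N f :: ('v::finite, 'a::comm_ring_1) mps)"
  unfolding mps_is_poly_def
  by (rule finite_subset[OF _ finite_size_le[of N]]) (auto simp: mps_nth_trunc)

lemma mps_deriv_trunc: "mps_deriv j (mps_trunc (Suc N) f) = mps_trunc N (mps_deriv j f)"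
  by (rule mps_eqI) (simp add: mps_nth_deriv mps_nth_trunc)

text \<open>Monomials of degree above \<open>N\<close> contribute only in total order above
  \<open>N\<close>. Every identity of substituted series can therefore be checked coefficientwise on
  polynomials.\<close>

lemma mps_subst2_trunc:
  fixes f :: "('v::finite, 'a::comm_ring_1) mps"
  assumes S: "\<And>v. ord2_ge (Suc 0) (S v)" and "i + n \<le> N"
  shows "fps_nth (fps_nth (mps_subst2 f S) i) n
       = fps_nth (fps_nth (mps_eval fps_const2 (mps_trunc N f) S) i) n"
proof -
  have "fps_nth (fps_nth (mps_eval fps_const2 (mps_trunc N f) S) i) n
      = (\<Sum>\<alpha> | size \<alpha> \<le> N. mps_nth f \<alpha> * fps_nth (fps_nth (prod_mset (image_mset S \<alpha>)) i) n)"
    by (subst c2.mps_eval_superset[OF finite_size_le[of N]])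
       (auto simp: mps_nth_trunc fps_sum_nth split: if_splits intro!: sum.cong)
  also have "\<dots> = fps_nth (fps_nth (mps_subst2 f S) i) n"
    unfolding mps_subst2_def fps_nth_Abs_fps
    using assms ord2_ge_prod_mset[of S, OF S]
    by (intro sum.mono_neutral_right finite_size_le) (auto simp: ord2_ge_def)
  finally show ?thesis by simp
qed

lemma mps_eval_high_order:
  fixes p :: "('v::finite, 'a::comm_ring_1) mps"
  assumes S: "\<And>v. ord2_ge (Suc 0) (S v)" and "\<And>\<alpha>. size \<alpha> \<le> N \<Longrightarrow> mps_nth p \<alpha> = 0" and "i + n \<le> N"
  shows "fps_nth (fps_nth (mps_eval fps_const2 p S) i) n = 0"
proof -
  have "mps_nth p \<alpha> * fps_nth (fps_nth (prod_mset (image_mset S \<alpha>)) i) n = 0" for \<alpha>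
    using assms ord2_ge_prod_mset[of S, OF S, of \<alpha>] by (cases "size \<alpha> \<le> N") (auto simp: ord2_ge_def)
  then show ?thesis
    by (auto simp: mps_eval_def fps_sum_nth intro!: sum.neutral)
qed

lemma mps_subst2_poly:
  fixes p :: "('v::finite, 'a::comm_ring_1) mps"
  assumes S: "\<And>v. ord2_ge (Suc 0) (S v)" and p: "mps_is_poly p"
  shows "mps_subst2 p S = mps_eval fps_const2 p S"
proof (intro fps_ext)
  fix i n :: nat
  have fin: "finite (size ` {\<alpha>. mps_nth p \<alpha> \<noteq> 0})" using p by (simp add: mps_is_poly_def)
  define N where "N = i + n + Max (insert 0 (size ` {\<alpha>. mps_nth p \<alpha> \<noteq> 0}))"
  have "mps_trunc N p = p"
  proof (rule mps_eqI)
    fix \<alpha>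
    have "size \<alpha> \<le> N" if "mps_nth p \<alpha> \<noteq> 0"
      unfolding N_def using fin that by (intro trans_le_add2 Max_ge) auto
    then show "mps_nth (mps_trunc N p) \<alpha> = mps_nth p \<alpha>" by (auto simp: mps_nth_trunc)
  qed
  then show "fps_nth (fps_nth (mps_subst2 p S) i) n = fps_nth (fps_nth (mps_eval fps_const2 p S) i) n"
    using mps_subst2_trunc[of S, OF S, of i n N p] by (simp add: N_def)
qed

lemma hom_mps_subst2:
  fixes S :: "'v::finite \<Rightarrow> 'a::comm_ring_1 fps fps"
  assumes S: "\<And>v. ord2_ge (Suc 0) (S v)"
  shows "comm_ring_hom (\<lambda>f. mps_subst2 f S)"
proof
  fix f g :: "('v, 'a) mps"
  show "mps_subst2 (f + g) S = mps_subst2 f S + mps_subst2 g S"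
    by (intro fps_ext) (simp add: mps_subst2_def ring_distribs sum.distrib)
  show "mps_subst2 1 S = 1"
    by (subst mps_subst2_poly[OF S]) (auto simp: c2.mps_eval_1)
  show "mps_subst2 (f * g) S = mps_subst2 f S * mps_subst2 g S"
  proof (intro fps_ext)
    fix i n :: nat
    define N where "N = i + n"
    let ?p = "mps_trunc N f" and ?q = "mps_trunc N g"
    \<comment> \<open>The product of the truncations and the truncated product differ only in
      monomials of degree above \<open>N\<close>, which do not reach the coefficient
      considered.\<close>
    let ?r = "?p * ?q + - mps_trunc N (f * g)"
    have "mps_nth ?r \<gamma> = 0" if "size \<gamma> \<le> N" for \<gamma>
    proof -
      have "mps_nth (?p * ?q) \<gamma> = mps_nth (f * g) \<gamma>"
        unfolding mps_nth_mult using that by (intro sum.cong refl) (auto simp: splits_def mps_nth_trunc)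
      then show ?thesis using that by (simp add: mps_nth_trunc)
    qed
    then have "fps_nth (fps_nth (mps_eval fps_const2 ?r S) i) n = 0"
      by (rule mps_eval_high_order[of S N, OF S]) (simp_all add: N_def)
    moreover have "mps_eval fps_const2 (?p * ?q) S = mps_eval fps_const2 (mps_trunc N (f * g)) S + mps_eval fps_const2 ?r S"
      using c2.mps_eval_add[OF mps_is_poly_trunc[of N "f * g"], of ?r S]
      by (simp add: mps_is_poly_add[of _ "- _", simplified] mps_is_poly_mult mps_is_poly_uminus)
    ultimately have "fps_nth (fps_nth (mps_subst2 (f * g) S) i) n
        = fps_nth (fps_nth (mps_eval fps_const2 (?p * ?q) S) i) n"
      by (subst mps_subst2_trunc[of S, OF S, of _ _ N]) (auto simp: N_def)
    also have "\<dots> = fps_nth (fps_nth (mps_subst2 f S * mps_subst2 g S) i) n"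
      unfolding c2.mps_eval_mult[OF mps_is_poly_trunc mps_is_poly_trunc]
      by (rule fps2_mult_cong) (subst mps_subst2_trunc[of S, OF S, of _ _ N]; simp add: N_def)+
    finally show "fps_nth (fps_nth (mps_subst2 (f * g) S) i) n
        = fps_nth (fps_nth (mps_subst2 f S * mps_subst2 g S) i) n" .
  qed
qed

text \<open>Series without \<open>s\<close> form the one-variable case, so the homomorphism property
  and the Taylor estimate need to be proved in two variables only.\<close>

lemma mps_subst2_const:
  fixes s :: "'v::finite \<Rightarrow> 'a::comm_ring_1 fps"
  shows "mps_subst2 f (\<lambda>v. fps_const (s v)) = fps_const (mps_subst f s)"
proof (intro fps_ext)
  fix i n :: nat
  interpret c: comm_ring_hom "fps_const :: 'a fps \<Rightarrow> _" by (rule hom_fps_const)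
  show "fps_nth (fps_nth (mps_subst2 f (\<lambda>v. fps_const (s v))) i) n
     = fps_nth (fps_nth (fps_const (mps_subst f s)) i) n"
    by (cases i) (simp_all add: mps_subst2_def mps_subst_def flip: c.hom_prod_mset)
qed

lemma ord2_ge_const: "fps_nth x 0 = 0 \<Longrightarrow> ord2_ge (Suc 0) (fps_const x)"
  by (auto simp: ord2_ge_def)

lemma hom_mps_subst:
  fixes s :: "'v::finite \<Rightarrow> 'a::comm_ring_1 fps"
  assumes s: "\<And>v. fps_nth (s v) 0 = 0"
  shows "comm_ring_hom (\<lambda>f. mps_subst f s)"
proof -
  interpret h: comm_ring_hom "\<lambda>f. mps_subst2 f (\<lambda>v. fps_const (s v))"
    by (intro hom_mps_subst2 ord2_ge_const s)
  show ?thesis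
    using h.hom_add h.hom_mult h.hom_one unfolding mps_subst2_const
    by unfold_locales (simp_all add: fps_const_inject)
qed

lemma mps_subst_poly:
  fixes p :: "('v::finite, 'a::comm_ring_1) mps"
  assumes s: "\<And>v. fps_nth (s v) 0 = 0" and p: "mps_is_poly p"
  shows "mps_subst p s = mps_eval fps_const p s"
proof -
  have "fps_const (mps_subst p s) = mps_eval fps_const2 p (\<lambda>v. fps_const (s v))"
    using mps_subst2_poly[of "\<lambda>v. fps_const (s v)" p] p s by (simp add: mps_subst2_const ord2_ge_const)
  also have "\<dots> = fps_const (mps_eval fps_const p s)"
    by (subst mps_eval_hom[OF hom_fps_const]) (simp add: fps_const2_def[abs_def])
  finally show ?thesis by (simp add: fps_const_inject)
qed

lemma mps_subst_trunc:
  fixes f :: "('v::finite, 'a::comm_ring_1) mps"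
  assumes s: "\<And>v. fps_nth (s v) 0 = 0" and "n \<le> N"
  shows "fps_nth (mps_subst f s) n = fps_nth (mps_eval fps_const (mps_trunc N f) s) n"
proof -
  have "fps_nth (fps_nth (mps_subst2 f (\<lambda>v. fps_const (s v))) 0) n
     = fps_nth (fps_nth (mps_eval fps_const2 (mps_trunc N f) (\<lambda>v. fps_const (s v))) 0) n"
    using assms by (intro mps_subst2_trunc ord2_ge_const) auto
  moreover have "mps_eval fps_const2 (mps_trunc N f) (\<lambda>v. fps_const (s v)) = fps_const (mps_eval fps_const (mps_trunc N f) s)"
    by (subst mps_eval_hom[OF hom_fps_const]) (simp add: fps_const2_def[abs_def])
  ultimately show ?thesis by (simp add: mps_subst2_const)
qed

section \<open>Divisibility by monomials and Taylor expansion of substitutions\<close>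

lemma fps_X_power_dvd_iff:
  "fps_X ^ p dvd (x :: 'a::comm_ring_1 fps) \<longleftrightarrow> (\<forall>n<p. fps_nth x n = 0)"
proof
  assume "\<forall>n<p. fps_nth x n = 0"
  then have "x = fps_X ^ p * fps_shift p x"
    by (intro fps_ext) (auto simp: fps_X_power_mult_nth)
  then show "fps_X ^ p dvd x" by (rule dvdI)
qed (auto simp: dvd_def fps_X_power_mult_nth)

text \<open>The monomial \<open>s ^ q * t ^ p\<close>; the first exponent belongs to the outer
  variable \<open>s\<close>.\<close>

definition monom2 :: "nat \<Rightarrow> nat \<Rightarrow> 'a::comm_ring_1 fps fps" where
  "monom2 q p = fps_X ^ q * fps_const (fps_X ^ p)"

lemma monom2_mult: "monom2 q p * monom2 q' p' = monom2 (q + q') (p + p')"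
  by (simp add: monom2_def power_add mult_ac flip: fps_const_mult)

lemma monom2_dvd_iff:
  "monom2 q p dvd x \<longleftrightarrow> (\<forall>i n. i < q \<or> n < p \<longrightarrow> fps_nth (fps_nth x i) n = 0)"
proof
  assume *: "\<forall>i n. i < q \<or> n < p \<longrightarrow> fps_nth (fps_nth x i) n = 0"
  have "x = monom2 q p * Abs_fps (\<lambda>i. fps_shift p (fps_nth x (i + q)))"
    unfolding monom2_def mult.assoc
    by (intro fps_ext) (auto simp: fps_X_power_mult_nth *)
  then show "monom2 q p dvd x" by (rule dvdI)
qed (auto simp: dvd_def monom2_def mult.assoc fps_X_power_mult_nth)

text \<open>The orders in \<open>s\<close> and \<open>t\<close> are kept apart, because Newton's
  method for curves contracts with respect to \<open>s\<close> while its division costs a power of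
  \<open>t\<close>.\<close>

lemma mps_subst2_taylor_dvd:
  fixes f :: "('v::finite, 'a::comm_ring_1) mps"
  assumes z: "\<And>v. ord2_ge (Suc 0) (z v)" and za: "\<And>v. ord2_ge (Suc 0) (z v + a v)" and zb: "\<And>v. ord2_ge (Suc 0) (z v + b v)"
    and a: "\<And>v. monom2 q p dvd a v" and b: "\<And>v. monom2 q p dvd b v" and ab: "\<And>v. monom2 q' p' dvd a v - b v"
  shows "monom2 (q + q') (p + p') dvd mps_subst2 f (\<lambda>v. z v + a v) - mps_subst2 f (\<lambda>v. z v + b v)
     - (\<Sum>v\<in>UNIV. mps_subst2 (mps_deriv v f) z * (a v - b v))"
  unfolding monom2_dvd_iff
proof (intro allI impI)
  fix i n assume in_: "i < q + q' \<or> n < p + p'"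
  define N where "N = i + n"
  \<comment> \<open>One degree more than \<open>N\<close>, since differentiation turns it into a
    truncation at \<open>N\<close>.\<close>
  let ?f = "mps_trunc (Suc N) f"
  have "monom2 q p * monom2 q' p' dvd mps_eval fps_const2 ?f (\<lambda>v. z v + a v) - mps_eval fps_const2 ?f (\<lambda>v. z v + b v)
     - (\<Sum>v\<in>UNIV. mps_eval fps_const2 (mps_deriv v ?f) z * (a v - b v))" (is "_ dvd ?R")
    by (intro c2.mps_eval_taylor_dvd a b ab) simp
  then have "fps_nth (fps_nth ?R i) n = 0"
    using in_ unfolding monom2_mult monom2_dvd_iff by blast
  moreover have "fps_nth (fps_nth (mps_subst2 f (\<lambda>v. z v + a v)) i) n
      = fps_nth (fps_nth (mps_eval fps_const2 ?f (\<lambda>v. z v + a v)) i) n"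
    by (rule mps_subst2_trunc) (use za in \<open>auto simp: N_def\<close>)
  moreover have "fps_nth (fps_nth (mps_subst2 f (\<lambda>v. z v + b v)) i) n
      = fps_nth (fps_nth (mps_eval fps_const2 ?f (\<lambda>v. z v + b v)) i) n"
    by (rule mps_subst2_trunc) (use zb in \<open>auto simp: N_def\<close>)
  moreover have "fps_nth (fps_nth (mps_subst2 (mps_deriv v f) z * (a v - b v)) i) n
      = fps_nth (fps_nth (mps_eval fps_const2 (mps_deriv v ?f) z * (a v - b v)) i) n" for v
    unfolding mps_deriv_trunc
    by (rule fps2_mult_cong) (auto intro!: mps_subst2_trunc z simp: N_def)
  ultimately show "fps_nth (fps_nth (mps_subst2 f (\<lambda>v. z v + a v) - mps_subst2 f (\<lambda>v. z v + b v)
     - (\<Sum>v\<in>UNIV. mps_subst2 (mps_deriv v f) z * (a v - b v))) i) n = 0"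
    by (simp add: fps_sum_nth)
qed

lemma mps_subst_taylor_dvd:
  fixes f :: "('v::finite, 'a::comm_ring_1) mps"
  assumes z: "\<And>v. fps_nth (z v) 0 = 0" and a0: "\<And>v. fps_nth (a v) 0 = 0" and b0: "\<And>v. fps_nth (b v) 0 = 0"
    and a: "\<And>v. fps_X ^ p dvd a v" and b: "\<And>v. fps_X ^ p dvd b v" and ab: "\<And>v. fps_X ^ p' dvd a v - b v"
  shows "fps_X ^ (p + p') dvd mps_subst f (\<lambda>v. z v + a v) - mps_subst f (\<lambda>v. z v + b v)
     - (\<Sum>v\<in>UNIV. mps_subst (mps_deriv v f) z * (a v - b v))"
proof -
  interpret c: comm_ring_hom "fps_const :: 'a fps \<Rightarrow> _" by (rule hom_fps_const)
  have iff: "monom2 0 p dvd fps_const x \<longleftrightarrow> fps_X ^ p dvd x" for p and x :: "'a fps"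
    by (auto simp: monom2_dvd_iff fps_X_power_dvd_iff)
  let ?c = "\<lambda>g v. fps_const (g v :: 'a fps)"
  have "monom2 (0 + 0) (p + p') dvd mps_subst2 f (\<lambda>v. ?c z v + ?c a v) - mps_subst2 f (\<lambda>v. ?c z v + ?c b v)
     - (\<Sum>v\<in>UNIV. mps_subst2 (mps_deriv v f) (?c z) * (?c a v - ?c b v))"
    by (rule mps_subst2_taylor_dvd) (auto simp: iff a b ab z a0 b0 ord2_ge_const simp flip: c.hom_add c.hom_diff)
  then show ?thesis
    unfolding mps_subst2_const c.hom_add[symmetric] c.hom_diff[symmetric] c.hom_mult[symmetric] c.hom_sum[symmetric]
    by (simp add: iff)
qed

section \<open>Kronecker substitution\<close>

lemma coeff_pcompose_in:
  assumes S: "subring_set S" and "\<And>i. coeff P i \<in> S" "\<And>i. coeff q i \<in> S"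
  shows "coeff (pcompose P q) i \<in> S"
  using assms(2)
proof (induction P arbitrary: i)
  case (pCons a P)
  have "a \<in> S" using pCons.prems[of 0] by simp
  moreover have "coeff P i \<in> S" for i using pCons.prems[of "Suc i"] by simp
  ultimately have "coeff (q * pcompose P q) i \<in> S"
    unfolding coeff_mult using pCons.IH assms(3)
    by (intro subring_set_sum[OF S] subring_set_mult[OF S]) auto
  moreover have "coeff [:a:] i \<in> S"
    using \<open>a \<in> S\<close> by (cases i) (auto simp: subring_set_0[OF S])
  ultimately show ?case
    unfolding pcompose_pCons coeff_add by (intro subring_set_add[OF S])
qed (simp add: subring_set_0[OF S])

definition fps_coeffs_in :: "'b::comm_ring_1 set \<Rightarrow> 'b fps set" where
  "fps_coeffs_in K = {h. \<forall>n. fps_nth h n \<in> K}"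

lemma subring_set_fps_coeffs_in:
  assumes K: "subring_set K" shows "subring_set (fps_coeffs_in K)"
  unfolding subring_set_def fps_coeffs_in_def
  by (auto simp: fps_mult_nth subring_set_0[OF K] subring_set_1[OF K]
      intro!: subring_set_diff[OF K] subring_set_sum[OF K] subring_set_mult[OF K])

text \<open>
  After division of the equation by the highest possible power of the variable, setting the variable
  to \<open>0\<close> gives an equation for the constant coefficient. Then subtract it, divide and repeat.
\<close>

lemma alg_over_fps_coeffs_in:
  fixes K :: "'b::idom set"
  assumes K: "subring_set K" and closed: "\<And>x. alg_over K x \<Longrightarrow> x \<in> K"
    and h: "alg_over (fps_coeffs_in K) h"
  shows "h \<in> fps_coeffs_in K"
proof -
  note F = subring_set_fps_coeffs_in[OF K]
  have const: "fps_nth h 0 \<in> K" if h: "alg_over (fps_coeffs_in K) h" for h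
  proof -
    obtain P where P: "P \<noteq> 0" "\<And>i. coeff P i \<in> fps_coeffs_in K" "poly P h = 0"
      using h by (auto simp: alg_over_def)
    have ex: "\<exists>n j. fps_nth (coeff P j) n \<noteq> 0"
      using P(1) by (metis fps_ext fps_zero_nth leading_coeff_0_iff)
    define n where "n = (LEAST n. \<exists>j. fps_nth (coeff P j) n \<noteq> 0)"
    obtain j where j: "fps_nth (coeff P j) n \<noteq> 0" using LeastI_ex[OF ex] unfolding n_def by blast
    have low: "fps_nth (coeff P j) i = 0" if "i < n" for i j
      using not_less_Least[of i "\<lambda>n. \<exists>j. fps_nth (coeff P j) n \<noteq> 0"] that unfolding n_def by blast
    define p where "p = (\<Sum>j\<le>degree P. monom (fps_nth (coeff P j) n) j)"
    have coeff_p: "coeff p j = fps_nth (coeff P j) n" for j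
      by (auto simp: p_def coeff_sum coeff_eq_0)
    have "0 = fps_nth (poly P h) n" by (simp add: P)
    also have "\<dots> = (\<Sum>j\<le>degree P. fps_nth (coeff P j * h ^ j) n)"
      by (simp add: poly_altdef fps_sum_nth)
    also have "\<dots> = (\<Sum>j\<le>degree P. fps_nth (coeff P j) n * fps_nth h 0 ^ j)"
    proof (intro sum.cong refl)
      fix j
      have "fps_nth (coeff P j * h ^ j) n = (\<Sum>i\<in>{n}. fps_nth (coeff P j) i * fps_nth (h ^ j) (n - i))"
        unfolding fps_mult_nth by (rule sum.mono_neutral_right) (auto simp: low)
      then show "fps_nth (coeff P j * h ^ j) n = fps_nth (coeff P j) n * fps_nth h 0 ^ j"
        by (simp add: fps_nth_power_0)
    qed
    also have "\<dots> = poly p (fps_nth h 0)" by (simp add: p_def poly_sum poly_monom)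
    finally have "poly p (fps_nth h 0) = 0" by simp
    moreover have "p \<noteq> 0" using j coeff_p by (metis coeff_0)
    moreover have "coeff p i \<in> K" for i using P(2)[of i] by (simp add: coeff_p fps_coeffs_in_def)
    ultimately show ?thesis by (intro closed) (auto simp: alg_over_def)
  qed
  have "fps_nth h n \<in> K" for n
    using h
  proof (induction n arbitrary: h)
    case (Suc n)
    obtain P where P: "P \<noteq> 0" "\<And>i. coeff P i \<in> fps_coeffs_in K" "poly P h = 0"
      using Suc.prems by (auto simp: alg_over_def)
    let ?q = "[:fps_const (fps_nth h 0), fps_X:]"
    have "h = fps_const (fps_nth h 0) + fps_X * fps_shift 1 h"
      by (rule fps_ext) (auto simp: fps_X_mult_nth)
    then have "poly (pcompose P ?q) (fps_shift 1 h) = 0"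
      using P(3) by (simp add: poly_pcompose mult.commute)
    moreover have "pcompose P ?q \<noteq> 0" using P(1) pcompose_eq_0[of P ?q] by auto
    moreover have "coeff (pcompose P ?q) i \<in> fps_coeffs_in K" for i
      using const[OF Suc.prems] subring_set_0[OF K] subring_set_1[OF K]
      by (intro coeff_pcompose_in[OF F] P)
         (auto simp: coeff_pCons fps_coeffs_in_def fps_X_def split: nat.splits)
    ultimately have "alg_over (fps_coeffs_in K) (fps_shift 1 h)" by (auto simp: alg_over_def)
    from Suc.IH[OF this] show ?case by simp
  qed (rule const)
  then show ?thesis by (simp add: fps_coeffs_in_def)
qed

text \<open>Kronecker's substitution; the weights lie in an interval \<open>{M..<2 * M}\<close> so that sums of two of them are larger.\<close>

lemma separating_weights:
  fixes F :: "('v::finite \<Rightarrow> nat) set"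
  assumes "finite F"
  obtains e :: "'v \<Rightarrow> nat" and M where
    "M > 0" "\<And>v. M \<le> e v" "\<And>v. e v < 2 * M" "inj e" "inj_on (\<lambda>c. \<Sum>v\<in>UNIV. c v * e v) F"
proof -
  obtain idx0 :: "'v \<Rightarrow> nat" where bij: "bij_betw idx0 UNIV {0..<CARD('v)}"
    using ex_bij_betw_finite_nat[of "UNIV :: 'v set"] by auto
  define L where "L = CARD('v)"
  have idx: "inj idx0" "\<And>v. idx0 v < L"
    using bij by (auto simp: bij_betw_def L_def)
  \<comment> \<open>This is the difference of the weighted sums of \<open>c\<close> and
    \<open>d\<close> as a polynomial in the base of the weights. Since all \<open>idx0 v\<close> are
    below \<open>L\<close>, its coefficient at \<open>idx0 v\<close> is \<open>c v - d v\<close>; so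
    for \<open>c \<noteq> d\<close> it has finitely many roots, and any other base separates the
    two.\<close>
  define p :: "('v \<Rightarrow> nat) \<times> ('v \<Rightarrow> nat) \<Rightarrow> int poly" where
    "p = (\<lambda>(c, d). \<Sum>v\<in>UNIV. monom (int (c v) - int (d v)) (idx0 v) + monom (int (c v) - int (d v)) L)"
  have p_nz: "p (c, d) \<noteq> 0" if "c \<noteq> d" for c d
  proof -
    obtain v where v: "c v \<noteq> d v" using \<open>c \<noteq> d\<close> by auto
    have "coeff (p (c, d)) (idx0 v) = (\<Sum>w\<in>UNIV. if w = v then int (c w) - int (d w) else 0)"
      unfolding p_def using idx(1) less_imp_neq[OF idx(2)[of v]]
      by (auto simp: coeff_sum inj_eq intro!: sum.cong)
    then have "coeff (p (c, d)) (idx0 v) \<noteq> 0" using v by simp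
    then show ?thesis by auto
  qed
  define R where "R = (\<Union>x\<in>{x \<in> F \<times> F. fst x \<noteq> snd x}. {r. poly (p x) r = 0})"
  have "finite R"
    unfolding R_def using assms by (intro finite_UN_I poly_roots_finite) (auto dest: p_nz)
  then have "finite (int -` R)" by (rule finite_vimageI) (auto simp: inj_def)
  then have "finite (int -` R \<union> {..1})" by simp
  then obtain N where N: "N \<notin> int -` R \<union> {..1}" using ex_new_if_finite[OF infinite_UNIV_nat] by blast
  then have N2: "N \<ge> 2" and NR: "int N \<notin> R" by auto
  define e where "e v = N ^ L + N ^ idx0 v" for v
  have w: "int (\<Sum>v\<in>UNIV. c v * e v) - int (\<Sum>v\<in>UNIV. d v * e v) = poly (p (c, d)) (int N)" for c d
    by (simp add: e_def p_def poly_sum poly_monom sum_subtractf[symmetric] algebra_simps)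
  show ?thesis
  proof
    show "N ^ L > 0" using N2 by simp
    show "N ^ L \<le> e v" "e v < 2 * N ^ L" for v
      using N2 idx(2)[of v] power_strict_increasing[of "idx0 v" L N] by (simp_all add: e_def)
    show "inj e"
      using idx(1) N2 by (auto simp: inj_def e_def)
    show "inj_on (\<lambda>c. \<Sum>v\<in>UNIV. c v * e v) F"
    proof (rule inj_onI, rule ccontr)
      fix c d assume *: "c \<in> F" "d \<in> F" "(\<Sum>v\<in>UNIV. c v * e v) = (\<Sum>v\<in>UNIV. d v * e v)" "c \<noteq> d"
      then have "int N \<in> R" unfolding R_def using w[of c d] by force
      then show False using NR by simp
    qed
  qed
qed

lemma sum_mset_counts:
  fixes d :: "'v::finite \<Rightarrow> nat"
  shows "sum_mset (image_mset d \<alpha>) = (\<Sum>v\<in>UNIV. count \<alpha> v * d v)"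
proof (induction \<alpha>)
  case (add x \<alpha>)
  have "(\<Sum>v\<in>UNIV. count (add_mset x \<alpha>) v * d v) = (\<Sum>v\<in>UNIV. (if v = x then d v else 0) + count \<alpha> v * d v)"
    by (intro sum.cong) auto
  then show ?case using add by (simp add: sum.distrib)
qed simp

lemma prod_mset_counts:
  fixes d :: "'v::finite \<Rightarrow> 'b::comm_monoid_mult"
  shows "prod_mset (image_mset d \<alpha>) = (\<Prod>v\<in>UNIV. d v ^ count \<alpha> v)"
proof (induction \<alpha>)
  case (add x \<alpha>)
  have "(\<Prod>v\<in>UNIV. d v ^ count (add_mset x \<alpha>) v) = (\<Prod>v\<in>UNIV. (if v = x then d v else 1) * d v ^ count \<alpha> v)"
    by (intro prod.cong) auto
  then show ?case using add by (simp add: prod.distrib)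
qed simp

lemma sum_option_UNIV:
  "(\<Sum>v\<in>(UNIV :: 'm::finite option set). g v) = g None + (\<Sum>j\<in>UNIV. g (Some j))"
  by (simp add: UNIV_option_conv sum.reindex)

lemma prod_option_UNIV:
  "(\<Prod>v\<in>(UNIV :: 'm::finite option set). g v) = g None * (\<Prod>j\<in>UNIV. g (Some j))"
  by (simp add: UNIV_option_conv prod.reindex)

text \<open>The coefficient of the highest power of \<open>s\<close> is computed. The weights
  separate the y-parts of the monomials, so only monomials with one and the same y-part contribute
  to it, and these differ in their powers of \<open>t\<close>, which are independent over the
  field.\<close>

lemma mps_eval_curve_nonzero:
  fixes p :: "('m::finite option, 'a::field) mps"
  assumes p: "mps_is_poly p" "p \<noteq> 0" and e: "\<And>j. e j > 0"
    and inj: "inj_on (\<lambda>c. \<Sum>j\<in>UNIV. c j * e j) ((\<lambda>\<alpha> j. count \<alpha> (Some j)) ` {\<alpha>. mps_nth p \<alpha> \<noteq> 0})"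
    and l: "\<And>j. l j \<noteq> 0"
  shows "mps_eval fps_const2 p (case_option (fps_const fps_X) (\<lambda>j. fps_const (c j) + fps_const (l j) * fps_X ^ e j)) \<noteq> 0"
proof -
  \<comment> \<open>The curve is polynomial in \<open>s\<close> over \<open>k[[t]]\<close>, which
    makes degree and leading coefficient available; \<open>t\<close> has degree 0.\<close>
  define Q :: "'m option \<Rightarrow> 'a fps poly" where
    "Q = case_option [:fps_X:] (\<lambda>j. [:c j:] + monom (l j) (e j))"
  define d where "d = case_option 0 e"
  define lc where "lc = case_option fps_X l"
  have lc_nz: "lc v \<noteq> 0" for v using l by (auto simp: lc_def split: option.splits)
  have Qv: "degree (Q v) = d v \<and> lead_coeff (Q v) = lc v" for v
  proof (cases v)
    case (Some j)
    have 1: "degree (Q v) = e j"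
      unfolding Q_def Some using l e[of j] degree_add_eq_right[of "[:c j:]" "monom (l j) (e j)"]
      by (simp add: degree_monom_eq)
    then show ?thesis
      unfolding 1 unfolding Q_def Some using e[of j] by (auto simp: d_def lc_def coeff_pCons split: nat.splits)
  qed (simp add: Q_def d_def lc_def)
  let ?m = "\<lambda>x \<alpha>. prod_mset (image_mset x \<alpha>)"
  define wt where "wt \<alpha> = sum_mset (image_mset d \<alpha>)" for \<alpha>
  have Qm: "degree (?m Q \<alpha>) = wt \<alpha> \<and> lead_coeff (?m Q \<alpha>) = ?m lc \<alpha> \<and> ?m lc \<alpha> \<noteq> 0" for \<alpha>
  proof (induction \<alpha>)
    case (add v \<alpha>)
    have Q_nz: "Q v \<noteq> 0" for v using Qv[of v] lc_nz[of v] by auto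
    moreover have "?m Q \<alpha> \<noteq> 0" using Q_nz by auto
    ultimately have "degree (Q v * ?m Q \<alpha>) = wt (add_mset v \<alpha>)"
      using add Qv[of v] by (simp add: wt_def degree_mult_eq)
    moreover have "lead_coeff (Q v * ?m Q \<alpha>) = lc v * ?m lc \<alpha>"
      unfolding lead_coeff_mult using add Qv[of v] by metis
    ultimately show ?case using add lc_nz[of v] by simp
  qed (simp add: wt_def)
  define supp where "supp = {\<alpha>. mps_nth p \<alpha> \<noteq> 0}"
  have fin: "finite supp" using p by (simp add: supp_def mps_is_poly_def)
  have "supp \<noteq> {}" using p(2) mps_eqI[of p 0] by (auto simp: supp_def)
  then have "Max (wt ` supp) \<in> wt ` supp" using fin by simp
  then obtain \<beta> where "\<beta> \<in> supp" "wt \<beta> = Max (wt ` supp)" by auto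
  with fin have \<beta>: "\<beta> \<in> supp" "\<And>\<alpha>. \<alpha> \<in> supp \<Longrightarrow> wt \<alpha> \<le> wt \<beta>" by auto
  have wt: "wt \<alpha> = (\<Sum>j\<in>UNIV. count \<alpha> (Some j) * e j)" for \<alpha>
    by (simp add: wt_def sum_mset_counts sum_option_UNIV d_def)
  \<comment> \<open>All monomials of top weight share their y-part with \<beta>, hence also the
    factor \<Lambda> defined next.\<close>
  have ypart: "count \<alpha> (Some j) = count \<beta> (Some j)" if "\<alpha> \<in> supp" "wt \<alpha> = wt \<beta>" for \<alpha> j
    using inj_onD[OF inj, of "\<lambda>j. count \<alpha> (Some j)" "\<lambda>j. count \<beta> (Some j)"] that \<beta>(1)
    by (auto simp: supp_def wt dest: fun_cong)
  define \<Lambda> where "\<Lambda> = (\<Prod>j\<in>UNIV. l j ^ count \<beta> (Some j))"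
  have \<Lambda>: "\<Lambda> \<noteq> 0" using l by (simp add: \<Lambda>_def)
  define q where "q = mps_eval (\<lambda>c. [:fps_const c:]) p Q"
  have "coeff q (wt \<beta>) = (\<Sum>\<alpha>\<in>supp. fps_const (mps_nth p \<alpha>) * coeff (?m Q \<alpha>) (wt \<beta>))"
    by (simp add: q_def mps_eval_def coeff_sum supp_def)
  also have "\<dots> = (\<Sum>\<alpha>\<in>{\<alpha> \<in> supp. wt \<alpha> = wt \<beta>}. fps_const (mps_nth p \<alpha>) * coeff (?m Q \<alpha>) (wt \<beta>))"
  proof (rule sum.mono_neutral_right[OF fin])
    show "\<forall>\<alpha>\<in>supp - {\<alpha> \<in> supp. wt \<alpha> = wt \<beta>}. fps_const (mps_nth p \<alpha>) * coeff (?m Q \<alpha>) (wt \<beta>) = 0"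
    proof
      fix \<alpha> assume "\<alpha> \<in> supp - {\<alpha> \<in> supp. wt \<alpha> = wt \<beta>}"
      then have "wt \<alpha> < wt \<beta>" using \<beta>(2)[of \<alpha>] by auto
      then show "fps_const (mps_nth p \<alpha>) * coeff (?m Q \<alpha>) (wt \<beta>) = 0"
        using Qm[of \<alpha>] by (simp add: coeff_eq_0)
    qed
  qed auto
  also have "\<dots> = (\<Sum>\<alpha>\<in>{\<alpha> \<in> supp. wt \<alpha> = wt \<beta>}. fps_const (mps_nth p \<alpha>) * fps_X ^ count \<alpha> None * \<Lambda>)"
  proof (intro sum.cong refl)
    fix \<alpha> assume \<alpha>: "\<alpha> \<in> {\<alpha> \<in> supp. wt \<alpha> = wt \<beta>}"
    then have "coeff (?m Q \<alpha>) (wt \<beta>) = ?m lc \<alpha>" using Qm[of \<alpha>] by auto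
    also have "\<dots> = fps_X ^ count \<alpha> None * \<Lambda>"
      using \<alpha> ypart[of \<alpha>] by (simp add: prod_mset_counts prod_option_UNIV lc_def \<Lambda>_def)
    finally show "fps_const (mps_nth p \<alpha>) * coeff (?m Q \<alpha>) (wt \<beta>)
        = fps_const (mps_nth p \<alpha>) * fps_X ^ count \<alpha> None * \<Lambda>" by (simp add: mult.assoc)
  qed
  finally have coeff_q: "coeff q (wt \<beta>)
    = (\<Sum>\<alpha>\<in>{\<alpha> \<in> supp. wt \<alpha> = wt \<beta>}. fps_const (mps_nth p \<alpha>) * fps_X ^ count \<alpha> None) * \<Lambda>" (is "_ = ?s * _")
    by (simp add: sum_distrib_right)
  \<comment> \<open>Among monomials with the same y-part the exponent of \<open>t\<close> singles
    out \<beta>.\<close>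
  have "fps_nth ?s (count \<beta> None) = (\<Sum>\<alpha>\<in>{\<alpha> \<in> supp. wt \<alpha> = wt \<beta>}. if \<alpha> = \<beta> then mps_nth p \<alpha> else 0)"
    unfolding fps_sum_nth
  proof (intro sum.cong refl)
    fix \<alpha> assume \<alpha>: "\<alpha> \<in> {\<alpha> \<in> supp. wt \<alpha> = wt \<beta>}"
    have "\<alpha> = \<beta>" if "count \<alpha> None = count \<beta> None"
    proof (rule multiset_eqI)
      show "count \<alpha> v = count \<beta> v" for v using that ypart[of \<alpha>] \<alpha> by (cases v) auto
    qed
    then show "fps_nth (fps_const (mps_nth p \<alpha>) * fps_X ^ count \<alpha> None) (count \<beta> None)
       = (if \<alpha> = \<beta> then mps_nth p \<alpha> else 0)" by auto
  qed
  also have "\<dots> = mps_nth p \<beta>" using fin \<beta>(1) by simp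
  finally have "?s \<noteq> 0" using \<beta>(1) by (auto simp: supp_def)
  then have "q \<noteq> 0" using coeff_q \<Lambda> by auto
  moreover have "mps_eval fps_const2 p (case_option (fps_const fps_X) (\<lambda>j. fps_const (c j) + fps_const (l j) * fps_X ^ e j))
      = fps_of_poly q"
  proof -
    have h: "comm_ring_hom (fps_of_poly :: 'a fps poly \<Rightarrow> _)"
      by unfold_locales (simp_all add: fps_of_poly_add fps_of_poly_mult)
    have "fps_of_poly (Q v) = case_option (fps_const fps_X) (\<lambda>j. fps_const (c j) + fps_const (l j) * fps_X ^ e j) v" for v
      by (cases v) (simp_all add: Q_def fps_of_poly_const fps_of_poly_add fps_of_poly_monom)
    then show ?thesis
      unfolding q_def by (subst mps_eval_hom[OF h]) (simp add: fps_of_poly_const fps_const2_def[abs_def])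
  qed
  ultimately show ?thesis by (metis fps_of_poly_0 fps_of_poly_eq_iff)
qed

text \<open>A leading-term argument: among the monomials of least total degree the separating
  weights select one in each factor, and no other pair can produce the product of the two. The
  instance makes \<open>alg_closure\<close> available inside the power series ring.\<close>

instance mps :: (finite, idom) idom
proof
  fix f g :: "('a, 'b) mps"
  assume "f \<noteq> 0" "g \<noteq> 0"
  have least: "\<exists>n. (\<exists>\<alpha>. mps_nth f \<alpha> \<noteq> 0 \<and> size \<alpha> = n) \<and> (\<forall>\<alpha>. mps_nth f \<alpha> \<noteq> 0 \<longrightarrow> n \<le> size \<alpha>)"
    if f: "f \<noteq> 0" for f :: "('a, 'b) mps"
  proof -
    have "\<exists>\<alpha>. mps_nth f \<alpha> \<noteq> 0" using f mps_eqI[of f 0] by auto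
    then obtain \<alpha> where "mps_nth f \<alpha> \<noteq> 0" "\<And>\<beta>. mps_nth f \<beta> \<noteq> 0 \<Longrightarrow> size \<alpha> \<le> size \<beta>"
      using exists_least_iff[of "\<lambda>n. \<exists>\<alpha>. mps_nth f \<alpha> \<noteq> 0 \<and> size \<alpha> = n"] by (metis leI)
    then show ?thesis by blast
  qed
  obtain n where n: "\<exists>\<alpha>. mps_nth f \<alpha> \<noteq> 0 \<and> size \<alpha> = n" "\<And>\<alpha>. mps_nth f \<alpha> \<noteq> 0 \<Longrightarrow> n \<le> size \<alpha>"
    using least[OF \<open>f \<noteq> 0\<close>] by blast
  obtain k where k: "\<exists>\<alpha>. mps_nth g \<alpha> \<noteq> 0 \<and> size \<alpha> = k" "\<And>\<alpha>. mps_nth g \<alpha> \<noteq> 0 \<Longrightarrow> k \<le> size \<alpha>"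
    using least[OF \<open>g \<noteq> 0\<close>] by blast
  have "finite (count ` {\<alpha> :: 'a multiset. size \<alpha> \<le> n + k})" by (intro finite_imageI finite_size_le)
  then obtain e :: "'a \<Rightarrow> nat" where
    e: "inj_on (\<lambda>c. \<Sum>v\<in>UNIV. c v * e v) (count ` {\<alpha> :: 'a multiset. size \<alpha> \<le> n + k})"
    by (rule separating_weights)
  define wt where "wt \<alpha> = (\<Sum>v\<in>UNIV. count \<alpha> v * e v)" for \<alpha> :: "'a multiset"
  have wt_inj: "\<alpha> = \<beta>" if "size \<alpha> \<le> n + k" "size \<beta> \<le> n + k" "wt \<alpha> = wt \<beta>" for \<alpha> \<beta>
    using inj_onD[OF e, of "count \<alpha>" "count \<beta>"] that by (simp add: wt_def count_inject)
  have wt_add: "wt (\<alpha> + \<beta>) = wt \<alpha> + wt \<beta>" for \<alpha> \<beta>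
    by (simp add: wt_def sum.distrib algebra_simps)
  have min: "\<exists>\<alpha>. P \<alpha> \<and> (\<forall>\<beta>. P \<beta> \<longrightarrow> wt \<alpha> \<le> wt \<beta>)" if "\<exists>\<alpha>. P \<alpha>" for P
    using that exists_least_iff[of "\<lambda>n. \<exists>\<alpha>. P \<alpha> \<and> wt \<alpha> = n"] by (metis leI)
  obtain \<alpha> where \<alpha>: "mps_nth f \<alpha> \<noteq> 0" "size \<alpha> = n" "\<And>\<beta>. mps_nth f \<beta> \<noteq> 0 \<Longrightarrow> size \<beta> = n \<Longrightarrow> wt \<alpha> \<le> wt \<beta>"
    using min[OF n(1)] by blast
  obtain \<beta> where \<beta>: "mps_nth g \<beta> \<noteq> 0" "size \<beta> = k" "\<And>\<alpha>. mps_nth g \<alpha> \<noteq> 0 \<Longrightarrow> size \<alpha> = k \<Longrightarrow> wt \<beta> \<le> wt \<alpha>"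
    using min[OF k(1)] by blast
  have "mps_nth (f * g) (\<alpha> + \<beta>) = (\<Sum>(\<alpha>', \<beta>')\<in>{(\<alpha>, \<beta>)}. mps_nth f \<alpha>' * mps_nth g \<beta>')"
    unfolding mps_nth_mult
  proof (rule sum.mono_neutral_right[OF finite_splits])
    show "\<forall>x\<in>splits (\<alpha> + \<beta>) - {(\<alpha>, \<beta>)}. (case x of (\<alpha>', \<beta>') \<Rightarrow> mps_nth f \<alpha>' * mps_nth g \<beta>') = 0"
    proof (intro ballI, rule ccontr)
      fix x assume x: "x \<in> splits (\<alpha> + \<beta>) - {(\<alpha>, \<beta>)}"
        "(case x of (\<alpha>', \<beta>') \<Rightarrow> mps_nth f \<alpha>' * mps_nth g \<beta>') \<noteq> 0"
      obtain \<alpha>' \<beta>' where "x = (\<alpha>', \<beta>')" by (cases x)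
      with x have *: "(\<alpha>', \<beta>') \<in> splits (\<alpha> + \<beta>)" "(\<alpha>', \<beta>') \<noteq> (\<alpha>, \<beta>)"
        "mps_nth f \<alpha>' * mps_nth g \<beta>' \<noteq> 0" by auto
      then have eq: "\<alpha>' + \<beta>' = \<alpha> + \<beta>" by (simp add: splits_def)
      have nz: "mps_nth f \<alpha>' \<noteq> 0" "mps_nth g \<beta>' \<noteq> 0" using * by auto
      have "size \<alpha>' + size \<beta>' = n + k" using arg_cong[OF eq, of size] \<alpha> \<beta> by simp
      then have sz: "size \<alpha>' = n" "size \<beta>' = k" using n(2)[OF nz(1)] k(2)[OF nz(2)] by auto
      have "wt \<alpha>' + wt \<beta>' = wt \<alpha> + wt \<beta>" using arg_cong[OF eq, of wt] by (simp add: wt_add)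
      then have "wt \<alpha> = wt \<alpha>'" using \<alpha>(3)[OF nz(1) sz(1)] \<beta>(3)[OF nz(2) sz(2)] by simp
      then have "\<alpha> = \<alpha>'" using wt_inj \<alpha> sz by simp
      then show False using eq * by simp
    qed
  qed (simp add: splits_def)
  then have "mps_nth (f * g) (\<alpha> + \<beta>) \<noteq> 0" using \<alpha> \<beta> by simp
  then show "f * g \<noteq> 0" by auto
qed

section \<open>Algebraic arcs\<close>

text \<open>Coefficientwise Banach iteration. The sets \<open>C i\<close> encode divisibility
  conditions on the domain, and the coefficient type is general so that the lemma applies to series
  in \<open>t\<close> as well as to series in \<open>s\<close> over \<open>k[[t]]\<close>. The last
  conclusion gives each coefficient through one fixed iterate, from which its polynomial form is
  read off later.\<close>

lemma fps_fixpoint: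
  fixes \<Psi> :: "('i \<Rightarrow> 'b::zero fps) \<Rightarrow> 'i \<Rightarrow> 'b fps" and C :: "nat \<Rightarrow> 'b set"
  defines "X \<equiv> {Y. \<forall>j i. fps_nth (Y j) i \<in> C i}"
  assumes Y0: "Y0 \<in> X" and inv: "\<And>Y. Y \<in> X \<Longrightarrow> \<Psi> Y \<in> X"
    and contr: "\<And>Y Y' n j i. Y \<in> X \<Longrightarrow> Y' \<in> X \<Longrightarrow>
      (\<And>j i. i < n \<Longrightarrow> fps_nth (Y j) i = fps_nth (Y' j) i) \<Longrightarrow> i \<le> n \<Longrightarrow>
      fps_nth (\<Psi> Y j) i = fps_nth (\<Psi> Y' j) i"
  obtains Y where "Y \<in> X" "\<Psi> Y = Y"
    "\<And>j i. fps_nth (Y j) i = fps_nth ((\<Psi> ^^ Suc i) Y0 j) i"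
proof -
  have X: "(\<Psi> ^^ k) Y0 \<in> X" for k by (induction k) (auto simp: Y0 inv)
  have step: "fps_nth ((\<Psi> ^^ k) Y0 j) i = fps_nth ((\<Psi> ^^ Suc k) Y0 j) i" if "i < k" for k i j
    using that
  proof (induction k arbitrary: i j)
    case (Suc k)
    then show ?case using contr[OF X X, of k k "Suc k" i j] by simp
  qed simp
  have stable: "fps_nth ((\<Psi> ^^ k) Y0 j) i = fps_nth ((\<Psi> ^^ Suc i) Y0 j) i" if "i < k" for k i j
    using that
  proof (induction k)
    case (Suc k)
    show ?case
    proof (cases "i < k")
      case True
      then show ?thesis using Suc.IH step[OF True, of j] by simp
    next
      case False
      then have "k = i" using Suc.prems by simp
      then show ?thesis by simp
    qed
  qed simp
  define Y where "Y j = Abs_fps (\<lambda>i. fps_nth ((\<Psi> ^^ Suc i) Y0 j) i)" for j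
  have YX: "Y \<in> X" using X[of "Suc i" for i] unfolding X_def Y_def by auto
  have "\<Psi> Y = Y"
  proof (intro ext fps_ext)
    fix j i
    have "fps_nth (\<Psi> Y j) i = fps_nth (\<Psi> ((\<Psi> ^^ i) Y0) j) i"
      by (rule contr[OF YX X, of i]) (use stable in \<open>auto simp: Y_def\<close>)
    then show "fps_nth (\<Psi> Y j) i = fps_nth (Y j) i" by (simp add: Y_def)
  qed
  then show ?thesis by (rule that[OF YX]) (simp add: Y_def)
qed

section \<open>Arcs and their deformations\<close>

definition zero_arc :: "'a::zero fps ^ 'm \<Rightarrow> bool" where
  "zero_arc y \<longleftrightarrow> (\<forall>j. fps_nth (y $ j) 0 = 0)"

lemma zero_arc_subst: "zero_arc (y :: 'a::field fps ^ 'm) \<Longrightarrow> fps_nth (case_option fps_X (\<lambda>j. y $ j) v) 0 = 0"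
  by (auto simp: zero_arc_def split: option.splits)

lemma hom_at_arc: "zero_arc y \<Longrightarrow> comm_ring_hom (\<lambda>h. at_arc h y)"
  unfolding at_arc_def by (intro hom_mps_subst zero_arc_subst)

lemma at_arc_poly: "zero_arc y \<Longrightarrow> mps_is_poly p \<Longrightarrow>
    at_arc p y = mps_eval fps_const p (case_option fps_X (\<lambda>j. y $ j))"
  unfolding at_arc_def by (intro mps_subst_poly zero_arc_subst)

lemma at_arc_taylor_dvd:
  fixes f :: "('m::finite option, 'a::field) mps" and z a b :: "'a fps ^ 'm"
  assumes z: "zero_arc z" and a0: "zero_arc a" and b0: "zero_arc b"
    and a: "\<And>j. fps_X ^ p dvd a $ j" and b: "\<And>j. fps_X ^ p dvd b $ j"
    and ab: "\<And>j. fps_X ^ p' dvd a $ j - b $ j"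
  shows "fps_X ^ (p + p') dvd at_arc f (z + a) - at_arc f (z + b)
     - (\<Sum>j\<in>UNIV. at_arc (mps_deriv (Some j) f) z * (a $ j - b $ j))"
proof -
  let ?z = "case_option fps_X (\<lambda>j. z $ j)" and ?a = "case_option 0 (\<lambda>j. a $ j)" and ?b = "case_option 0 (\<lambda>j. b $ j)"
  have eq: "(\<lambda>v. ?z v + case_option 0 (\<lambda>j. c $ j) v) = case_option fps_X (\<lambda>j. z $ j + c $ j)" for c :: "'a fps ^ 'm"
    by (auto split: option.splits)
  have "fps_X ^ (p + p') dvd mps_subst f (\<lambda>v. ?z v + ?a v) - mps_subst f (\<lambda>v. ?z v + ?b v)
     - (\<Sum>v\<in>UNIV. mps_subst (mps_deriv v f) ?z * (?a v - ?b v))"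
    by (rule mps_subst_taylor_dvd)
       (use assms in \<open>auto simp: zero_arc_def split: option.splits\<close>)
  then show ?thesis unfolding eq sum_option_UNIV by (simp add: at_arc_def)
qed

text \<open>A deformation of the arc \<open>y\<close> in the outer variable \<open>s\<close>, with
  \<open>t\<close> kept fixed.\<close>

definition at_curve :: "('m::finite option, 'a::field) mps \<Rightarrow> 'a fps ^ 'm \<Rightarrow> ('m \<Rightarrow> 'a fps fps) \<Rightarrow> 'a fps fps" where
  "at_curve h y Y = mps_subst2 h (case_option (fps_const fps_X) (\<lambda>j. fps_const (y $ j) + Y j))"

context
  fixes y :: "'a::field fps ^ 'm::finite" and Y :: "'m \<Rightarrow> 'a fps fps"
  assumes y: "zero_arc y" and Y: "\<And>j. monom2 1 0 dvd Y j"
begin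

lemma curve_small: "ord2_ge (Suc 0) (case_option (fps_const fps_X) (\<lambda>j. fps_const (y $ j) + Y j) v)"
  using y Y by (auto simp: ord2_ge_def zero_arc_def monom2_dvd_iff split: option.splits)

lemma hom_at_curve: "comm_ring_hom (\<lambda>h. at_curve h y Y)"
  unfolding at_curve_def by (intro hom_mps_subst2 curve_small)

lemma at_curve_poly: "mps_is_poly p \<Longrightarrow>
    at_curve p y Y = mps_eval fps_const2 p (case_option (fps_const fps_X) (\<lambda>j. fps_const (y $ j) + Y j))"
  unfolding at_curve_def by (intro mps_subst2_poly curve_small)

lemma at_curve_var: "at_curve (mps_var v) y Y = case_option (fps_const fps_X) (\<lambda>j. fps_const (y $ j) + Y j) v"
  by (simp add: at_curve_poly comm_ring_hom.mps_eval_var[OF hom_fps_const2])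

lemma at_curve_const: "at_curve (mps_const c) y Y = fps_const2 c"
  by (simp add: at_curve_poly comm_ring_hom.mps_eval_const[OF hom_fps_const2])

lemma at_curve_taylor_dvd:
  assumes Y': "\<And>j. monom2 1 0 dvd Y' j"
    and a: "\<And>j. monom2 q p dvd Y j" and b: "\<And>j. monom2 q p dvd Y' j"
    and ab: "\<And>j. monom2 q' p' dvd Y j - Y' j"
  shows "monom2 (q + q') (p + p') dvd at_curve f y Y - at_curve f y Y'
     - (\<Sum>j\<in>UNIV. fps_const (at_arc (mps_deriv (Some j) f) y) * (Y j - Y' j))"
proof -
  let ?z = "case_option (fps_const fps_X) (\<lambda>j. fps_const (y $ j))"
    and ?a = "case_option 0 Y" and ?b = "case_option 0 Y'"
  have eq: "(\<lambda>v. ?z v + case_option 0 Z v) = case_option (fps_const fps_X) (\<lambda>j. fps_const (y $ j) + Z j)" for Z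
    by (auto split: option.splits)
  have z: "?z = (\<lambda>v. fps_const (case_option fps_X (\<lambda>j. y $ j) v))" by (auto split: option.splits)
  have "monom2 (q + q') (p + p') dvd mps_subst2 f (\<lambda>v. ?z v + ?a v) - mps_subst2 f (\<lambda>v. ?z v + ?b v)
     - (\<Sum>v\<in>UNIV. mps_subst2 (mps_deriv v f) ?z * (?a v - ?b v))"
    by (rule mps_subst2_taylor_dvd)
       (use y a b ab Y Y' in \<open>auto simp: zero_arc_def ord2_ge_def monom2_dvd_iff split: option.splits\<close>)
  then show ?thesis unfolding eq sum_option_UNIV unfolding z mps_subst2_const
    by (simp add: at_arc_def at_curve_def)
qed

end

lemma at_curve_zero: "at_curve h y (\<lambda>_. 0) = fps_const (at_arc h y)"
proof -
  have "(case_option (fps_const fps_X) (\<lambda>j. fps_const (y $ j) + 0))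
      = (\<lambda>v. fps_const (case_option fps_X (\<lambda>j. y $ j) v))" by (auto split: option.splits)
  then show ?thesis by (simp add: at_curve_def at_arc_def mps_subst2_const)
qed

section \<open>Algebraic series in \<open>t\<close>, and series in \<open>s\<close> with such
  coefficients\<close>

definition alg_series :: "'a::field fps set" where
  "alg_series = {h. alg_over (range fps_of_poly) h}"

lemma subring_set_range_fps_of_poly: "subring_set (range (fps_of_poly :: 'a::field poly \<Rightarrow> _))"
  unfolding subring_set_def
  by (auto simp: fps_of_poly_mult[symmetric] fps_of_poly_diff[symmetric] intro: range_eqI[of _ _ 1])

lemma series1_Algebraic: "series1 Algebraic = alg_series"
proof -
  have "(\<exists>P::'a poly poly. P \<noteq> 0 \<and> poly (map_poly fps_of_poly P) h = 0) \<longleftrightarrow> alg_over (range fps_of_poly) h" for h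
  proof
    assume "\<exists>P::'a poly poly. P \<noteq> 0 \<and> poly (map_poly fps_of_poly P) h = 0"
    then obtain P :: "'a poly poly" where P: "P \<noteq> 0" "poly (map_poly fps_of_poly P) h = 0" by blast
    have "map_poly fps_of_poly P \<noteq> 0"
      using P(1) fps_of_poly_eq_iff[of _ 0] by (simp add: map_poly_eq_0_iff)
    then show "alg_over (range fps_of_poly) h"
      using P unfolding alg_over_def by (intro exI[of _ "map_poly fps_of_poly P"]) (auto simp: coeff_map_poly)
  next
    assume "alg_over (range fps_of_poly) h"
    then obtain P where P: "P \<noteq> 0" "\<And>i. coeff P i \<in> range fps_of_poly" "poly P h = 0"
      by (auto simp: alg_over_def)
    define g where "g = inv (fps_of_poly :: 'a poly \<Rightarrow> _)"
    have g: "fps_of_poly (g (coeff P i)) = coeff P i" for i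
      unfolding g_def using P(2) by (simp add: f_inv_into_f)
    have g0: "g 0 = 0"
      unfolding g_def by (rule inv_f_eq) (auto simp: inj_def fps_of_poly_eq_iff)
    have "map_poly fps_of_poly (map_poly g P) = P"
      by (rule poly_eqI) (simp add: coeff_map_poly g0 g)
    with P show "\<exists>P::'a poly poly. P \<noteq> 0 \<and> poly (map_poly fps_of_poly P) h = 0"
      by (intro exI[of _ "map_poly g P"]) auto
  qed
  then show ?thesis by (auto simp: alg_series_def)
qed

lemma subring_set_alg_series: "subring_set alg_series"
  unfolding alg_series_def by (intro subring_set_alg_over subring_set_range_fps_of_poly)

lemma alg_series_closed: "alg_over alg_series x \<Longrightarrow> x \<in> alg_series"
  unfolding alg_series_def using alg_over_trans[OF subring_set_range_fps_of_poly] by blast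

lemma fps_of_poly_in_alg_series: "fps_of_poly p \<in> alg_series"
  unfolding alg_series_def by (simp add: alg_over_self subring_set_range_fps_of_poly)

lemma fps_const_in_alg_series: "fps_const c \<in> alg_series"
  using fps_of_poly_in_alg_series[of "[:c:]"] by (simp add: fps_of_poly_const)

lemma fps_X_in_alg_series: "fps_X \<in> alg_series"
  using fps_of_poly_in_alg_series[of "[:0, 1:]"] by simp

abbreviation "alg_series2 \<equiv> fps_coeffs_in alg_series"

lemmas subring_alg_series2 = subring_set_fps_coeffs_in[OF subring_set_alg_series]

lemma const_in_alg_series2: "x \<in> alg_series \<Longrightarrow> fps_const x \<in> alg_series2"
  by (auto simp: fps_coeffs_in_def subring_set_0[OF subring_set_alg_series])

lemma X_in_alg_series2: "fps_X \<in> alg_series2"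
  by (auto simp: fps_coeffs_in_def fps_X_def subring_set_0[OF subring_set_alg_series] subring_set_1[OF subring_set_alg_series])

lemma alg_series2_closed: "alg_over alg_series2 x \<Longrightarrow> x \<in> alg_series2"
  by (rule alg_over_fps_coeffs_in[OF subring_set_alg_series alg_series_closed])

lemma mps_eval_in_subring:
  assumes "subring_set S" "\<And>c. h c \<in> S" "\<And>v. x v \<in> S" shows "mps_eval h p x \<in> S"
  unfolding mps_eval_def
  by (intro subring_set_sum[OF assms(1)] subring_set_mult[OF assms(1)] subring_set_prod_mset[OF assms(1)] assms)

text \<open>The equation of \<open>f\<close> may vanish identically on the arc. It is therefore
  restricted to the curve \<open>y + s^e\<close>, with weights for which its leading coefficient
  survives. The value of \<open>f\<close> on the curve then has algebraic coefficients in
  \<open>s\<close>: the one of \<open>s^0\<close> is the value on the arc, the one of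
  \<open>s^(e j)\<close> is the derivative in direction \<open>j\<close>.\<close>

lemma algebraic_at_arc:
  fixes f :: "('m::finite option, 'a::field) mps" and y :: "'a fps ^ 'm"
  assumes f: "f \<in> series Algebraic" and y0: "zero_arc y" and y: "\<And>j. y $ j \<in> alg_series"
  shows "at_arc f y \<in> alg_series" and "at_arc (mps_deriv (Some j) f) y \<in> alg_series"
proof -
  obtain P where P: "P \<noteq> 0" "\<And>i. mps_is_poly (coeff P i)" "poly P f = 0"
    using f by auto
  define p where "p = lead_coeff P"
  have p: "p \<noteq> 0" "mps_is_poly p" using P by (auto simp: p_def)
  have fin: "finite ((\<lambda>\<alpha> j. count \<alpha> (Some j)) ` {\<alpha>. mps_nth p \<alpha> \<noteq> 0})"
    using p(2) by (simp add: mps_is_poly_def)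
  obtain e :: "'m \<Rightarrow> nat" and M where e: "M > 0" "\<And>v. M \<le> e v" "\<And>v. e v < 2 * M" "inj e"
    "inj_on (\<lambda>c. \<Sum>v\<in>UNIV. c v * e v) ((\<lambda>\<alpha> j. count \<alpha> (Some j)) ` {\<alpha>. mps_nth p \<alpha> \<noteq> 0})"
    by (rule separating_weights[OF fin], rule that)
  define Y :: "'m \<Rightarrow> 'a fps fps" where "Y j = fps_X ^ e j" for j
  have YM: "monom2 M 0 dvd Y j" for j
    using e(2)[of j] by (auto simp: monom2_dvd_iff Y_def)
  have Y: "monom2 1 0 dvd Y j" for j
    using e(1) e(2)[of j] by (auto simp: monom2_dvd_iff Y_def)
  interpret \<phi>: comm_ring_hom "\<lambda>h. at_curve h y Y" by (rule hom_at_curve[OF y0 Y])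
  have in2: "at_curve q y Y \<in> alg_series2" if "mps_is_poly q" for q
    unfolding at_curve_poly[OF y0 Y that]
    by (rule mps_eval_in_subring[OF subring_alg_series2])
       (auto simp: fps_const2_def Y_def y split: option.splits
         intro!: const_in_alg_series2 fps_const_in_alg_series fps_X_in_alg_series
           subring_set_add[OF subring_alg_series2] subring_set_power[OF subring_alg_series2] X_in_alg_series2)
  have "at_curve p y Y = mps_eval fps_const2 p (case_option (fps_const fps_X) (\<lambda>j. fps_const (y $ j) + fps_const 1 * fps_X ^ e j))"
    unfolding at_curve_poly[OF y0 Y p(2)] by (simp add: Y_def)
  moreover have "\<dots> \<noteq> 0"
    using e(1,2,5) p by (intro mps_eval_curve_nonzero) (auto intro: less_le_trans)
  ultimately have "map_poly (\<lambda>h. at_curve h y Y) P \<noteq> 0"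
    unfolding p_def using coeff_map_poly[of "\<lambda>h. at_curve h y Y" P "degree P", OF \<phi>.hom_zero] by auto
  moreover have "poly (map_poly (\<lambda>h. at_curve h y Y) P) (at_curve f y Y) = 0"
    using P(3) by (simp add: \<phi>.hom_poly[symmetric] \<phi>.hom_zero)
  ultimately have "alg_over alg_series2 (at_curve f y Y)"
    unfolding alg_over_def using in2 P(2)
    by (intro exI[of _ "map_poly (\<lambda>h. at_curve h y Y) P"]) (auto simp: coeff_map_poly \<phi>.hom_zero)
  then have mem: "fps_nth (at_curve f y Y) n \<in> alg_series" for n
    using alg_series2_closed by (auto simp: fps_coeffs_in_def)
  have T: "monom2 (M + M) (0 + 0) dvd at_curve f y Y - at_curve f y (\<lambda>_. 0)
     - (\<Sum>j\<in>UNIV. fps_const (at_arc (mps_deriv (Some j) f) y) * (Y j - 0))"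
    by (rule at_curve_taylor_dvd[OF y0 Y]) (use YM in auto)
  \<comment> \<open>\<open>Y\<close> is divisible by \<open>s^M\<close>, so the quadratic part
    starts at \<open>s^(2 M)\<close>, beyond all weights; the linear terms below it do not overlap,
    as the weights are distinct.\<close>
  then have low: "fps_nth (at_curve f y Y) i
      = (if i = 0 then at_arc f y else 0) + (\<Sum>j\<in>UNIV. if e j = i then at_arc (mps_deriv (Some j) f) y else 0)"
    if "i < 2 * M" for i
  proof -
    have "fps_nth (at_curve f y Y - at_curve f y (\<lambda>_. 0)
     - (\<Sum>j\<in>UNIV. fps_const (at_arc (mps_deriv (Some j) f) y) * (Y j - 0))) i = 0"
      using that T by (intro fps_ext) (simp add: monom2_dvd_iff)
    moreover have "fps_nth (fps_const x * (Y j - 0)) i = (if e j = i then x else 0)" for x j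
      by (simp add: Y_def)
    ultimately show ?thesis 
      by (auto simp: at_curve_zero fps_sum_nth diff_eq_eq add.commute simp del: diff_zero)
  qed
  have "e j \<noteq> 0" for j using e(1) e(2)[of j] by simp
  then show "at_arc f y \<in> alg_series" using low[of 0] mem[of 0] e(1) by (simp del: neq0_conv)
  have "(\<Sum>j'\<in>UNIV. if e j' = e j then at_arc (mps_deriv (Some j') f) y else 0)
      = (\<Sum>j'\<in>UNIV. if j' = j then at_arc (mps_deriv (Some j') f) y else 0)"
    using e(4) by (intro sum.cong) (auto simp: inj_eq)
  then show "at_arc (mps_deriv (Some j) f) y \<in> alg_series"
    using low[of "e j"] mem[of "e j"] e(3)[of j] \<open>e j \<noteq> 0\<close> by (simp del: neq0_conv)
qed

text \<open>
  Newton's method: division by \<open>g\<close> costs a factor \<open>t\<^sup>d\<close>, so the error term, quadratic in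
  \<open>Y \<in> t\<^sup>d s k[[t]][[s]]\<close>, stays divisible by \<open>t\<^sup>d s\<^sup>2\<close>.
\<close>

lemma curve_with_given_image:
  fixes F :: "'m::finite \<Rightarrow> ('m option, 'a::field) mps" and y :: "'a fps ^ 'm"
  assumes y0: "zero_arc y" and g0: "at_arc g y \<noteq> 0" and d: "d = subdegree (at_arc g y)"
    and B: "\<And>p r. (\<Sum>q\<in>UNIV. mps_deriv (Some q) (F p) * B q r) = (if p = r then g else 0)"
    and e: "\<And>p. e p > 0"
  obtains Y where "\<And>j. monom2 1 0 dvd Y j"
    "\<And>p. at_curve (F p) y Y = fps_const (at_arc (F p) y) + fps_const (fps_X ^ (2 * d)) * fps_X ^ e p"
proof -
  define J where "J p q = at_arc (mps_deriv (Some q) (F p)) y" for p q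
  define b where "b q r = at_arc (B q r) y" for q r
  define \<gamma> where "\<gamma> = at_arc g y"
  define \<nu> where "\<nu> = inverse (fps_shift d \<gamma>)"
  interpret h: comm_ring_hom "\<lambda>h. at_arc h y" by (rule hom_at_arc[OF y0])
  have Jb: "(\<Sum>q\<in>UNIV. J p q * b q r) = (if p = r then \<gamma> else 0)" for p r
    using arg_cong[OF B[of p r], of "\<lambda>h. at_arc h y"]
    by (auto simp: h.hom_sum h.hom_mult h.hom_zero J_def b_def \<gamma>_def)
  have \<gamma>: "\<gamma> = fps_X ^ d * fps_shift d \<gamma>"
    using d fps_shift_times_fps_X_power[of d \<gamma>] by (simp add: \<gamma>_def mult.commute)
  have "fps_nth (fps_shift d \<gamma>) 0 \<noteq> 0" using g0 d by (simp add: \<gamma>_def)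
  then have \<nu>: "fps_shift d \<gamma> * \<nu> = 1" unfolding \<nu>_def by (rule inverse_mult_eq_1')
  define E where "E Y r = at_curve (F r) y Y - fps_const (at_arc (F r) y) - (\<Sum>j\<in>UNIV. fps_const (J r j) * Y j)" for Y r
  \<comment> \<open>The required equation reads J Y = R(Y). As J b = \<gamma> 1, it follows from the
    fixed-point equation Y = b R(Y) / \<gamma>.\<close>
  define R where "R Y r = fps_const (fps_X ^ (2 * d)) * fps_X ^ e r - E Y r" for Y r
  \<comment> \<open>Division by \<gamma>, correct on multiples of \<open>t^d\<close>; elsewhere the
    shift discards terms.\<close>
  define dv where "dv x = Abs_fps (\<lambda>i. \<nu> * fps_shift d (fps_nth x i))" for x :: "'a fps fps"
  define \<Psi> where "\<Psi> Y q = dv (\<Sum>r\<in>UNIV. fps_const (b q r) * R Y r)" for Y q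
  define C :: "nat \<Rightarrow> 'a fps set" where "C i = {x. \<forall>n. i = 0 \<or> n < d \<longrightarrow> fps_nth x n = 0}" for i
  have X: "(\<forall>j i. fps_nth (Y j) i \<in> C i) \<longleftrightarrow> (\<forall>j. monom2 1 d dvd Y j)" for Y :: "'m \<Rightarrow> 'a fps fps"
    by (simp add: C_def monom2_dvd_iff)
  have small: "monom2 1 0 dvd Y j" if "monom2 1 d dvd Y j" for Y :: "'m \<Rightarrow> 'a fps fps" and j
    using that by (auto simp: monom2_dvd_iff)
  have dv_dvd: "monom2 q p dvd dv x" if "monom2 q (d + p) dvd x" for q p x
  proof -
    obtain x' where x': "x = monom2 q (d + p) * x'" using \<open>monom2 q (d + p) dvd x\<close> by blast
    have "monom2 q (d + p) = (fps_const (fps_X ^ d) * monom2 q p :: 'a fps fps)"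
      by (simp add: monom2_def power_add mult_ac flip: fps_const_mult del: fps_const_power)
    then have "x = fps_const (fps_X ^ d) * (monom2 q p * x')"
      by (simp only: x' mult.assoc)
    then have "fps_nth x i = fps_nth (monom2 q p * x') i * fps_X ^ d" for i
      by (simp add: mult.commute)
    then have "fps_shift d (fps_nth x i) = fps_nth (monom2 q p * x') i" for i
      by (simp add: fps_shift_times_fps_X_power)
    then have "dv x = fps_const \<nu> * (monom2 q p * x')" by (intro fps_ext) (simp add: dv_def)
    then show ?thesis by simp
  qed
  have dv_mult: "fps_const \<gamma> * dv x = x" if "monom2 0 d dvd x" for x
  proof (rule fps_ext)
    fix i
    have x: "fps_X ^ d dvd fps_nth x i" using that by (auto simp: monom2_dvd_iff fps_X_power_dvd_iff)
    have "\<gamma> * (\<nu> * fps_shift d (fps_nth x i)) = (fps_shift d \<gamma> * \<nu>) * (fps_X ^ d * fps_shift d (fps_nth x i))"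
      by (subst \<gamma>) (simp only: mult_ac)
    also have "\<dots> = fps_nth x i"
      using x unfolding \<nu> by (auto elim!: dvdE simp: fps_shift_times_fps_X_power mult.commute[of "fps_X ^ d"])
    finally show "fps_nth (fps_const \<gamma> * dv x) i = fps_nth x i" by (simp add: dv_def)
  qed
  have dv_diff: "dv x - dv x' = dv (x - x')" for x x'
    by (rule fps_ext) (simp add: dv_def fps_shift_diff right_diff_distrib)
  have E_diff: "monom2 (Suc q) (2 * d) dvd E Y r - E Y' r"
    if "\<And>j. monom2 1 d dvd Y j" "\<And>j. monom2 1 d dvd Y' j" "\<And>j. monom2 q d dvd Y j - Y' j" for Y Y' q r
  proof -
    have "monom2 (1 + q) (d + d) dvd at_curve (F r) y Y - at_curve (F r) y Y'
     - (\<Sum>j\<in>UNIV. fps_const (at_arc (mps_deriv (Some j) (F r)) y) * (Y j - Y' j))"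
      by (rule at_curve_taylor_dvd) (use that small y0 in auto)
    then show ?thesis
      unfolding mult_2 by (simp add: E_def J_def algebra_simps sum_subtractf)
  qed
  have E0: "E (\<lambda>_. 0) r = 0" for r by (simp add: E_def at_curve_zero)
  have E_dvd: "monom2 1 (2 * d) dvd E Y r" if "\<And>j. monom2 1 d dvd Y j" for Y r
    using E_diff[of Y "\<lambda>_. 0" 0 r] that by (simp add: E0 monom2_dvd_iff)
  \<comment> \<open>Here the factor \<open>t^(2d)\<close> of the prescribed image enters: after
    division by \<gamma> a factor \<open>t^d\<close> is left, as the domain of the iteration
    demands.\<close>
  have s_dvd: "monom2 1 (2 * d) dvd fps_const (fps_X ^ (2 * d)) * fps_X ^ e r" for r
    using e[of r] by (auto simp: monom2_dvd_iff fps_X_power_nth)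
  have R_dvd: "monom2 1 (2 * d) dvd (\<Sum>r\<in>UNIV. fps_const (b q r) * R Y r)"
    if "\<And>j. monom2 1 d dvd Y j" for Y q
    unfolding R_def using that by (intro dvd_sum dvd_mult dvd_diff s_dvd E_dvd)
  obtain Y where Y: "Y \<in> {Y. \<forall>j i. fps_nth (Y j) i \<in> C i}" "\<Psi> Y = Y"
  proof (rule fps_fixpoint[of "\<lambda>_. 0" C \<Psi>])
    show "(\<lambda>_. 0) \<in> {Y. \<forall>(j::'m) i. fps_nth (Y j) i \<in> C i}" by (simp add: X)
    show "\<Psi> Y \<in> {Y. \<forall>j i. fps_nth (Y j) i \<in> C i}" if "Y \<in> {Y. \<forall>j i. fps_nth (Y j) i \<in> C i}" for Y
    proof -
      have "monom2 1 d dvd \<Psi> Y q" for q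
        unfolding \<Psi>_def using R_dvd[of Y q] that X by (intro dv_dvd) (simp add: mult_2)
      then show ?thesis by (simp add: X)
    qed
    fix Y Y' n j i
    assume YY: "Y \<in> {Y. \<forall>j i. fps_nth (Y j) i \<in> C i}" "Y' \<in> {Y. \<forall>j i. fps_nth (Y j) i \<in> C i}"
      and eq: "\<And>(j::'m) i. i < n \<Longrightarrow> fps_nth (Y j) i = fps_nth (Y' j) i" and i: "i \<le> n"
    then have Yd: "monom2 1 d dvd Y j" "monom2 1 d dvd Y' j" for j by (auto simp only: X mem_Collect_eq)
    have "monom2 n d dvd Y j - Y' j" for j
      using Yd[of j] eq by (auto simp: monom2_dvd_iff)
    then have "monom2 (Suc n) (2 * d) dvd E Y r - E Y' r" for r by (intro E_diff Yd)
    then have "monom2 (Suc n) (2 * d) dvd - (E Y r - E Y' r)" for r by (simp only: dvd_minus_iff)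
    then have "monom2 (Suc n) (2 * d) dvd R Y r - R Y' r" for r by (simp add: R_def)
    then have "monom2 (Suc n) (d + d) dvd (\<Sum>r\<in>UNIV. fps_const (b j r) * (R Y r - R Y' r))"
      by (intro dvd_sum dvd_mult) (simp add: mult_2)
    then have "monom2 (Suc n) d dvd \<Psi> Y j - \<Psi> Y' j"
      unfolding \<Psi>_def dv_diff by (intro dv_dvd) (simp add: right_diff_distrib sum_subtractf)
    then have "fps_nth (\<Psi> Y j - \<Psi> Y' j) i = 0"
      using i by (intro fps_ext) (simp add: monom2_dvd_iff)
    then show "fps_nth (\<Psi> Y j) i = fps_nth (\<Psi> Y' j) i" by simp
  qed
  then have Yd: "monom2 1 d dvd Y j" for j using X by auto
  show ?thesis
  proof
    show "monom2 1 0 dvd Y j" for j by (intro small Yd)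
    fix p
    have "fps_const \<gamma> * (\<Sum>q\<in>UNIV. fps_const (J p q) * Y q)
        = (\<Sum>q\<in>UNIV. fps_const (J p q) * (fps_const \<gamma> * \<Psi> Y q))"
      by (simp add: sum_distrib_left Y(2) mult_ac)
    also have "\<dots> = (\<Sum>q\<in>UNIV. fps_const (J p q) * (\<Sum>r\<in>UNIV. fps_const (b q r) * R Y r))"
    proof (intro sum.cong refl arg_cong2[of _ _ _ _ "(*)"])
      fix q
      have "monom2 0 d dvd (\<Sum>r\<in>UNIV. fps_const (b q r) * R Y r)"
        using R_dvd[OF Yd, of q] by (simp add: monom2_dvd_iff)
      then show "fps_const \<gamma> * \<Psi> Y q = (\<Sum>r\<in>UNIV. fps_const (b q r) * R Y r)"
        unfolding \<Psi>_def by (rule dv_mult)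
    qed
    also have "\<dots> = (\<Sum>r\<in>UNIV. fps_const (\<Sum>q\<in>UNIV. J p q * b q r) * R Y r)"
      unfolding sum_distrib_left comm_ring_hom.hom_sum[OF hom_fps_const] sum_distrib_right
      by (subst sum.swap) (simp add: mult.assoc flip: fps_const_mult)
    also have "\<dots> = fps_const \<gamma> * R Y p"
      by (simp add: Jb if_distrib[of fps_const] if_distrib[of "\<lambda>x. x * _"] cong: if_cong)
    finally have "(\<Sum>q\<in>UNIV. fps_const (J p q) * Y q) = R Y p"
      using g0 by (simp add: \<gamma>_def)
    then show "at_curve (F p) y Y = fps_const (at_arc (F p) y) + fps_const (fps_X ^ (2 * d)) * fps_X ^ e p"
      by (simp add: R_def E_def algebra_simps)
  qed
qed

lemma mps_nth_mult_var_power: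
  "mps_nth (f * mps_var v ^ n) \<gamma> = (if n \<le> count \<gamma> v then mps_nth f (\<gamma> - replicate_mset n v) else 0)"
proof (induction n arbitrary: \<gamma>)
  case (Suc n)
  have "mps_nth (f * mps_var v ^ Suc n) \<gamma> = mps_nth ((f * mps_var v ^ n) * mps_var v) \<gamma>"
    by (simp add: mult_ac)
  also have "\<dots> = (if Suc n \<le> count \<gamma> v then mps_nth f (\<gamma> - replicate_mset (Suc n) v) else 0)"
    unfolding mps_nth_mult_var Suc.IH
    by (auto simp: not_in_iff Suc_le_eq count_greater_zero_iff diff_diff_add_mset dest: multi_member_split)
  finally show ?case .
qed simp

lemma series_Algebraic_alg_closure:
  fixes f :: "('v::finite, 'a::field) mps"
  assumes "f \<in> series Algebraic"
  shows "f \<in> alg_closure (range mps_const \<union> range mps_var)"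
proof -
  have "p \<in> ring_hull (range mps_const \<union> range mps_var)" if "mps_is_poly p" for p :: "('v, 'a) mps"
  proof -
    have "mps_eval mps_const p mps_var \<in> ring_hull (range mps_const \<union> range mps_var)"
      by (rule mps_eval_in_subring[OF subring_set_ring_hull]) (auto intro: subsetD[OF ring_hull_superset])
    then show ?thesis by (simp add: mps_eval_var_self[OF that])
  qed
  then show ?thesis
    using assms by (auto simp: alg_closure_def alg_over_def)
qed

text \<open>
  \<open>t, F\<^sub>1, \<dots>, F\<^sub>m\<close> are algebraically independent: there are arcs on which the \<open>F p\<close> take, up to constants
  and units, independent values \<open>s\<^sup>e\<^sup>p\<close>. By Steinitz the variables are algebraic over \<open>k(t, F)\<close>,
  and such a relation can be specialised to \<open>y\<close>.
\<close>

lemma algebraic_solution: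
  fixes F :: "'m::finite \<Rightarrow> ('m option, 'a::field) mps" and y :: "'a fps ^ 'm"
  assumes F: "\<And>p. F p \<in> series Algebraic"
    and y0: "zero_arc y" and Fy: "\<And>p. at_arc (F p) y \<in> alg_series"
    and g0: "at_arc g y \<noteq> 0"
    and B: "\<And>p r. (\<Sum>q\<in>UNIV. mps_deriv (Some q) (F p) * B q r) = (if p = r then g else 0)"
  shows "y $ j \<in> alg_series"
proof -
  define xs where "xs = case_option (mps_var None) F"
  define C where "C = range (mps_const :: 'a \<Rightarrow> ('m option, 'a) mps)"
  \<comment> \<open>The weights are adapted to \<open>p\<close>: on the curve,
    \<open>p(t, F)\<close> becomes \<open>p(t, F(y) + t^(2d) s^e)\<close>, to which
    \<open>mps_eval_curve_nonzero\<close> applies with \<open>l j = t^(2d)\<close>.\<close>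
  have curve: "\<exists>Y. (\<forall>j. monom2 1 0 dvd Y j) \<and> at_curve (mps_eval mps_const p xs) y Y \<noteq> 0 \<and>
      (\<forall>v. at_curve (xs v) y Y \<in> alg_series2)"
    if p: "mps_is_poly p" "p \<noteq> 0" for p
  proof -
    have fin: "finite ((\<lambda>\<alpha> j. count \<alpha> (Some j)) ` {\<alpha>. mps_nth p \<alpha> \<noteq> 0})"
      using p(1) by (simp add: mps_is_poly_def)
    obtain e :: "'m \<Rightarrow> nat" and M where e: "M > 0" "\<And>v. M \<le> e v" "\<And>v. e v < 2 * M" "inj e"
      "inj_on (\<lambda>c. \<Sum>v\<in>UNIV. c v * e v) ((\<lambda>\<alpha> j. count \<alpha> (Some j)) ` {\<alpha>. mps_nth p \<alpha> \<noteq> 0})"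
      by (rule separating_weights[OF fin], rule that)
    have e0: "e p > 0" for p using e(1) e(2)[of p] by simp
    define d where "d = subdegree (at_arc g y)"
    obtain Y where Y: "\<And>j. monom2 1 0 dvd Y j"
      "\<And>p. at_curve (F p) y Y = fps_const (at_arc (F p) y) + fps_const (fps_X ^ (2 * d)) * fps_X ^ e p"
      by (rule curve_with_given_image[OF y0 g0 d_def B e0], rule that)
    note hom = hom_at_curve[OF y0 Y(1)]
    have xs: "at_curve (xs v) y Y = case_option (fps_const fps_X)
        (\<lambda>j. fps_const (at_arc (F j) y) + fps_const (fps_X ^ (2 * d)) * fps_X ^ e j) v" for v
      by (cases v) (simp_all add: xs_def at_curve_var[OF y0 Y(1)] Y(2))
    have "at_curve (mps_eval mps_const p xs) y Y = mps_eval fps_const2 p (case_option (fps_const fps_X)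
        (\<lambda>j. fps_const (at_arc (F j) y) + fps_const (fps_X ^ (2 * d)) * fps_X ^ e j))"
      by (subst mps_eval_hom[OF hom]) (simp add: at_curve_const[OF y0 Y(1)] xs)
    also have "\<dots> \<noteq> 0" by (intro mps_eval_curve_nonzero p e0 e(5)) simp
    finally have "at_curve (mps_eval mps_const p xs) y Y \<noteq> 0" .
    moreover have "at_curve (xs v) y Y \<in> alg_series2" for v
      unfolding xs
      by (auto split: option.splits intro!: const_in_alg_series2 fps_X_in_alg_series Fy X_in_alg_series2
          subring_set_add[OF subring_alg_series2] subring_set_mult[OF subring_alg_series2]
          subring_set_power[OF subring_alg_series2] subring_set_power[OF subring_set_alg_series]
          simp del: fps_const_power)
    ultimately show ?thesis using Y(1) by blast
  qed
  have mps_eval_nz: "mps_eval mps_const p xs \<noteq> 0" if p: "mps_is_poly p" "p \<noteq> 0" for p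
  proof
    assume "mps_eval mps_const p xs = 0"
    moreover obtain Y where "\<And>j. monom2 1 0 dvd Y j" "at_curve (mps_eval mps_const p xs) y Y \<noteq> 0"
      using curve[OF p] by blast
    ultimately show False
      using comm_ring_hom.hom_zero[OF hom_at_curve[OF y0]] by metis
  qed
  interpret c: comm_ring_hom "mps_const :: 'a \<Rightarrow> ('m option, 'a) mps" by (rule hom_mps_const)
  \<comment> \<open>Keeping track of the variables in \<open>V\<close> makes it possible to say that
    a relation avoids a given variable.\<close>
  have hull: "\<exists>p. mps_is_poly p \<and> (\<forall>\<alpha>. mps_nth p \<alpha> \<noteq> 0 \<longrightarrow> set_mset \<alpha> \<subseteq> V) \<and> h = mps_eval mps_const p xs"
    if h: "h \<in> ring_hull (C \<union> xs ` V)" for h V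
  proof -
    define T where "T = {mps_eval mps_const p xs | p. mps_is_poly p \<and> (\<forall>\<alpha>. mps_nth p \<alpha> \<noteq> 0 \<longrightarrow> set_mset \<alpha> \<subseteq> V)}"
    have T: "mps_eval mps_const p xs \<in> T"
      if "mps_is_poly p" "\<And>\<alpha>. mps_nth p \<alpha> \<noteq> 0 \<Longrightarrow> set_mset \<alpha> \<subseteq> V" for p
      using that unfolding T_def by blast
    have const: "mps_const c \<in> T" for c
    proof -
      have "mps_eval mps_const (mps_const c) xs \<in> T"
        by (rule T) (auto simp: mps_nth_const split: if_splits)
      then show ?thesis by (simp add: c.mps_eval_const)
    qed
    have var: "xs v \<in> T" if "v \<in> V" for v
    proof -
      have "mps_eval mps_const (mps_var v) xs \<in> T"
        by (rule T) (use that in \<open>auto simp: mps_nth_var split: if_splits\<close>)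
      then show ?thesis by (simp add: c.mps_eval_var)
    qed
    have "subring_set T"
      unfolding subring_set_def
    proof (intro conjI ballI)
      show "1 \<in> T" using const[of 1] by simp
      fix a b assume "a \<in> T" "b \<in> T"
      then obtain p q where p: "mps_is_poly p" "\<And>\<alpha>. mps_nth p \<alpha> \<noteq> 0 \<Longrightarrow> set_mset \<alpha> \<subseteq> V" "a = mps_eval mps_const p xs"
        and q: "mps_is_poly q" "\<And>\<alpha>. mps_nth q \<alpha> \<noteq> 0 \<Longrightarrow> set_mset \<alpha> \<subseteq> V" "b = mps_eval mps_const q xs"
        unfolding T_def by blast
      have "a - b = mps_eval mps_const (p + mps_const (-1) * q) xs"
        unfolding c.mps_eval_add[OF p(1) mps_is_poly_mult[OF mps_is_poly_const q(1)]]
          c.mps_eval_mult[OF mps_is_poly_const q(1)] c.mps_eval_const by (simp add: p q c.hom_uminus)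
      also have "\<dots> \<in> T"
      proof (intro T mps_is_poly_add mps_is_poly_mult mps_is_poly_const p(1) q(1))
        fix \<alpha> assume "mps_nth (p + mps_const (- 1) * q) \<alpha> \<noteq> 0"
        then have "mps_nth p \<alpha> \<noteq> 0 \<or> mps_nth q \<alpha> \<noteq> 0" by auto
        then show "set_mset \<alpha> \<subseteq> V" using p(2) q(2) by blast
      qed
      finally show "a - b \<in> T" .
      have "a * b = mps_eval mps_const (p * q) xs" using p q by (simp add: c.mps_eval_mult)
      also have "\<dots> \<in> T"
      proof (intro T mps_is_poly_mult p(1) q(1))
        fix \<alpha> assume "mps_nth (p * q) \<alpha> \<noteq> 0"
        then show "set_mset \<alpha> \<subseteq> V" using mps_mult_support[of p q] p(2) q(2) by fastforce
      qed
      finally show "a * b \<in> T" .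
    qed
    moreover have "C \<union> xs ` V \<subseteq> T" using const var by (auto simp: C_def)
    ultimately have "h \<in> T" using h ring_hull_least by blast
    then show ?thesis unfolding T_def by blast
  qed
  have inj: "inj xs"
  proof (rule injI, rule ccontr)
    fix u v assume uv: "xs u = xs v" "u \<noteq> v"
    let ?p = "mps_var u + mps_const (-1) * mps_var v :: ('m option, 'a) mps"
    have "mps_nth ?p {#u#} = 1" using uv(2) by (simp add: mps_nth_var)
    then have "?p \<noteq> 0" by (metis mps_nth_zero zero_neq_one)
    moreover have "mps_is_poly ?p" by (intro mps_is_poly_add mps_is_poly_mult) simp_all
    moreover have "mps_eval mps_const ?p xs = 0"
      unfolding c.mps_eval_add[OF mps_is_poly_var mps_is_poly_mult[OF mps_is_poly_const mps_is_poly_var]]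
        c.mps_eval_mult[OF mps_is_poly_const mps_is_poly_var] c.mps_eval_const c.mps_eval_var
      using uv by (simp add: c.hom_uminus)
    ultimately show False using mps_eval_nz by blast
  qed
  \<comment> \<open>A relation for \<open>xs v\<close> over the other \<open>xs\<close> is assembled
    into one polynomial \<open>q\<close> in all variables with value 0, which contradicts
    \<open>mps_eval_nz\<close> once \<open>q\<close> is known to be nonzero.\<close>
  have indep: "xs v \<notin> alg_closure (C \<union> (range xs - {xs v}))" for v
  proof
    assume "xs v \<in> alg_closure (C \<union> (range xs - {xs v}))"
    moreover have "range xs - {xs v} = xs ` (- {v})" using inj by (auto simp: inj_def)
    ultimately obtain P where P: "P \<noteq> 0" "\<And>i. coeff P i \<in> ring_hull (C \<union> xs ` (- {v}))" "poly P (xs v) = 0"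
      by (auto simp: alg_closure_def alg_over_def)
    have "\<forall>i. \<exists>p. mps_is_poly p \<and> (\<forall>\<alpha>. mps_nth p \<alpha> \<noteq> 0 \<longrightarrow> set_mset \<alpha> \<subseteq> - {v}) \<and> coeff P i = mps_eval mps_const p xs"
      using hull P(2) by blast
    then obtain p where p: "\<And>i. mps_is_poly (p i)" "\<And>i \<alpha>. mps_nth (p i) \<alpha> \<noteq> 0 \<Longrightarrow> v \<notin># \<alpha>"
        "\<And>i. coeff P i = mps_eval mps_const (p i) xs" by (metis ComplD insertI1 subsetD)
    define n where "n = degree P"
    define q where "q = (\<Sum>i\<le>n. p i * mps_var v ^ i)"
    have pow: "mps_is_poly (mps_var v ^ i :: ('m option, 'a) mps)" "mps_eval mps_const (mps_var v ^ i) xs = xs v ^ i" for i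
      by (induction i) (simp_all add: mps_is_poly_mult c.mps_eval_1 c.mps_eval_mult c.mps_eval_var)
    have "mps_is_poly (\<Sum>i\<in>I. p i * mps_var v ^ i) \<and>
        mps_eval mps_const (\<Sum>i\<in>I. p i * mps_var v ^ i) xs = (\<Sum>i\<in>I. coeff P i * xs v ^ i)" if "finite I" for I
      using that
      by induction (simp_all add: c.mps_eval_0 c.mps_eval_add c.mps_eval_mult p pow mps_is_poly_add mps_is_poly_mult)
    then have q: "mps_is_poly q" "mps_eval mps_const q xs = 0"
      using P(3) by (simp_all add: q_def n_def poly_altdef)
    have "p n \<noteq> 0" using P(1) p(3)[of n] by (auto simp: n_def c.mps_eval_0)
    then obtain \<alpha> where \<alpha>: "mps_nth (p n) \<alpha> \<noteq> 0" using mps_eqI[of "p n" 0] by auto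
    then have v: "count \<alpha> v = 0" using p(2) by (simp add: count_eq_zero_iff)
    \<comment> \<open>The variable \<open>v\<close> occurs neither in \<alpha> nor in any
      \<open>p i\<close>, so its exponent \<open>n\<close> isolates the term
      \<open>i = n\<close>.\<close>
    have "mps_nth (p i * mps_var v ^ i) (\<alpha> + replicate_mset n v) = (if i = n then mps_nth (p n) \<alpha> else 0)"
      if "i \<le> n" for i
    proof (cases "i = n")
      case False
      have "v \<in># \<alpha> + replicate_mset n v - replicate_mset i v"
        using that False v by (simp add: in_diff_count)
      then show ?thesis using p(2)[of i] False by (auto simp: mps_nth_mult_var_power)
    qed (simp add: mps_nth_mult_var_power)
    then have "mps_nth q (\<alpha> + replicate_mset n v) = mps_nth (p n) \<alpha>"
      by (simp add: q_def mps_nth_sum)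
    then have "q \<noteq> 0" using \<alpha> by auto
    then show False using mps_eval_nz q by blast
  qed
  \<comment> \<open>Steinitz exchange with the variables as generators and the equally numerous
    \<open>xs\<close> as independent set.\<close>
  have "range mps_var \<subseteq> alg_closure (C \<union> range xs)"
  proof (rule alg_closure_steinitz)
    show "card (range (mps_var :: _ \<Rightarrow> ('m option, 'a) mps)) \<le> card (range xs)"
      unfolding card_image[OF inj] by (rule card_image_le) simp
    show "range xs \<subseteq> alg_closure (C \<union> range mps_var)"
    proof clarify
      fix v show "xs v \<in> alg_closure (C \<union> range mps_var)"
        using series_Algebraic_alg_closure[OF F] alg_closure_superset[of "C \<union> range mps_var"]
        by (cases v) (auto simp: xs_def C_def)
    qed
  qed (use indep in auto)
  then have "mps_var (Some j) \<in> alg_closure (C \<union> range xs)" by blast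
  then obtain P where P: "P \<noteq> 0" "\<And>i. coeff P i \<in> ring_hull (C \<union> range xs)" "poly P (mps_var (Some j)) = 0"
    by (auto simp: alg_closure_def alg_over_def)
  \<comment> \<open>The curve is chosen for the leading coefficient: if that one does not vanish,
    the whole relation specialises to a nonzero one over \<open>alg_series2\<close>.\<close>
  obtain p where p: "mps_is_poly p" "lead_coeff P = mps_eval mps_const p xs"
    using hull[OF P(2)] by metis
  have "p \<noteq> 0" using P(1) p(2) by (auto simp: c.mps_eval_0)
  then obtain Y where Y: "\<And>j. monom2 1 0 dvd Y j" "at_curve (lead_coeff P) y Y \<noteq> 0"
      "\<And>v. at_curve (xs v) y Y \<in> alg_series2"
    using curve[OF p(1)] p(2) by metis
  interpret \<phi>: comm_ring_hom "\<lambda>h. at_curve h y Y" by (rule hom_at_curve[OF y0 Y(1)])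
  have "ring_hull (C \<union> range xs) \<subseteq> {h. at_curve h y Y \<in> alg_series2}"
  proof (rule ring_hull_least)
    show "subring_set {h. at_curve h y Y \<in> alg_series2}"
      using subring_alg_series2 by (auto simp: subring_set_def \<phi>.hom_one \<phi>.hom_diff \<phi>.hom_mult)
    show "C \<union> range xs \<subseteq> {h. at_curve h y Y \<in> alg_series2}"
      using Y(3) by (auto simp: C_def at_curve_const[OF y0 Y(1)] fps_const2_def
          intro!: const_in_alg_series2 fps_const_in_alg_series)
  qed
  then have "alg_over alg_series2 (at_curve (mps_var (Some j)) y Y)"
    unfolding alg_over_def using P Y(2)
    by (intro exI[of _ "map_poly (\<lambda>h. at_curve h y Y) P"])
       (auto simp: coeff_map_poly \<phi>.hom_zero poly_eq_iff simp flip: \<phi>.hom_poly)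
  then have "fps_const (y $ j) + Y j \<in> alg_series2"
    using alg_series2_closed by (simp add: at_curve_var[OF y0 Y(1)])
  then have "fps_nth (fps_const (y $ j) + Y j) 0 \<in> alg_series" unfolding fps_coeffs_in_def by blast
  moreover have "fps_nth (Y j) 0 = 0"
    using Y(1)[of j] by (intro fps_ext) (simp add: monom2_dvd_iff)
  ultimately show ?thesis by simp
qed

section \<open>Convergent series\<close>

locale valued_field =
  fixes av :: "'a::field \<Rightarrow> real"
  assumes valuation: "is_valuation av"
begin

lemma av_nonneg [simp]: "0 \<le> av x"
  and av_zero_iff [simp]: "av x = 0 \<longleftrightarrow> x = 0"
  and av_mult: "av (x * y) = av x * av y"
  and av_add: "av (x + y) \<le> av x + av y"
  using valuation by (auto simp: is_valuation_def)

lemma av_zero [simp]: "av 0 = 0" by simp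

lemma av_pos: "x \<noteq> 0 \<Longrightarrow> 0 < av x"
  by (simp add: less_le)

lemma av_one [simp]: "av 1 = 1"
  using av_mult[of 1 1] av_zero_iff[of 1] by simp

lemma av_uminus [simp]: "av (- x) = av x"
proof -
  have "av (- 1) * av (- 1) = 1" using av_mult[of "- 1" "- 1"] by simp
  then have "av (- 1) = 1" using av_nonneg[of "- 1"] by (metis abs_of_nonneg real_sqrt_abs2 real_sqrt_one)
  then show ?thesis using av_mult[of "- 1" x] by simp
qed

lemma av_sum: "av (sum f A) \<le> (\<Sum>i\<in>A. av (f i))"
proof (induction A rule: infinite_finite_induct)
  case (insert x A)
  then show ?case using av_add[of "f x" "sum f A"] by simp
qed simp_all

lemma av_of_nat: "av (of_nat n) \<le> real n"
proof (induction n)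
  case (Suc n)
  then show ?case using av_add[of 1 "of_nat n"] by simp
qed simp

text \<open>A weighted norm of a truncation is finite for every formal series. Convergence becomes a
  bound uniform in \<open>N\<close>, and terms may be absorbed or estimated inductively before
  convergence is known.\<close>

definition trunc_norm :: "real \<Rightarrow> nat \<Rightarrow> 'a fps \<Rightarrow> real" where
  "trunc_norm r N h = (\<Sum>n\<le>N. av (fps_nth h n) * r ^ n)"

lemma trunc_norm_cong: "(\<And>n. n \<le> N \<Longrightarrow> fps_nth g n = fps_nth h n) \<Longrightarrow> trunc_norm r N g = trunc_norm r N h"
  by (simp add: trunc_norm_def)

lemma trunc_norm_zero [simp]: "trunc_norm r N 0 = 0"
  by (simp add: trunc_norm_def)

lemma trunc_norm_one [simp]: "trunc_norm r N 1 = 1"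
proof -
  have "trunc_norm r N 1 = (\<Sum>n\<in>{0}. av (fps_nth 1 n) * r ^ n)"
    unfolding trunc_norm_def by (rule sum.mono_neutral_right) auto
  then show ?thesis by simp
qed

context
  fixes r :: real
  assumes r: "0 \<le> r"
begin

lemma trunc_norm_nonneg [simp]: "0 \<le> trunc_norm r N h"
  using r by (simp add: trunc_norm_def sum_nonneg)

lemma trunc_norm_mono: "M \<le> N \<Longrightarrow> trunc_norm r M h \<le> trunc_norm r N h"
  unfolding trunc_norm_def using r by (intro sum_mono2) auto

lemma trunc_norm_add: "trunc_norm r N (g + h) \<le> trunc_norm r N g + trunc_norm r N h"
  unfolding trunc_norm_def sum.distrib[symmetric] distrib_right[symmetric]
  using r by (intro sum_mono mult_right_mono) (auto simp: av_add)

lemma trunc_norm_uminus [simp]: "trunc_norm r N (- h) = trunc_norm r N h"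
  by (simp add: trunc_norm_def)

lemma trunc_norm_diff: "trunc_norm r N (g - h) \<le> trunc_norm r N g + trunc_norm r N h"
  using trunc_norm_add[of N g "- h"] by simp

lemma trunc_norm_sum: "trunc_norm r N (sum f A) \<le> (\<Sum>i\<in>A. trunc_norm r N (f i))"
proof (induction A rule: infinite_finite_induct)
  case (insert x A)
  then show ?case using trunc_norm_add[of N "f x" "sum f A"] by simp
qed simp_all

lemma trunc_norm_const_mult: "trunc_norm r N (fps_const c * h) = av c * trunc_norm r N h"
  by (simp add: trunc_norm_def av_mult sum_distrib_left mult.assoc)

text \<open>The pairs with \<open>i + j \<le> N\<close> lie in the square of pairs with both indices
  at most \<open>N\<close>, and all terms are nonnegative.\<close>

lemma trunc_norm_mult: "trunc_norm r N (g * h) \<le> trunc_norm r N g * trunc_norm r N h"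
proof -
  let ?t = "\<lambda>i j. (av (fps_nth g i) * r ^ i) * (av (fps_nth h j) * r ^ j)"
  have "trunc_norm r N (g * h) \<le> (\<Sum>n\<le>N. \<Sum>i\<le>n. ?t i (n - i))"
    unfolding trunc_norm_def
  proof (rule sum_mono)
    fix n
    have "av (fps_nth (g * h) n) * r ^ n \<le> (\<Sum>i\<le>n. av (fps_nth g i * fps_nth h (n - i))) * r ^ n"
      unfolding fps_mult_nth atLeast0AtMost using r by (intro mult_right_mono av_sum) simp
    also have "\<dots> = (\<Sum>i\<le>n. ?t i (n - i))"
      unfolding sum_distrib_right
      by (intro sum.cong refl) (simp add: av_mult flip: power_add)
    finally show "av (fps_nth (g * h) n) * r ^ n \<le> (\<Sum>i\<le>n. ?t i (n - i))" .
  qed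
  also have "\<dots> = (\<Sum>(n, i)\<in>Sigma {..N} (\<lambda>n. {..n}). ?t i (n - i))"
    by (simp add: sum.Sigma)
  also have "\<dots> = (\<Sum>(i, j)\<in>(\<lambda>(n, i). (i, n - i)) ` Sigma {..N} (\<lambda>n. {..n}). ?t i j)"
    by (subst sum.reindex) (auto simp: inj_on_def case_prod_unfold)
  also have "\<dots> \<le> (\<Sum>(i, j)\<in>{..N} \<times> {..N}. ?t i j)"
    using r by (intro sum_mono2) auto
  also have "\<dots> = trunc_norm r N g * trunc_norm r N h"
    by (simp add: trunc_norm_def sum_product sum.cartesian_product)
  finally show ?thesis .
qed

lemma trunc_norm_mult_le: "trunc_norm r N g \<le> a \<Longrightarrow> trunc_norm r N h \<le> b \<Longrightarrow> trunc_norm r N (g * h) \<le> a * b"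
  using trunc_norm_mult[of N g h] trunc_norm_nonneg[of N g] trunc_norm_nonneg[of N h]
  by (meson mult_mono order_trans)

lemma trunc_norm_monom_le:
  assumes "\<And>v. trunc_norm r N (s v) \<le> R"
  shows "trunc_norm r N (prod_mset (image_mset s \<alpha>)) \<le> R ^ size \<alpha>"
  by (induction \<alpha>) (auto intro!: trunc_norm_mult_le assms)

text \<open>The constant comes from the recursion: adding one variable gives \<rho> times the old
  bound plus \<eta> times a monomial in \<open>z + a\<close>, and these two summands are equal,
  which doubles \<rho>.\<close>

lemma trunc_norm_monom_diff_le:
  assumes z: "\<And>v. trunc_norm r N (z v) \<le> \<rho>" and a: "\<And>v. trunc_norm r N (a v) \<le> \<eta>" and "\<eta> \<le> \<rho>" "\<rho> > 0"
  shows "trunc_norm r N (prod_mset (image_mset (\<lambda>v. z v + a v) \<alpha>) - prod_mset (image_mset z \<alpha>))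
    \<le> (2 * \<rho>) ^ size \<alpha> * (\<eta> / \<rho>)"
proof (induction \<alpha>)
  case empty
  have "0 \<le> \<eta>" using a trunc_norm_nonneg order_trans by blast
  then show ?case using assms by simp
next
  case (add x \<alpha>)
  let ?m = "\<lambda>y \<alpha>. prod_mset (image_mset y \<alpha>)"
  have za: "trunc_norm r N (z v + a v) \<le> 2 * \<rho>" for v
    using trunc_norm_add[of N "z v" "a v"] z[of v] a[of v] assms by linarith
  have "?m (\<lambda>v. z v + a v) (add_mset x \<alpha>) - ?m z (add_mset x \<alpha>)
      = z x * (?m (\<lambda>v. z v + a v) \<alpha> - ?m z \<alpha>) + a x * ?m (\<lambda>v. z v + a v) \<alpha>"
    by (simp add: algebra_simps)
  then have "trunc_norm r N (?m (\<lambda>v. z v + a v) (add_mset x \<alpha>) - ?m z (add_mset x \<alpha>))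
      \<le> trunc_norm r N (z x * (?m (\<lambda>v. z v + a v) \<alpha> - ?m z \<alpha>)) + trunc_norm r N (a x * ?m (\<lambda>v. z v + a v) \<alpha>)"
    by (simp add: trunc_norm_add)
  also have "\<dots> \<le> \<rho> * ((2 * \<rho>) ^ size \<alpha> * (\<eta> / \<rho>)) + \<eta> * (2 * \<rho>) ^ size \<alpha>"
    by (intro add_mono trunc_norm_mult_le z a add trunc_norm_monom_le za)
  also have "\<dots> = (2 * \<rho>) ^ size (add_mset x \<alpha>) * (\<eta> / \<rho>)"
    using assms by (simp add: field_simps)
  finally show ?case .
qed

text \<open>The same recursion one order higher. The multiplicities \<open>count \<alpha> v\<close>
  are absorbed in \<open>2 ^ size \<alpha>\<close>, so that the bound can be summed against a
  majorant of radius \<open>2 * \<rho>\<close>.\<close>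

lemma trunc_norm_monom_taylor_le:
  fixes z a :: "'v::finite \<Rightarrow> 'a fps"
  assumes z: "\<And>v. trunc_norm r N (z v) \<le> \<rho>" and a: "\<And>v. trunc_norm r N (a v) \<le> \<eta>" and "\<eta> \<le> \<rho>" "\<rho> > 0"
  shows "trunc_norm r N (prod_mset (image_mset (\<lambda>v. z v + a v) \<alpha>) - prod_mset (image_mset z \<alpha>)
      - (\<Sum>v\<in>UNIV. of_nat (count \<alpha> v) * prod_mset (image_mset z (\<alpha> - {#v#})) * a v))
    \<le> (2 * \<rho>) ^ size \<alpha> * (\<eta> / \<rho>) ^ 2"
proof (induction \<alpha>)
  case (add x \<alpha>)
  let ?m = "\<lambda>y \<alpha>. prod_mset (image_mset y \<alpha>)"
  let ?D = "\<lambda>\<alpha>. \<Sum>v\<in>UNIV. of_nat (count \<alpha> v) * ?m z (\<alpha> - {#v#}) * a v"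
  have "of_nat (count (add_mset x \<alpha>) v) * ?m z (add_mset x \<alpha> - {#v#}) * a v
      = z x * (of_nat (count \<alpha> v) * ?m z (\<alpha> - {#v#}) * a v) + (if v = x then ?m z \<alpha> * a v else 0)" for v
  proof (cases "v \<in># \<alpha>")
    case True
    then obtain \<beta> where "\<alpha> = add_mset v \<beta>" by (auto dest: multi_member_split)
    then show ?thesis by (auto simp: algebra_simps)
  qed (auto simp: not_in_iff)
  then have D: "?D (add_mset x \<alpha>) = z x * ?D \<alpha> + ?m z \<alpha> * a x"
    by (simp add: sum.distrib sum_distrib_left)
  have "?m (\<lambda>v. z v + a v) (add_mset x \<alpha>) - ?m z (add_mset x \<alpha>) - ?D (add_mset x \<alpha>)
     = z x * (?m (\<lambda>v. z v + a v) \<alpha> - ?m z \<alpha> - ?D \<alpha>) + a x * (?m (\<lambda>v. z v + a v) \<alpha> - ?m z \<alpha>)"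
    unfolding D by (simp add: algebra_simps)
  then have "trunc_norm r N (?m (\<lambda>v. z v + a v) (add_mset x \<alpha>) - ?m z (add_mset x \<alpha>) - ?D (add_mset x \<alpha>))
     \<le> trunc_norm r N (z x * (?m (\<lambda>v. z v + a v) \<alpha> - ?m z \<alpha> - ?D \<alpha>))
       + trunc_norm r N (a x * (?m (\<lambda>v. z v + a v) \<alpha> - ?m z \<alpha>))"
    by (simp only: trunc_norm_add)
  also have "\<dots> \<le> \<rho> * ((2 * \<rho>) ^ size \<alpha> * (\<eta> / \<rho>)\<^sup>2) + \<eta> * ((2 * \<rho>) ^ size \<alpha> * (\<eta> / \<rho>))"
    by (intro add_mono trunc_norm_mult_le z a add trunc_norm_monom_diff_le assms)
  also have "\<dots> = (2 * \<rho>) ^ size (add_mset x \<alpha>) * (\<eta> / \<rho>)\<^sup>2"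
    using assms by (simp add: field_simps power2_eq_square)
  finally show ?case .
qed simp

end

section \<open>Convergent series in one variable\<close>

abbreviation "conv \<equiv> series1 (Convergent av)"

lemma conv_if_bounded:
  assumes "r > 0" "\<And>N. trunc_norm r N h \<le> B" shows "h \<in> conv"
proof -
  have "summable (\<lambda>n. av (fps_nth h n) * r ^ n)"
  proof (rule summableI_nonneg_bounded)
    fix n
    have "(\<Sum>i<n. av (fps_nth h i) * r ^ i) \<le> trunc_norm r n h"
      unfolding trunc_norm_def using assms(1) by (intro sum_mono2) auto
    then show "(\<Sum>i<n. av (fps_nth h i) * r ^ i) \<le> B" using assms(2)[of n] by linarith
  qed (use assms in auto)
  then show ?thesis using assms(1) by auto
qed

text \<open>Passing from radius \<open>R\<close> to \<open>r\<close> multiplies the terms of index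
  at least \<open>e\<close> by at most \<open>(r / R) ^ e\<close>. The bound is stated for all small
  \<open>r\<close>, so that finitely many estimates can be used at a common radius.\<close>

lemma conv_eventually_bounded:
  assumes "h \<in> conv" "fps_X ^ e dvd h"
  shows "\<exists>C\<ge>0. \<forall>\<^sub>F r in at_right 0. \<forall>N. trunc_norm r N h \<le> C * r ^ e"
proof -
  obtain R where R: "R > 0" "summable (\<lambda>n. av (fps_nth h n) * R ^ n)" using assms(1) by auto
  define B where "B = (\<Sum>n. av (fps_nth h n) * R ^ n)"
  have B: "trunc_norm R N h \<le> B" for N
    unfolding trunc_norm_def B_def lessThan_Suc_atMost[symmetric] using R by (intro sum_le_suminf) auto
  have B0: "B \<ge> 0" using B[of 0] trunc_norm_nonneg[of R 0 h] R by linarith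
  have le: "trunc_norm r N h \<le> B / R ^ e * r ^ e" if r: "0 < r" "r < R" for r N
  proof -
    have "trunc_norm r N h \<le> (\<Sum>n\<le>N. (r / R) ^ e * (av (fps_nth h n) * R ^ n))"
      unfolding trunc_norm_def
    proof (rule sum_mono)
      fix n
      show "av (fps_nth h n) * r ^ n \<le> (r / R) ^ e * (av (fps_nth h n) * R ^ n)"
      proof (cases "n < e")
        case True
        then show ?thesis using assms(2) by (simp add: fps_X_power_dvd_iff)
      next
        case False
        have "r ^ n = (r / R) ^ n * R ^ n" using R by (simp add: power_divide)
        also have "\<dots> \<le> (r / R) ^ e * R ^ n"
          using r R False by (intro mult_right_mono power_decreasing) auto
        finally have "av (fps_nth h n) * r ^ n \<le> av (fps_nth h n) * ((r / R) ^ e * R ^ n)"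
          by (rule mult_left_mono) simp
        then show ?thesis by (simp only: mult_ac)
      qed
    qed
    also have "\<dots> = (r / R) ^ e * trunc_norm R N h" by (simp add: trunc_norm_def sum_distrib_left)
    also have "\<dots> \<le> (r / R) ^ e * B" using r R B by (intro mult_left_mono) auto
    finally show ?thesis by (simp add: power_divide mult.commute)
  qed
  have "\<forall>\<^sub>F r in at_right 0. 0 < r \<and> r < R"
    using R(1) by (simp add: eventually_at_right_less eventually_conj eventually_at_right_field) (metis)
  then have "\<forall>\<^sub>F r in at_right 0. \<forall>N. trunc_norm r N h \<le> B / R ^ e * r ^ e"
    by eventually_elim (use le in auto)
  moreover have "B / R ^ e \<ge> 0" using B0 R by simp
  ultimately show ?thesis by blast
qed

lemma conv_family_bounded:
  fixes h :: "'i::finite \<Rightarrow> 'a fps"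
  assumes "\<And>i. h i \<in> conv" "\<And>i. fps_X ^ e dvd h i"
  shows "\<exists>C\<ge>0. \<forall>\<^sub>F r in at_right 0. \<forall>i N. trunc_norm r N (h i) \<le> C * r ^ e"
proof -
  have "\<forall>i. \<exists>C. C \<ge> 0 \<and> (\<forall>\<^sub>F r in at_right 0. \<forall>N. trunc_norm r N (h i) \<le> C * r ^ e)"
    using conv_eventually_bounded[OF assms] by blast
  from choice[OF this] obtain C where
    C: "\<And>i. C i \<ge> 0" "\<And>i. \<forall>\<^sub>F r in at_right 0. \<forall>N. trunc_norm r N (h i) \<le> C i * r ^ e"
    by blast
  define D where "D = (\<Sum>i\<in>UNIV. C i)"
  have D: "C i \<le> D" for i unfolding D_def using C(1) by (intro member_le_sum) auto
  have "\<forall>\<^sub>F r in at_right 0. \<forall>i. \<forall>N. trunc_norm r N (h i) \<le> C i * r ^ e"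
    using C(2) by (intro eventually_all_finite) auto
  moreover have "\<forall>\<^sub>F r in at_right 0. r > (0::real)" by (simp add: eventually_at_right_less)
  ultimately have "\<forall>\<^sub>F r in at_right 0. \<forall>i N. trunc_norm r N (h i) \<le> D * r ^ e"
  proof eventually_elim
    case (elim r)
    show ?case
    proof (intro allI)
      fix i N
      have "trunc_norm r N (h i) \<le> C i * r ^ e" using elim by blast
      also have "\<dots> \<le> D * r ^ e" using D elim by (intro mult_right_mono) auto
      finally show "trunc_norm r N (h i) \<le> D * r ^ e" .
    qed
  qed
  moreover have "D \<ge> 0" unfolding D_def using C(1) by (intro sum_nonneg) auto
  ultimately show ?thesis by blast
qed

lemma conv_if_eventually_bounded:
  assumes "\<forall>\<^sub>F r in at_right 0. \<exists>B. \<forall>N. trunc_norm r N h \<le> B" shows "h \<in> conv"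
proof -
  have "\<forall>\<^sub>F r in at_right 0. r > (0::real)" by (simp add: eventually_at_right_less)
  with assms have "\<forall>\<^sub>F r in at_right 0. r > (0::real) \<and> (\<exists>B. \<forall>N. trunc_norm r N h \<le> B)"
    by eventually_elim auto
  from eventually_happens'[OF trivial_limit_at_right_real this]
  obtain r B where "r > 0" "\<And>N. trunc_norm r N h \<le> B" by auto
  then show ?thesis by (rule conv_if_bounded)
qed

lemma conv_finite_support:
  assumes "\<And>n. n > d \<Longrightarrow> fps_nth h n = 0" shows "h \<in> conv"
proof (rule conv_if_bounded[of 1])
  fix N
  have "trunc_norm 1 N h \<le> trunc_norm 1 (max N d) h" by (intro trunc_norm_mono) auto
  also have "\<dots> = trunc_norm 1 d h"
    unfolding trunc_norm_def using assms by (intro sum.mono_neutral_right) auto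
  finally show "trunc_norm 1 N h \<le> trunc_norm 1 d h" .
qed simp

lemma conv_fps_of_poly: "fps_of_poly p \<in> conv"
  by (rule conv_finite_support[of "degree p"]) (simp add: coeff_eq_0)

lemma subring_set_conv: "subring_set conv"
  unfolding subring_set_def
proof (intro conjI ballI)
  show "1 \<in> conv" using conv_fps_of_poly[of 1] by simp
  fix x y assume xy: "x \<in> conv" "y \<in> conv"
  obtain C where C: "\<forall>\<^sub>F r in at_right 0. \<forall>N. trunc_norm r N x \<le> C * r ^ 0"
    using conv_eventually_bounded[OF xy(1), of 0] by auto
  obtain D where D: "\<forall>\<^sub>F r in at_right 0. \<forall>N. trunc_norm r N y \<le> D * r ^ 0"
    using conv_eventually_bounded[OF xy(2), of 0] by auto
  have pos: "\<forall>\<^sub>F r in at_right 0. r > (0::real)" by (simp add: eventually_at_right_less)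
  show "x - y \<in> conv"
  proof (rule conv_if_eventually_bounded, use C D pos in eventually_elim)
    case (elim r)
    have "trunc_norm r N (x - y) \<le> C + D" for N
      using trunc_norm_diff[of r N x y] elim(1)[rule_format, of N] elim(2)[rule_format, of N] elim(3) by simp
    then show ?case by blast
  qed
  show "x * y \<in> conv"
  proof (rule conv_if_eventually_bounded, use C D pos in eventually_elim)
    case (elim r)
    have "trunc_norm r N (x * y) \<le> C * D" for N
      using elim by (intro trunc_norm_mult_le) auto
    then show ?case by blast
  qed
qed

lemma conv_shift:
  assumes "h \<in> conv" "fps_X ^ d dvd h" shows "fps_shift d h \<in> conv"
proof -
  obtain R where R: "R > 0" "summable (\<lambda>n. av (fps_nth h n) * R ^ n)" using assms(1) by auto
  have "summable (\<lambda>n. av (fps_nth h (n + d)) * R ^ (n + d))"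
    using R(2) by (rule summable_ignore_initial_segment)
  then have "summable (\<lambda>n. inverse (R ^ d) * (av (fps_nth h (n + d)) * R ^ (n + d)))"
    by (rule summable_mult)
  moreover have "inverse (R ^ d) * (av (fps_nth h (n + d)) * R ^ (n + d)) = av (fps_nth h (n + d)) * R ^ n" for n
    using R(1) by (simp add: power_add)
  ultimately show ?thesis using R(1) by auto
qed

lemma trunc_norm_shift_le:
  assumes "r > 0" shows "trunc_norm r N (fps_shift d h) \<le> trunc_norm r (N + d) h / r ^ d"
proof -
  have "trunc_norm r N (fps_shift d h) = (\<Sum>n\<le>N. av (fps_nth h (n + d)) * r ^ (n + d)) / r ^ d"
    unfolding trunc_norm_def sum_divide_distrib using assms by (intro sum.cong) (auto simp: power_add)
  also have "(\<Sum>n\<le>N. av (fps_nth h (n + d)) * r ^ (n + d)) = (\<Sum>n\<in>(\<lambda>n. n + d) ` {..N}. av (fps_nth h n) * r ^ n)"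
    by (subst sum.reindex) auto
  also have "\<dots> \<le> trunc_norm r (N + d) h"
    unfolding trunc_norm_def using assms by (intro sum_mono2) auto
  finally show ?thesis using assms by (simp add: divide_right_mono)
qed

text \<open>With \<open>u = u0 + w\<close> one has \<open>u0 x = u x - w x\<close>, and for small
  radius the norm of \<open>w\<close> is below half of that of \<open>u0\<close>. The term
  \<open>w x\<close> is absorbed into the left-hand side, which is legitimate because truncated
  norms are finite.\<close>

lemma conv_unit_division:
  assumes u: "u \<in> conv" "fps_nth u 0 \<noteq> 0" and h: "u * x \<in> conv"
  shows "x \<in> conv"
proof -
  define u0 where "u0 = fps_nth u 0"
  define w where "w = u - fps_const u0"
  have u0: "av u0 > 0" using u by (simp add: u0_def av_pos)
  have "w \<in> conv"
    unfolding w_def using conv_fps_of_poly[of "[:u0:]"] u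
    by (intro subring_set_diff[OF subring_set_conv]) (auto simp: fps_of_poly_const simp del: series1.simps)
  moreover have "fps_X ^ 1 dvd w" unfolding fps_X_power_dvd_iff by (simp add: w_def u0_def)
  ultimately obtain C where C: "C \<ge> 0" "\<forall>\<^sub>F r in at_right 0. \<forall>N. trunc_norm r N w \<le> C * r ^ 1"
    using conv_eventually_bounded by blast
  obtain D where D: "\<forall>\<^sub>F r in at_right 0. \<forall>N. trunc_norm r N (u * x) \<le> D * r ^ 0"
    using conv_eventually_bounded[OF h, of 0] by auto
  have small: "\<forall>\<^sub>F r in at_right 0. C * r < av u0 / 2"
    using u0 by (intro order_tendstoD(2)[of _ 0] tendsto_eq_intros | simp)+
  have pos: "\<forall>\<^sub>F r in at_right 0. r > (0::real)" by (simp add: eventually_at_right_less)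
  show ?thesis
  proof (rule conv_if_eventually_bounded, use C(2) D small pos in eventually_elim)
    case (elim r)
    have "trunc_norm r N x \<le> 2 * D / av u0" for N
    proof -
      have "fps_const u0 * x = u * x - w * x" by (simp add: w_def algebra_simps)
      then have "av u0 * trunc_norm r N x \<le> trunc_norm r N (u * x) + trunc_norm r N (w * x)"
        using trunc_norm_diff[of r N "u * x" "w * x"] trunc_norm_const_mult[of r N u0 x] elim by simp
      also have "trunc_norm r N (w * x) \<le> (av u0 / 2) * trunc_norm r N x"
      proof (rule trunc_norm_mult_le)
        show "trunc_norm r N w \<le> av u0 / 2" using elim(1)[rule_format, of N] elim(3) by simp
      qed (use elim in auto)
      finally have "av u0 * trunc_norm r N x \<le> D + (av u0 / 2) * trunc_norm r N x"
        using elim(2)[rule_format, of N] by simp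
      then show ?thesis using u0 by (simp add: field_simps)
    qed
    then show ?case by blast
  qed
qed

lemma conv_division:
  assumes g: "g \<in> conv" "g \<noteq> 0" and h: "g * x \<in> conv"
  shows "x \<in> conv"
proof -
  define d where "d = subdegree g"
  have gd: "g = fps_X ^ d * fps_shift d g"
    using fps_shift_times_fps_X_power[of d g] by (simp add: d_def mult.commute)
  then have dvd: "fps_X ^ d dvd g" by (metis dvd_triv_left)
  have "fps_shift d (g * x) = fps_shift d g * x"
    unfolding d_def by (subst fps_shift_mult_right) auto
  moreover have "fps_shift d (g * x) \<in> conv"
    by (rule conv_shift[OF h]) (simp add: dvd)
  ultimately show ?thesis
    using conv_unit_division[OF conv_shift[OF g(1) dvd]] g(2) by (simp add: d_def)
qed


section \<open>Convergent series in several variables and their values on arcs\<close>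

lemma series_conv_iff:
  fixes f :: "('v::finite, 'a) mps"
  shows "f \<in> series (Convergent av) \<longleftrightarrow>
    (\<exists>R>0. \<exists>B. \<forall>F. finite F \<longrightarrow> (\<Sum>\<alpha>\<in>F. av (mps_nth f \<alpha>) * R ^ size \<alpha>) \<le> B)"
proof
  assume "f \<in> series (Convergent av)"
  then obtain R where R: "R > 0" "(\<lambda>\<alpha>. av (mps_nth f \<alpha>) * R ^ size \<alpha>) summable_on UNIV" by auto
  have "(\<Sum>\<alpha>\<in>F. av (mps_nth f \<alpha>) * R ^ size \<alpha>) \<le> (\<Sum>\<^sub>\<infinity>\<alpha>. av (mps_nth f \<alpha>) * R ^ size \<alpha>)" if "finite F" for F
    using R that by (intro finite_sum_le_infsum) auto
  then show "\<exists>R>0. \<exists>B. \<forall>F. finite F \<longrightarrow> (\<Sum>\<alpha>\<in>F. av (mps_nth f \<alpha>) * R ^ size \<alpha>) \<le> B"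
    using R(1) by blast
next
  assume "\<exists>R>0. \<exists>B. \<forall>F. finite F \<longrightarrow> (\<Sum>\<alpha>\<in>F. av (mps_nth f \<alpha>) * R ^ size \<alpha>) \<le> B"
  then obtain R B where R: "R > 0" "\<And>F. finite F \<Longrightarrow> (\<Sum>\<alpha>\<in>F. av (mps_nth f \<alpha>) * R ^ size \<alpha>) \<le> B"
    by blast
  have "(\<lambda>\<alpha>. av (mps_nth f \<alpha>) * R ^ size \<alpha>) summable_on UNIV"
    by (rule nonneg_bdd_above_summable_on) (use R in \<open>auto simp: bdd_above_def\<close>)
  then show "f \<in> series (Convergent av)" using R(1) by auto
qed

text \<open>The factor \<open>Suc (count \<alpha> x)\<close> is at most
  \<open>2 ^ size \<alpha>\<close>, which halving the radius compensates.\<close>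

lemma mps_deriv_conv:
  fixes f :: "('v::finite, 'a) mps"
  assumes "f \<in> series (Convergent av)" shows "mps_deriv x f \<in> series (Convergent av)"
proof -
  obtain R B where R: "R > 0" "\<And>F. finite F \<Longrightarrow> (\<Sum>\<alpha>\<in>F. av (mps_nth f \<alpha>) * R ^ size \<alpha>) \<le> B"
    using assms unfolding series_conv_iff by blast
  have "(\<Sum>\<alpha>\<in>F. av (mps_nth (mps_deriv x f) \<alpha>) * (R / 2) ^ size \<alpha>) \<le> B / R" if F: "finite F" for F
  proof -
    have "(\<Sum>\<alpha>\<in>F. av (mps_nth (mps_deriv x f) \<alpha>) * (R / 2) ^ size \<alpha>)
       \<le> (\<Sum>\<alpha>\<in>F. av (mps_nth f (add_mset x \<alpha>)) * R ^ size (add_mset x \<alpha>) / R)"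
    proof (rule sum_mono)
      fix \<alpha>
      have "av (mps_nth (mps_deriv x f) \<alpha>) \<le> real (Suc (count \<alpha> x)) * av (mps_nth f (add_mset x \<alpha>))"
        unfolding mps_nth_deriv av_mult by (intro mult_right_mono av_of_nat) simp
      also have "\<dots> \<le> 2 ^ size \<alpha> * av (mps_nth f (add_mset x \<alpha>))"
      proof (intro mult_right_mono)
        have "Suc (count \<alpha> x) \<le> Suc (size \<alpha>)" by (simp add: count_le_size)
        also have "\<dots> \<le> 2 ^ size \<alpha>" by (simp add: Suc_le_eq)
        finally show "real (Suc (count \<alpha> x)) \<le> 2 ^ size \<alpha>" by (metis of_nat_le_iff of_nat_numeral of_nat_power)
      qed simp
      finally have "av (mps_nth (mps_deriv x f) \<alpha>) * (R / 2) ^ size \<alpha>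
          \<le> 2 ^ size \<alpha> * av (mps_nth f (add_mset x \<alpha>)) * (R / 2) ^ size \<alpha>"
        using R(1) by (intro mult_right_mono) auto
      also have "\<dots> = av (mps_nth f (add_mset x \<alpha>)) * R ^ size (add_mset x \<alpha>) / R"
        using R(1) by (simp add: power_divide)
      finally show "av (mps_nth (mps_deriv x f) \<alpha>) * (R / 2) ^ size \<alpha>
          \<le> av (mps_nth f (add_mset x \<alpha>)) * R ^ size (add_mset x \<alpha>) / R" .
    qed
    also have "\<dots> = (\<Sum>\<alpha>\<in>add_mset x ` F. av (mps_nth f \<alpha>) * R ^ size \<alpha>) / R"
      by (subst sum.reindex) (auto simp: inj_on_def sum_divide_distrib)
    also have "\<dots> \<le> B / R" using R F by (intro divide_right_mono) auto
    finally show ?thesis .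
  qed
  then show ?thesis unfolding series_conv_iff using R(1)
    by (intro exI[of _ "R / 2"] conjI exI[of _ "B / R"]) auto
qed

lemma is_poly_conv:
  fixes p :: "('v::finite, 'a) mps"
  assumes p: "mps_is_poly p" shows "p \<in> series (Convergent av)"
proof -
  have "(\<Sum>\<alpha>\<in>F. av (mps_nth p \<alpha>) * 1 ^ size \<alpha>) \<le> (\<Sum>\<alpha> | mps_nth p \<alpha> \<noteq> 0. av (mps_nth p \<alpha>))" if "finite F" for F
  proof -
    have "(\<Sum>\<alpha>\<in>F. av (mps_nth p \<alpha>) * 1 ^ size \<alpha>) = (\<Sum>\<alpha>\<in>F \<inter> {\<alpha>. mps_nth p \<alpha> \<noteq> 0}. av (mps_nth p \<alpha>))"
      using that by (intro sum.mono_neutral_cong_right) auto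
    also have "\<dots> \<le> (\<Sum>\<alpha> | mps_nth p \<alpha> \<noteq> 0. av (mps_nth p \<alpha>))"
      using p by (intro sum_mono2) (auto simp: mps_is_poly_def)
    finally show ?thesis .
  qed
  then show ?thesis unfolding series_conv_iff by (intro exI[of _ 1]) auto
qed

text \<open>The bound does not depend on the truncation degree \<open>M\<close>. The family \<Delta>
  stands for monomials in \<open>conv_at_arc\<close> and for their Taylor errors in
  \<open>conv_taylor_bound\<close>.\<close>

lemma trunc_norm_mps_eval_weighted_le:
  fixes f :: "('v::finite, 'a) mps"
  assumes r: "r \<ge> 0" and B: "\<And>F. finite F \<Longrightarrow> (\<Sum>\<alpha>\<in>F. av (mps_nth f \<alpha>) * R ^ size \<alpha>) \<le> B"
    and "\<And>\<alpha>. trunc_norm r N (\<Delta> \<alpha>) \<le> c * R ^ size \<alpha>" and "c \<ge> 0"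
  shows "trunc_norm r N (\<Sum>\<alpha> | mps_nth (mps_trunc M f) \<alpha> \<noteq> 0. fps_const (mps_nth (mps_trunc M f) \<alpha>) * \<Delta> \<alpha>) \<le> c * B"
proof -
  let ?F = "{\<alpha>. mps_nth (mps_trunc M f) \<alpha> \<noteq> 0}"
  have fin: "finite ?F" using mps_is_poly_trunc[of M f] by (simp add: mps_is_poly_def)
  have "trunc_norm r N (\<Sum>\<alpha>\<in>?F. fps_const (mps_nth (mps_trunc M f) \<alpha>) * \<Delta> \<alpha>)
     \<le> (\<Sum>\<alpha>\<in>?F. trunc_norm r N (fps_const (mps_nth (mps_trunc M f) \<alpha>) * \<Delta> \<alpha>))"
    by (rule trunc_norm_sum[OF r])
  also have "\<dots> \<le> (\<Sum>\<alpha>\<in>?F. c * (av (mps_nth f \<alpha>) * R ^ size \<alpha>))"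
  proof (rule sum_mono)
    fix \<alpha>
    assume "\<alpha> \<in> ?F"
    then have "trunc_norm r N (fps_const (mps_nth (mps_trunc M f) \<alpha>) * \<Delta> \<alpha>) = av (mps_nth f \<alpha>) * trunc_norm r N (\<Delta> \<alpha>)"
      by (auto simp: trunc_norm_const_mult[OF r] mps_nth_trunc split: if_splits)
    also have "\<dots> \<le> av (mps_nth f \<alpha>) * (c * R ^ size \<alpha>)" using assms(3) by (intro mult_left_mono) auto
    finally show "trunc_norm r N (fps_const (mps_nth (mps_trunc M f) \<alpha>) * \<Delta> \<alpha>) \<le> c * (av (mps_nth f \<alpha>) * R ^ size \<alpha>)"
      by (simp add: mult_ac)
  qed
  also have "\<dots> \<le> c * B"
    unfolding sum_distrib_left[symmetric] using B[OF fin] \<open>c \<ge> 0\<close> by (intro mult_left_mono)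
  finally show ?thesis .
qed

lemma arc_eventually_small:
  fixes y :: "'a fps ^ 'm::finite"
  assumes "zero_arc y" "\<And>j. y $ j \<in> conv" "\<rho> > 0"
  shows "\<forall>\<^sub>F r in at_right 0. \<forall>v N. trunc_norm r N (case_option fps_X (\<lambda>j. y $ j) v) \<le> \<rho>"
proof -
  have "case_option fps_X (\<lambda>j. y $ j) v \<in> conv" for v
    using assms conv_fps_of_poly[of "[:0, 1:]"] by (auto split: option.splits simp del: series1.simps)
  moreover have "fps_X ^ 1 dvd case_option fps_X (\<lambda>j. y $ j) v" for v
    using zero_arc_subst[OF assms(1), of v] unfolding fps_X_power_dvd_iff by simp
  ultimately obtain C where C: "C \<ge> 0" "\<forall>\<^sub>F r in at_right 0. \<forall>v N. trunc_norm r N (case_option fps_X (\<lambda>j. y $ j) v) \<le> C * r ^ 1"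
    using conv_family_bounded by blast
  have small: "\<forall>\<^sub>F r in at_right 0. C * r < \<rho>"
    using assms by (intro order_tendstoD(2)[of _ 0] tendsto_eq_intros | simp)+
  show ?thesis using C(2) small
  proof eventually_elim
    case (elim r)
    then show ?case unfolding power_one_right by (meson less_imp_le order_trans)
  qed
qed

lemma conv_at_arc:
  fixes f :: "('m::finite option, 'a) mps" and y :: "'a fps ^ 'm"
  assumes f: "f \<in> series (Convergent av)" and y: "zero_arc y" "\<And>j. y $ j \<in> conv"
  shows "at_arc f y \<in> conv"
proof -
  obtain R B where R: "R > 0" "\<And>F. finite F \<Longrightarrow> (\<Sum>\<alpha>\<in>F. av (mps_nth f \<alpha>) * R ^ size \<alpha>) \<le> B"
    using f unfolding series_conv_iff by blast
  have pos: "\<forall>\<^sub>F r in at_right 0. r > (0::real)" by (simp add: eventually_at_right_less)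
  show ?thesis
  proof (rule conv_if_eventually_bounded, use arc_eventually_small[OF y R(1)] pos in eventually_elim)
    case (elim r)
    have "trunc_norm r N (at_arc f y) \<le> 1 * B" for N
    proof -
      have "trunc_norm r N (at_arc f y) = trunc_norm r N (mps_eval fps_const (mps_trunc N f) (case_option fps_X (\<lambda>j. y $ j)))"
        unfolding at_arc_def by (intro trunc_norm_cong mps_subst_trunc zero_arc_subst y)
      also have "\<dots> \<le> 1 * B"
        unfolding mps_eval_def
      proof (rule trunc_norm_mps_eval_weighted_le[OF _ R(2)])
        show "trunc_norm r N (prod_mset (image_mset (case_option fps_X (\<lambda>j. y $ j)) \<alpha>)) \<le> 1 * R ^ size \<alpha>" for \<alpha>
          unfolding mult_1 using elim by (intro trunc_norm_monom_le) auto
      qed (use elim in auto)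
      finally show ?thesis .
    qed
    then show ?case by blast
  qed
qed

text \<open>The increment enters through its truncated norm only, and neither \<open>C\<close> nor
  the admissible radii depend on \<open>N\<close> or \<open>a\<close>. This uniformity is essential
  in \<open>conv_solution\<close>, where \<open>a\<close> runs through all cutoffs of a series whose
  convergence is still to be shown.\<close>

lemma conv_taylor_bound:
  fixes f :: "('m::finite option, 'a) mps" and y :: "'a fps ^ 'm"
  assumes f: "f \<in> series (Convergent av)" and y: "zero_arc y" "\<And>j. y $ j \<in> conv"
  shows "\<exists>C\<ge>0. \<exists>\<eta>\<^sub>0>0. \<forall>\<^sub>F r in at_right 0. \<forall>N a \<eta>. zero_arc a \<longrightarrow> \<eta> \<le> \<eta>\<^sub>0 \<longrightarrow> (\<forall>j. trunc_norm r N (a $ j) \<le> \<eta>) \<longrightarrow>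
      trunc_norm r N (at_arc f (y + a) - at_arc f y - (\<Sum>j\<in>UNIV. at_arc (mps_deriv (Some j) f) y * a $ j)) \<le> C * \<eta>\<^sup>2"
proof -
  interpret fc: comm_ring_hom "fps_const :: 'a \<Rightarrow> 'a fps" by (rule hom_fps_const)
  obtain R B where R: "R > 0" "\<And>F. finite F \<Longrightarrow> (\<Sum>\<alpha>\<in>F. av (mps_nth f \<alpha>) * R ^ size \<alpha>) \<le> B"
    using f unfolding series_conv_iff by blast
  \<comment> \<open>Arc and increment are each kept below half the radius, so that their sum stays
    within \<open>R\<close>.\<close>
  define \<rho> where "\<rho> = R / 2"
  have \<rho>: "\<rho> > 0" "2 * \<rho> = R" using R by (simp_all add: \<rho>_def)
  have B0: "B \<ge> 0" using R(2)[of "{}"] by simp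
  have pos: "\<forall>\<^sub>F r in at_right 0. r > (0::real)" by (simp add: eventually_at_right_less)
  have "\<forall>\<^sub>F r in at_right 0. \<forall>N a \<eta>. zero_arc a \<longrightarrow> \<eta> \<le> \<rho> \<longrightarrow> (\<forall>j. trunc_norm r N (a $ j) \<le> \<eta>) \<longrightarrow>
      trunc_norm r N (at_arc f (y + a) - at_arc f y - (\<Sum>j\<in>UNIV. at_arc (mps_deriv (Some j) f) y * a $ j)) \<le> B / \<rho>\<^sup>2 * \<eta>\<^sup>2"
    using arc_eventually_small[OF y \<rho>(1)] pos
  proof eventually_elim
    case (elim r)
    show ?case
    proof (intro allI impI)
      fix N \<eta> and a :: "'a fps ^ 'm"
      assume a: "zero_arc a" "\<eta> \<le> \<rho>" "\<forall>j. trunc_norm r N (a $ j) \<le> \<eta>"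
      let ?z = "case_option fps_X (\<lambda>j. y $ j)" and ?a = "case_option 0 (\<lambda>j. a $ j)"
      let ?f = "mps_trunc (Suc N) f"
      let ?L = "at_arc f (y + a) - at_arc f y - (\<Sum>j\<in>UNIV. at_arc (mps_deriv (Some j) f) y * a $ j)"
      let ?P = "mps_eval fps_const ?f (\<lambda>v. ?z v + ?a v) - mps_eval fps_const ?f (\<lambda>v. ?z v + 0)
         - (\<Sum>v\<in>UNIV. mps_eval fps_const (mps_deriv v ?f) ?z * (?a v - 0))"
      \<comment> \<open>Any component would do: its norm forces \<eta> to be nonnegative.\<close>
      have "trunc_norm r N (a $ undefined) \<ge> 0" using elim by (intro trunc_norm_nonneg) auto
      then have \<eta>0: "\<eta> \<ge> 0" using a(3) order_trans by blast
      have na: "trunc_norm r N (?a v) \<le> \<eta>" for v using a(3) \<eta>0 by (auto split: option.splits)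
      have ya: "(\<lambda>v. ?z v + ?a v) = case_option fps_X (\<lambda>j. (y + a) $ j)" by (auto split: option.splits)
      have zya: "zero_arc (y + a)" using y(1) a(1) by (simp add: zero_arc_def)
      have "trunc_norm r N ?L = trunc_norm r N ?P"
      proof (rule trunc_norm_cong)
        fix n assume n: "n \<le> N"
        have 1: "fps_nth (at_arc f (y + a)) n = fps_nth (mps_eval fps_const ?f (\<lambda>v. ?z v + ?a v)) n"
          unfolding ya at_arc_def using n by (intro mps_subst_trunc zero_arc_subst zya) auto
        have 2: "fps_nth (at_arc f y) n = fps_nth (mps_eval fps_const ?f (\<lambda>v. ?z v + 0)) n"
          unfolding add_0_right at_arc_def using n by (intro mps_subst_trunc zero_arc_subst y) auto
        have 3: "fps_nth (at_arc (mps_deriv (Some j) f) y * a $ j) n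
            = fps_nth (mps_eval fps_const (mps_deriv (Some j) ?f) ?z * a $ j) n" for j
          unfolding fps_mult_nth mps_deriv_trunc at_arc_def using n
          by (intro sum.cong refl arg_cong2[of _ _ _ _ "(*)"] mps_subst_trunc zero_arc_subst y) auto
        show "fps_nth ?L n = fps_nth ?P n"
          using 1 2 3 by (simp add: sum_option_UNIV fps_sum_nth)
      qed
      also have "\<dots> \<le> (\<eta> / \<rho>)\<^sup>2 * B"
        unfolding fc.mps_eval_taylor_sum[OF mps_is_poly_trunc]
      proof (rule trunc_norm_mps_eval_weighted_le[OF _ R(2)])
        show "trunc_norm r N (prod_mset (image_mset (\<lambda>v. ?z v + ?a v) \<alpha>) - prod_mset (image_mset (\<lambda>v. ?z v + 0) \<alpha>) -
          (\<Sum>v\<in>UNIV. of_nat (count \<alpha> v) * prod_mset (image_mset ?z (\<alpha> - {#v#})) * (?a v - 0)))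
          \<le> (\<eta> / \<rho>)\<^sup>2 * R ^ size \<alpha>" for \<alpha>
        proof -
          have "trunc_norm r N (prod_mset (image_mset (\<lambda>v. ?z v + ?a v) \<alpha>) - prod_mset (image_mset ?z \<alpha>) -
            (\<Sum>v\<in>UNIV. of_nat (count \<alpha> v) * prod_mset (image_mset ?z (\<alpha> - {#v#})) * ?a v))
            \<le> R ^ size \<alpha> * (\<eta> / \<rho>)\<^sup>2"
            unfolding \<rho>(2)[symmetric] using elim na a \<rho>(1) by (intro trunc_norm_monom_taylor_le) auto
          then show ?thesis by (simp only: add_0_right diff_0_right mult.commute[of "R ^ _"])
        qed
      qed (use elim in auto)
      finally show "trunc_norm r N ?L \<le> B / \<rho>\<^sup>2 * \<eta>\<^sup>2" by (simp add: power_divide mult.commute)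
    qed
  qed
  moreover have "B / \<rho>\<^sup>2 \<ge> 0" using B0 by simp
  ultimately show ?thesis using \<rho>(1) by blast
qed

text \<open>
  Induction on the truncation order \<open>N\<close>: the coefficients of \<open>v - w\<close> up to \<open>N + 1\<close> depend only on those
  of \<open>w\<close> up to \<open>N\<close>, quadratically; the loss \<open>r\<^sup>-\<^sup>d\<close> in the division by \<open>g\<close> is made up for by
  \<open>|v| = O(r\<^sup>d\<^sup>+\<^sup>1)\<close>.
\<close>

lemma conv_solution:
  fixes F :: "'m::finite \<Rightarrow> ('m option, 'a) mps" and z v w :: "'a fps ^ 'm"
  assumes F: "\<And>p. F p \<in> series (Convergent av)"
    and z: "zero_arc z" "\<And>j. z $ j \<in> conv"
    and v: "\<And>j. v $ j \<in> conv" "\<And>j. fps_X ^ Suc d dvd v $ j"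
    and w: "\<And>j. fps_X ^ Suc d dvd w $ j"
    and \<gamma>: "\<gamma> \<in> conv" "\<gamma> \<noteq> 0" "subdegree \<gamma> = d"
    and b: "\<And>q r. b q r \<in> conv"
    and eq: "\<And>q. \<gamma> * (v $ q - w $ q) = (\<Sum>r\<in>UNIV. b q r * (at_arc (F r) (z + w) - at_arc (F r) z
        - (\<Sum>j\<in>UNIV. at_arc (mps_deriv (Some j) (F r)) z * w $ j)))"
  shows "w $ j \<in> conv"
proof -
  define E where "E a r = at_arc (F r) (z + a) - at_arc (F r) z
        - (\<Sum>j\<in>UNIV. at_arc (mps_deriv (Some j) (F r)) z * a $ j)" for a :: "'a fps ^ 'm" and r
  have w0: "zero_arc w" using w unfolding zero_arc_def fps_X_power_dvd_iff by blast
  \<comment> \<open>As \<open>E\<close> is quadratic on multiples of \<open>t^(d+1)\<close>, the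
    coefficients of \<open>w\<close> up to degree \<open>N\<close> determine those of
    \<open>E w\<close> up to degree \<open>N + d + 1\<close>.\<close>
  have E_cong: "fps_nth (E w r) n = fps_nth (E a r) n"
    if a: "\<And>j. fps_X ^ Suc d dvd a $ j" and wa: "\<And>j. fps_X ^ Suc N dvd w $ j - a $ j" and n: "n < Suc d + Suc N"
    for a :: "'a fps ^ 'm" and r n N
  proof -
    have a0: "zero_arc a" using a unfolding zero_arc_def fps_X_power_dvd_iff by blast
    have "fps_X ^ (Suc d + Suc N) dvd at_arc (F r) (z + w) - at_arc (F r) (z + a)
       - (\<Sum>j\<in>UNIV. at_arc (mps_deriv (Some j) (F r)) z * (w $ j - a $ j))"
      by (intro at_arc_taylor_dvd z w0 a0 w a wa)
    also have "\<dots> = E w r - E a r"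
      by (simp add: E_def right_diff_distrib sum_subtractf)
    finally show ?thesis using n unfolding fps_X_power_dvd_iff by simp
  qed
  define \<nu> where "\<nu> = inverse (fps_shift d \<gamma>)"
  have g: "\<gamma> = fps_X ^ d * fps_shift d \<gamma>"
    using fps_shift_times_fps_X_power[of d \<gamma>] \<gamma>(3) by (simp add: mult.commute)
  have sh: "fps_shift d \<gamma> * \<nu> = 1"
    unfolding \<nu>_def by (rule inverse_mult_eq_1') (use \<gamma> in auto)
  have "fps_X ^ d dvd \<gamma>" by (subst g) simp
  then have sc: "fps_shift d \<gamma> \<in> conv" by (rule conv_shift[OF \<gamma>(1)])
  have \<nu>: "\<nu> \<in> conv"
  proof (rule conv_unit_division[OF sc])
    show "fps_nth (fps_shift d \<gamma>) 0 \<noteq> 0" using \<gamma> by auto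
    show "fps_shift d \<gamma> * \<nu> \<in> conv" unfolding sh by (rule subring_set_1[OF subring_set_conv])
  qed
  have T: "v $ q - w $ q = \<nu> * fps_shift d (\<Sum>r\<in>UNIV. b q r * E w r)" for q
  proof -
    have "fps_shift d (\<gamma> * (v $ q - w $ q)) = fps_shift d \<gamma> * (v $ q - w $ q)"
      using \<gamma>(3) fps_shift_mult_right[of d \<gamma> "v $ q - w $ q"] by simp
    then have "\<nu> * fps_shift d (\<Sum>r\<in>UNIV. b q r * E w r) = (fps_shift d \<gamma> * \<nu>) * (v $ q - w $ q)"
      unfolding eq E_def by (simp add: mult_ac)
    then show ?thesis unfolding sh by simp
  qed
  obtain V where V: "V \<ge> 0" "\<forall>\<^sub>F r in at_right 0. \<forall>j N. trunc_norm r N (v $ j) \<le> V * r ^ Suc d"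
    using conv_family_bounded[of "\<lambda>j. v $ j" "Suc d"] v by blast
  obtain M where M: "M \<ge> 0" "\<forall>\<^sub>F r in at_right 0. \<forall>N. trunc_norm r N \<nu> \<le> M * r ^ 0"
    using conv_eventually_bounded[OF \<nu>, of 0] by auto
  obtain L where L: "L \<ge> 0" "\<forall>\<^sub>F r in at_right 0. \<forall>qr N. trunc_norm r N (b (fst qr) (snd qr)) \<le> L * r ^ 0"
    using conv_family_bounded[of "\<lambda>qr. b (fst qr) (snd qr)" 0] b by auto
  define bound where "bound p C \<eta> \<longleftrightarrow> C \<ge> 0 \<and> \<eta> > 0 \<and> (\<forall>\<^sub>F r in at_right 0. \<forall>N a \<eta>'. zero_arc a \<longrightarrow>
      \<eta>' \<le> \<eta> \<longrightarrow> (\<forall>j. trunc_norm r N (a $ j) \<le> \<eta>') \<longrightarrow> trunc_norm r N (E a p) \<le> C * \<eta>'\<^sup>2)" for p C \<eta>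
  have "\<exists>C \<eta>. bound p C \<eta>" for p
    using conv_taylor_bound[OF F[of p] z] unfolding bound_def E_def by blast
  then have "\<forall>p. \<exists>C. \<exists>\<eta>. bound p C \<eta>" by blast
  from choice[OF this] obtain C\<^sub>0 where "\<forall>p. \<exists>\<eta>. bound p (C\<^sub>0 p) \<eta>" by blast
  from choice[OF this] obtain \<eta> where bound: "\<And>p. bound p (C\<^sub>0 p) (\<eta> p)" by blast
  have C: "\<And>p. C\<^sub>0 p \<ge> 0" "\<And>p. \<eta> p > 0"
    "\<And>p. \<forall>\<^sub>F r in at_right 0. \<forall>N a \<eta>'. zero_arc a \<longrightarrow> \<eta>' \<le> \<eta> p \<longrightarrow>
      (\<forall>j. trunc_norm r N (a $ j) \<le> \<eta>') \<longrightarrow> trunc_norm r N (E a p) \<le> C\<^sub>0 p * \<eta>'\<^sup>2"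
    using bound unfolding bound_def by blast+
  define C where "C = (\<Sum>p\<in>UNIV. C\<^sub>0 p)"
  define \<eta>\<^sub>0 where "\<eta>\<^sub>0 = Min (range \<eta>)"
  have \<eta>0: "\<eta>\<^sub>0 > 0" "\<And>p. \<eta>\<^sub>0 \<le> \<eta> p" using C(2) by (auto simp: \<eta>\<^sub>0_def)
  have C0: "C \<ge> 0" using C(1) by (auto simp: C_def intro: sum_nonneg)
  have evE: "\<forall>\<^sub>F r in at_right 0. \<forall>p. \<forall>N a \<eta>'. zero_arc a \<longrightarrow> \<eta>' \<le> \<eta> p \<longrightarrow>
      (\<forall>j. trunc_norm r N (a $ j) \<le> \<eta>') \<longrightarrow> trunc_norm r N (E a p) \<le> C\<^sub>0 p * \<eta>'\<^sup>2"
    using C(3) by (rule eventually_all_finite)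
  have pos: "\<forall>\<^sub>F r in at_right 0. r > (0::real)" by (simp add: eventually_at_right_less)
  have small1: "\<forall>\<^sub>F r in at_right 0. 2 * (V * r ^ Suc d) < \<eta>\<^sub>0"
    using \<eta>0 by (intro order_tendstoD(2)[of _ 0] tendsto_eq_intros | simp)+
  \<comment> \<open>With \<beta> = \<open>V * r ^ Suc d\<close> the error bound
    \<open>M * (L * C * (2 * \<beta>)\<^sup>2 / r ^ d)\<close> equals this quantity times \<beta>;
    below 1 it closes the induction.\<close>
  have small2: "\<forall>\<^sub>F r in at_right 0. 4 * (M * L * C) * V * r < 1"
    by (intro order_tendstoD(2)[of _ 0] tendsto_eq_intros | simp)+
  show ?thesis
  proof (rule conv_if_eventually_bounded, use V(2) M(2) L(2) evE pos small1 small2 in eventually_elim)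
    case (elim r)
    define \<beta> where "\<beta> = V * r ^ Suc d"
    have \<beta>0: "\<beta> \<ge> 0" using V elim by (simp add: \<beta>_def)
    \<comment> \<open>The bound is made of one \<beta> for \<open>v\<close> and one for
      \<open>v - w\<close>.\<close>
    have "\<forall>j. trunc_norm r N (w $ j) \<le> 2 * \<beta>" for N
    proof (induction N)
      case 0
      show ?case using w0 \<beta>0 by (simp add: trunc_norm_def zero_arc_def)
    next
      case (Suc N)
      define a :: "'a fps ^ 'm" where "a = (\<chi> j. fps_cutoff (Suc N) (w $ j))"
      have a: "fps_X ^ Suc d dvd a $ j" "fps_X ^ Suc N dvd w $ j - a $ j" for j
        using w[of j] by (auto simp: a_def fps_X_power_dvd_iff simp del: power_Suc)
      have a0: "zero_arc a" using a(1) unfolding zero_arc_def fps_X_power_dvd_iff by blast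
      \<comment> \<open>The division by \<gamma> shifts by \<open>d\<close>, so \<open>d\<close>
        further coefficients of the error are needed; this is the range covered by
        \<open>E_cong\<close>.\<close>
      let ?K = "Suc N + d"
      have na: "trunc_norm r ?K (a $ j) \<le> 2 * \<beta>" for j
      proof -
        have "trunc_norm r ?K (a $ j) = (\<Sum>n\<le>N. av (fps_nth (a $ j) n) * r ^ n)"
          unfolding trunc_norm_def by (rule sum.mono_neutral_right) (auto simp: a_def)
        also have "\<dots> = trunc_norm r N (w $ j)" unfolding trunc_norm_def by (intro sum.cong) (auto simp: a_def)
        finally show ?thesis using Suc.IH by simp
      qed
      have nE: "trunc_norm r ?K (E w p) \<le> C\<^sub>0 p * (2 * \<beta>)\<^sup>2" for p
      proof -
        have "trunc_norm r ?K (E w p) = trunc_norm r ?K (E a p)"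
          by (intro trunc_norm_cong E_cong[OF a]) auto
        also have "\<dots> \<le> C\<^sub>0 p * (2 * \<beta>)\<^sup>2"
          using elim(4)[rule_format, of a "2 * \<beta>" p ?K] a0 na elim(6) \<eta>0(2)[of p] by (simp add: \<beta>_def)
        finally show ?thesis .
      qed
      have nT: "trunc_norm r (Suc N) (v $ q - w $ q) \<le> \<beta>" for q
      proof -
        have "trunc_norm r ?K (\<Sum>p\<in>UNIV. b q p * E w p) \<le> (\<Sum>p\<in>UNIV. L * (C\<^sub>0 p * (2 * \<beta>)\<^sup>2))"
        proof (rule order_trans[OF trunc_norm_sum sum_mono])
          show "trunc_norm r ?K (b q p * E w p) \<le> L * (C\<^sub>0 p * (2 * \<beta>)\<^sup>2)" for p
            using elim(3)[rule_format, of _ "(q, p)"] elim(5) nE by (intro trunc_norm_mult_le) auto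
        qed (use elim in auto)
        also have "\<dots> = L * C * (2 * \<beta>)\<^sup>2"
          by (simp add: C_def sum_distrib_left sum_distrib_right mult.assoc)
        finally have 1: "trunc_norm r (Suc N) (fps_shift d (\<Sum>p\<in>UNIV. b q p * E w p)) \<le> L * C * (2 * \<beta>)\<^sup>2 / r ^ d"
          using order_trans[OF trunc_norm_shift_le[OF elim(5)] divide_right_mono] elim(5) by simp
        have "trunc_norm r (Suc N) (v $ q - w $ q) \<le> M * (L * C * (2 * \<beta>)\<^sup>2 / r ^ d)"
          unfolding T using elim(2,5) 1 by (intro trunc_norm_mult_le) auto
        also have "\<dots> = (4 * (M * L * C) * V * r) * \<beta>"
          using elim(5) by (simp add: \<beta>_def power2_eq_square)
        also have "\<dots> \<le> 1 * \<beta>" using elim(7) \<beta>0 by (intro mult_right_mono) auto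
        finally show ?thesis by simp
      qed
      show ?case
      proof
        fix j
        have "trunc_norm r (Suc N) (v $ j - (v $ j - w $ j)) \<le> trunc_norm r (Suc N) (v $ j) + trunc_norm r (Suc N) (v $ j - w $ j)"
          using elim by (intro trunc_norm_diff) auto
        also have "\<dots> \<le> \<beta> + \<beta>" using elim(1) nT by (intro add_mono) (auto simp: \<beta>_def)
        finally show "trunc_norm r (Suc N) (w $ j) \<le> 2 * \<beta>" by simp
      qed
    qed
    then show ?case by blast
  qed
qed

end

section \<open>Common properties of the three qualities\<close>

lemma is_poly_in_series:
  fixes p :: "('v::finite, 'a::field) mps"
  assumes val: "\<forall>av. Q = Convergent av \<longrightarrow> is_valuation av" and p: "mps_is_poly p"
  shows "p \<in> series Q"
proof (cases Q)
  case (Convergent av)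
  then interpret valued_field av using val by unfold_locales blast
  show ?thesis using is_poly_conv[OF p] Convergent by simp
next
  case Algebraic
  have "mps_is_poly (coeff [:- p, 1:] i)" for i
    using p by (auto simp: coeff_pCons mps_is_poly_uminus split: nat.splits)
  then show ?thesis using Algebraic by (auto intro!: exI[of _ "[:- p, 1:]"])
qed simp

lemma subring_set_UNIV: "subring_set UNIV"
  by (simp add: subring_set_def)

lemma subring_set_series1:
  assumes val: "\<forall>av. Q = Convergent av \<longrightarrow> is_valuation av"
  shows "subring_set (series1 Q)"
proof (cases Q)
  case (Convergent av)
  then interpret valued_field av using val by unfold_locales blast
  show ?thesis using subring_set_conv Convergent by simp
qed (simp_all add: subring_set_UNIV series1_Algebraic subring_set_alg_series del: series1.simps(3))

lemma fps_of_poly_in_series1: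
  assumes val: "\<forall>av. Q = Convergent av \<longrightarrow> is_valuation av"
  shows "fps_of_poly p \<in> series1 Q"
proof (cases Q)
  case (Convergent av)
  then interpret valued_field av using val by unfold_locales blast
  show ?thesis using conv_fps_of_poly Convergent by simp
qed (simp_all add: series1_Algebraic fps_of_poly_in_alg_series del: series1.simps(3))

text \<open>In the algebraic case the quotient is a root of the linear polynomial with coefficients
  \<open>- (g * x)\<close> and \<open>g\<close>.\<close>

lemma series1_division:
  assumes val: "\<forall>av. Q = Convergent av \<longrightarrow> is_valuation av"
    and g: "g \<in> series1 Q" "g \<noteq> 0" and gx: "g * x \<in> series1 Q"
  shows "x \<in> series1 Q"
proof (cases Q)
  case (Convergent av)
  then interpret valued_field av using val by unfold_locales blast
  show ?thesis using conv_division[of g x] g gx Convergent by simp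
next
  case Algebraic
  have "alg_over alg_series x"
    unfolding alg_over_def
    using g gx Algebraic subring_set_0[OF subring_set_alg_series] subring_set_uminus[OF subring_set_alg_series]
    by (intro exI[of _ "[:- (g * x), g:]"])
       (auto simp: coeff_pCons series1_Algebraic simp del: series1.simps(3) split: nat.splits)
  then show ?thesis using Algebraic alg_series_closed by (simp add: series1_Algebraic del: series1.simps(3))
qed simp

lemma at_arc_in_series1:
  fixes f :: "('m::finite option, 'a::field) mps" and y :: "'a fps ^ 'm"
  assumes val: "\<forall>av. Q = Convergent av \<longrightarrow> is_valuation av"
    and f: "f \<in> series Q" and y: "zero_arc y" "\<And>j. y $ j \<in> series1 Q"
  shows "at_arc f y \<in> series1 Q" "at_arc (mps_deriv (Some j) f) y \<in> series1 Q"
proof -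
  have "at_arc f y \<in> series1 Q \<and> at_arc (mps_deriv (Some j) f) y \<in> series1 Q"
  proof (cases Q)
    case (Convergent av)
    then interpret valued_field av using val by unfold_locales blast
    show ?thesis
      using conv_at_arc[of _ y] mps_deriv_conv[of f "Some j"] f y unfolding Convergent by blast
  next
    case Algebraic
    then show ?thesis
      using algebraic_at_arc(1)[of f y] algebraic_at_arc(2)[of f y j] f y by (simp add: series1_Algebraic del: series1.simps(3))
  qed simp
  then show "at_arc f y \<in> series1 Q" "at_arc (mps_deriv (Some j) f) y \<in> series1 Q" by auto
qed

section \<open>Newton's method along arcs\<close>

no_notation fps_nth (infixl "$" 75)

text \<open>\<open>B\<close> is a right inverse of the Jacobian matrix up to the factor
  \<open>g\<close>; as an identity of power series it can be evaluated on every arc.\<close>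

locale newton_system =
  fixes F :: "'m::finite \<Rightarrow> ('m option, 'a::field) mps" and B :: "'m \<Rightarrow> 'm \<Rightarrow> ('m option, 'a) mps"
    and g :: "('m option, 'a) mps"
  assumes jacobian_B: "(\<Sum>q\<in>UNIV. mps_deriv (Some q) (F p) * B q r) = (if p = r then g else 0)"
begin

definition taylor_error :: "'a fps ^ 'm \<Rightarrow> 'a fps ^ 'm \<Rightarrow> 'm \<Rightarrow> 'a fps" where
  "taylor_error z w p = at_arc (F p) (z + w) - at_arc (F p) z
     - (\<Sum>q\<in>UNIV. at_arc (mps_deriv (Some q) (F p)) z * w $ q)"

text \<open>The term B(z) E(z, w) / g(z). The factor \<open>t^d\<close> of g(z) is removed by a
  shift, exact for \<open>w\<close> in \<open>t^(d+1)\<close>, and the remaining unit is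
  inverted.\<close>

definition correction :: "nat \<Rightarrow> 'a fps ^ 'm \<Rightarrow> 'a fps ^ 'm \<Rightarrow> 'm \<Rightarrow> 'a fps" where
  "correction d z w q = fps_shift d (\<Sum>r\<in>UNIV. at_arc (B q r) z * taylor_error z w r)
     * inverse (fps_shift d (at_arc g z))"

definition newton_iterate :: "nat \<Rightarrow> 'a fps ^ 'm \<Rightarrow> 'a fps ^ 'm \<Rightarrow> nat \<Rightarrow> 'm \<Rightarrow> 'a fps" where
  "newton_iterate d z v n = ((\<lambda>W q. v $ q - correction d z (\<chi> j. W j) q) ^^ n) (\<lambda>_. 0)"

text \<open>Under the hypotheses of \<open>newton_solution_exists\<close> the coefficient of
  \<open>t^i\<close> is stationary from iterate \<open>Suc i\<close> on. Taking it from there yields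
  an explicit expression, whose regularity in \<open>z\<close> and \<open>v\<close> can be checked
  iterate by iterate.\<close>

definition newton_solution :: "nat \<Rightarrow> 'a fps ^ 'm \<Rightarrow> 'a fps ^ 'm \<Rightarrow> 'a fps ^ 'm" where
  "newton_solution d z v = (\<chi> j. Abs_fps (\<lambda>i. fps_nth (newton_iterate d z v (Suc i) j) i))"

lemma zero_arc_dvd: "(\<And>j. fps_X ^ Suc d dvd w $ j) \<Longrightarrow> zero_arc (w :: 'a fps ^ 'm)"
  unfolding zero_arc_def fps_X_power_dvd_iff by blast

context
  fixes d :: nat and z :: "'a fps ^ 'm"
  assumes z: "zero_arc z" and ord: "has_ord (at_arc g z) d"
begin

lemma unit_part: "at_arc g z = fps_X ^ d * fps_shift d (at_arc g z)"
  using fps_shift_times_fps_X_power[of d "at_arc g z"] ord by (simp add: has_ord_def mult.commute)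

lemma inverse_unit_part: "fps_shift d (at_arc g z) * inverse (fps_shift d (at_arc g z)) = 1"
  by (rule inverse_mult_eq_1') (use ord in \<open>auto simp: has_ord_def\<close>)

lemma taylor_error_diff_dvd:
  assumes "\<And>j. fps_X ^ Suc d dvd w $ j" "\<And>j. fps_X ^ Suc d dvd w' $ j" "\<And>j. fps_X ^ n dvd w $ j - w' $ j"
  shows "fps_X ^ (Suc d + n) dvd taylor_error z w p - taylor_error z w' p"
proof -
  have "fps_X ^ (Suc d + n) dvd at_arc (F p) (z + w) - at_arc (F p) (z + w')
       - (\<Sum>q\<in>UNIV. at_arc (mps_deriv (Some q) (F p)) z * (w $ q - w' $ q))"
    by (intro at_arc_taylor_dvd z zero_arc_dvd[OF assms(1)] zero_arc_dvd[OF assms(2)] assms)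
  also have "\<dots> = taylor_error z w p - taylor_error z w' p"
    by (simp add: taylor_error_def right_diff_distrib sum_subtractf)
  finally show ?thesis .
qed

lemma taylor_error_zero: "taylor_error z 0 p = 0"
  by (simp add: taylor_error_def)

lemma taylor_error_dvd:
  assumes "\<And>j. fps_X ^ Suc d dvd w $ j"
  shows "fps_X ^ (Suc d + Suc d) dvd taylor_error z w p"
  using taylor_error_diff_dvd[of w 0 "Suc d" p] assms by (simp add: taylor_error_zero)

lemma correction_mult:
  assumes "\<And>j. fps_X ^ Suc d dvd w $ j"
  shows "at_arc g z * correction d z w q = (\<Sum>r\<in>UNIV. at_arc (B q r) z * taylor_error z w r)" (is "_ = ?S")
proof -
  have "fps_X ^ (Suc d + Suc d) dvd ?S" by (intro dvd_sum dvd_mult taylor_error_dvd assms)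
  then have "fps_X ^ d dvd ?S" by (rule dvd_trans[OF le_imp_power_dvd, rotated]) simp
  then have S: "fps_X ^ d * fps_shift d ?S = ?S"
    by (auto elim!: dvdE simp: fps_shift_times_fps_X_power mult.commute[of "fps_X ^ d"])
  have "at_arc g z * correction d z w q
     = (fps_shift d (at_arc g z) * inverse (fps_shift d (at_arc g z))) * (fps_X ^ d * fps_shift d ?S)"
    by (subst unit_part) (simp only: correction_def mult_ac)
  then show ?thesis unfolding inverse_unit_part S by simp
qed

text \<open>The Taylor errors differ by a multiple of \<open>t^(d+1+n)\<close> and the division
  costs \<open>t^d\<close>, so one order is gained. Existence and uniqueness of the solution both
  rest on this.\<close>

lemma correction_diff_dvd:
  assumes "\<And>j. fps_X ^ Suc d dvd w $ j" "\<And>j. fps_X ^ Suc d dvd w' $ j" "\<And>j. fps_X ^ n dvd w $ j - w' $ j"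
  shows "fps_X ^ Suc n dvd correction d z w q - correction d z w' q"
proof -
  have "fps_X ^ (Suc d + n) dvd (\<Sum>r\<in>UNIV. at_arc (B q r) z * (taylor_error z w r - taylor_error z w' r))" (is "_ dvd ?S")
    by (intro dvd_sum dvd_mult taylor_error_diff_dvd assms)
  then have "fps_X ^ Suc n dvd fps_shift d ?S"
    unfolding fps_X_power_dvd_iff by simp
  moreover have "correction d z w q - correction d z w' q = fps_shift d ?S * inverse (fps_shift d (at_arc g z))"
    by (simp add: correction_def left_diff_distrib right_diff_distrib sum_subtractf fps_shift_diff)
  ultimately show ?thesis by simp
qed

lemma correction_dvd:
  assumes "\<And>j. fps_X ^ Suc d dvd w $ j"
  shows "fps_X ^ Suc d dvd correction d z w q"
proof -
  have "correction d z 0 q = 0" by (simp add: correction_def taylor_error_zero)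
  then have "fps_X ^ Suc (Suc d) dvd correction d z w q"
    using correction_diff_dvd[of w 0 "Suc d" q] assms by simp
  then show ?thesis unfolding fps_X_power_dvd_iff by simp
qed

text \<open>Multiplied by dF(z), the correction gives back the Taylor error, because dF B = g. The
  linear term in \<open>v\<close> thus contains all higher terms in \<open>w\<close>.\<close>

lemma arc_linearised:
  assumes w: "\<And>j. fps_X ^ Suc d dvd w $ j" and v: "\<And>q. v $ q = w $ q + correction d z w q"
  shows "at_arc (F p) (z + w) = at_arc (F p) z + (\<Sum>q\<in>UNIV. at_arc (mps_deriv (Some q) (F p)) z * v $ q)"
proof -
  interpret h: comm_ring_hom "\<lambda>h. at_arc h z" by (rule hom_at_arc[OF z])
  let ?J = "\<lambda>q. at_arc (mps_deriv (Some q) (F p)) z"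
  have JB: "(\<Sum>q\<in>UNIV. ?J q * at_arc (B q r) z) = (if p = r then at_arc g z else 0)" for r
    using arg_cong[OF jacobian_B[of p r], of "\<lambda>h. at_arc h z"]
    by (auto simp: h.hom_sum h.hom_mult h.hom_zero)
  have "at_arc g z * (\<Sum>q\<in>UNIV. ?J q * correction d z w q) = (\<Sum>q\<in>UNIV. ?J q * (at_arc g z * correction d z w q))"
    by (simp add: sum_distrib_left mult_ac)
  also have "\<dots> = (\<Sum>r\<in>UNIV. (\<Sum>q\<in>UNIV. ?J q * at_arc (B q r) z) * taylor_error z w r)"
    unfolding correction_mult[OF w] sum_distrib_left sum_distrib_right
    by (subst sum.swap) (simp add: mult.assoc)
  also have "\<dots> = at_arc g z * taylor_error z w p"
    unfolding JB by (simp add: if_distrib[of "\<lambda>x. x * _"] cong: if_cong)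
  finally have "(\<Sum>q\<in>UNIV. ?J q * correction d z w q) = taylor_error z w p"
    using ord by (simp add: has_ord_def)
  then show ?thesis
    unfolding v by (simp add: taylor_error_def distrib_left sum.distrib algebra_simps)
qed

lemma newton_solution_exists:
  assumes v: "\<And>j. fps_X ^ Suc d dvd v $ j"
  shows "fps_X ^ Suc d dvd newton_solution d z v $ j"
    and "v $ j = newton_solution d z v $ j + correction d z (newton_solution d z v) j"
proof -
  \<comment> \<open>These sets express membership in the multiples of \<open>t^(d+1)\<close>, where
    the correction is contracting.\<close>
  define C :: "nat \<Rightarrow> 'a set" where "C i = (if i < Suc d then {0} else UNIV)" for i
  have X: "(\<forall>j i. fps_nth (Y j) i \<in> C i) \<longleftrightarrow> (\<forall>j. fps_X ^ Suc d dvd Y j)" for Y :: "'m \<Rightarrow> 'a fps"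
    unfolding C_def fps_X_power_dvd_iff by auto
  define \<Psi> where "\<Psi> W q = v $ q - correction d z (\<chi> j. W j) q" for W q
  obtain Y where Y: "Y \<in> {Y. \<forall>j i. fps_nth (Y j) i \<in> C i}" "\<Psi> Y = Y"
    "\<And>j i. fps_nth (Y j) i = fps_nth ((\<Psi> ^^ Suc i) (\<lambda>_. 0) j) i"
  proof (rule fps_fixpoint[of "\<lambda>_. 0" C \<Psi>])
    show "(\<lambda>_. 0) \<in> {Y. \<forall>(j::'m) i. fps_nth (Y j) i \<in> C i}" by (simp add: X)
    show "\<Psi> Y \<in> {Y. \<forall>j i. fps_nth (Y j) i \<in> C i}" if "Y \<in> {Y. \<forall>j i. fps_nth (Y j) i \<in> C i}" for Y
      using that v unfolding X mem_Collect_eq \<Psi>_def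
      by (intro allI dvd_diff correction_dvd) simp_all
    fix Y Y' n j i
    assume YY: "Y \<in> {Y. \<forall>j i. fps_nth (Y j) i \<in> C i}" "Y' \<in> {Y. \<forall>j i. fps_nth (Y j) i \<in> C i}"
      and eq: "\<And>(j::'m) i. i < n \<Longrightarrow> fps_nth (Y j) i = fps_nth (Y' j) i" and i: "i \<le> n"
    have "fps_X ^ Suc n dvd correction d z (\<chi> j. Y j) j - correction d z (\<chi> j. Y' j) j"
      using YY eq unfolding X mem_Collect_eq
      by (intro correction_diff_dvd) (simp_all add: fps_X_power_dvd_iff[of n])
    then have "fps_nth (correction d z (\<chi> j. Y j) j - correction d z (\<chi> j. Y' j) j) i = 0"
      using i unfolding fps_X_power_dvd_iff by simp
    then show "fps_nth (\<Psi> Y j) i = fps_nth (\<Psi> Y' j) i" by (simp add: \<Psi>_def)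
  qed (rule that)
  have sol: "newton_solution d z v $ j = Y j" for j
    by (rule fps_ext) (simp add: newton_solution_def newton_iterate_def Y(3) \<Psi>_def[abs_def] del: funpow.simps)
  then have eq: "newton_solution d z v = (\<chi> j. Y j)" by (simp add: vec_eq_iff)
  show "fps_X ^ Suc d dvd newton_solution d z v $ j" unfolding sol using Y(1) X by blast
  have "Y j = v $ j - correction d z (\<chi> j. Y j) j" using fun_cong[OF Y(2), of j] by (simp add: \<Psi>_def)
  then show "v $ j = newton_solution d z v $ j + correction d z (newton_solution d z v) j"
    unfolding eq by simp
qed

lemma newton_unique:
  assumes w: "\<And>j. fps_X ^ Suc d dvd w $ j" and w': "\<And>j. fps_X ^ Suc d dvd w' $ j"
    and eq: "\<And>j. w $ j + correction d z w j = w' $ j + correction d z w' j"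
  shows "w = w'"
proof -
  have dvd: "fps_X ^ n dvd w $ j - w' $ j" for n j
  proof (induction n arbitrary: j)
    case (Suc n)
    have "w $ j - w' $ j = - (correction d z w j - correction d z w' j)"
      using eq[of j] by (simp add: algebra_simps)
    then show ?case using correction_diff_dvd[OF w w' Suc] by (simp only: dvd_minus_iff)
  qed simp
  have "fps_nth (w $ j) n = fps_nth (w' $ j) n" for j n
    using dvd[of "Suc n" j] unfolding fps_X_power_dvd_iff by simp
  then show ?thesis by (simp add: vec_eq_iff fps_eq_iff)
qed

text \<open>The Taylor expansion modulo \<open>t^(d+1)\<close>. For \<open>h = g\<close> it says
  that moving \<open>z\<close> by \<open>w\<close> changes neither the order \<open>d\<close> nor
  the leading coefficient.\<close>

lemma at_arc_perturb:
  assumes "\<And>j. fps_X ^ Suc d dvd w $ j" "i \<le> d"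
  shows "fps_nth (at_arc h (z + w)) i = fps_nth (at_arc h z) i"
proof -
  have 1: "fps_X ^ (0 + Suc d) dvd at_arc h (z + w) - at_arc h (z + 0)
       - (\<Sum>q\<in>UNIV. at_arc (mps_deriv (Some q) h) z * (w $ q - 0 $ q))"
    by (rule at_arc_taylor_dvd) (use z assms zero_arc_dvd in \<open>auto simp: zero_arc_def[of 0]\<close>)
  have 2: "fps_X ^ (0 + Suc d) dvd (\<Sum>q\<in>UNIV. at_arc (mps_deriv (Some q) h) z * (w $ q - 0 $ q))"
    using assms(1) by (intro dvd_sum dvd_mult) simp
  have "fps_X ^ Suc d dvd at_arc h (z + w) - at_arc h z"
    using dvd_add[OF 1 2] by simp
  then show ?thesis using assms(2) unfolding fps_X_power_dvd_iff by simp
qed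

end

end

text \<open>In this form the order condition consists of \<open>d\<close> polynomial equations and
  one inequation in the coefficients of the arc.\<close>

lemma has_ord_iff: "has_ord h d \<longleftrightarrow> (\<forall>i<d. fps_nth h i = 0) \<and> fps_nth h d \<noteq> 0"
proof
  assume "(\<forall>i<d. fps_nth h i = 0) \<and> fps_nth h d \<noteq> 0"
  then have h: "fps_nth h d \<noteq> 0" "\<And>i. i < d \<Longrightarrow> fps_nth h i = 0" by auto
  have "h \<noteq> 0" using h(1) by (intro notI) simp
  then show "has_ord h d" unfolding has_ord_def using subdegreeI[OF h] by blast
next
  assume "has_ord h d"
  then have "h \<noteq> 0" "subdegree h = d" by (auto simp: has_ord_def)
  then show "(\<forall>i<d. fps_nth h i = 0) \<and> fps_nth h d \<noteq> 0"
    using nth_less_subdegree_zero[of _ h] nth_subdegree_nonzero[of h] by blast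
qed

lemma series1_solution:
  fixes F :: "'m::finite \<Rightarrow> ('m option, 'a::field) mps" and z v w :: "'a fps ^ 'm"
  assumes val: "\<forall>av. Q = Convergent av \<longrightarrow> is_valuation av"
    and sys: "newton_system F B g"
    and F: "\<And>p. F p \<in> series Q" and gz: "at_arc g z \<in> series1 Q" and bz: "\<And>q r. at_arc (B q r) z \<in> series1 Q"
    and z: "zero_arc z" "\<And>j. z $ j \<in> series1 Q" and ord: "has_ord (at_arc g z) d"
    and v: "\<And>j. v $ j \<in> series1 Q" "\<And>j. fps_X ^ Suc d dvd v $ j"
    and w: "\<And>j. fps_X ^ Suc d dvd w $ j"
    and eq: "\<And>q. v $ q = w $ q + newton_system.correction F B g d z w q"
  shows "w $ j \<in> series1 Q"
proof -
  interpret newton_system F B g by fact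
  show ?thesis
  proof (cases Q)
    case (Convergent av)
    then interpret valued_field av using val by unfold_locales blast
    have "v $ q - w $ q = correction d z w q" for q using eq[of q] by simp
    then have "at_arc g z * (v $ q - w $ q) = (\<Sum>r\<in>UNIV. at_arc (B q r) z * (at_arc (F r) (z + w) - at_arc (F r) z
        - (\<Sum>j\<in>UNIV. at_arc (mps_deriv (Some j) (F r)) z * w $ j)))" for q
      using correction_mult[OF z(1) ord w, of q] by (simp add: taylor_error_def)
    then have "w $ j \<in> conv"
      using F gz bz z v w ord unfolding Convergent has_ord_def
      by (intro conv_solution[where F = F and z = z and v = v and w = w and d = d and \<gamma> = "at_arc g z"
            and b = "\<lambda>q r. at_arc (B q r) z"]) blast+
    then show ?thesis using Convergent by simp
  next
    case Algebraic
    note ser = series1_Algebraic[where 'a = 'a]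
    note R = subring_set_alg_series[where 'a = 'a]
    have J: "at_arc (mps_deriv (Some q) (F p)) z \<in> alg_series" "at_arc (F p) z \<in> alg_series" for p q
      using at_arc_in_series1(1)[OF val F[of p] z] at_arc_in_series1(2)[OF val F[of p] z, of q]
      unfolding Algebraic ser by auto
    have zw: "zero_arc (z + w)" using z(1) zero_arc_dvd[OF w] by (simp add: zero_arc_def)
    have "(z + w) $ j \<in> alg_series"
    proof (rule algebraic_solution[OF _ zw _ _ jacobian_B])
      show "F p \<in> series Algebraic" for p using F Algebraic by simp
      \<comment> \<open>By linearisation this value is expressed through \<open>z\<close> and
        \<open>v\<close> alone, so it is algebraic before anything is known about
        \<open>w\<close>.\<close>
      show "at_arc (F p) (z + w) \<in> alg_series" for p
        unfolding arc_linearised[OF z(1) ord w eq] using v(1)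
        unfolding Algebraic ser by (intro subring_set_add[OF R] subring_set_sum[OF R] subring_set_mult[OF R] J) auto
      have "fps_nth (at_arc g (z + w)) d \<noteq> 0"
        using at_arc_perturb[OF z(1) ord w, of d g] ord by (simp add: has_ord_iff)
      then show "at_arc g (z + w) \<noteq> 0" by auto
    qed
    then have "(z + w) $ j - z $ j \<in> alg_series"
      using z(2) unfolding Algebraic ser by (intro subring_set_diff[OF R])
    then show ?thesis unfolding Algebraic ser by simp
  qed simp
qed

text \<open>The cofactor of the entry in row \<open>i\<close> and column \<open>l\<close>, obtained
  by replacing row \<open>i\<close> by a unit vector; this avoids submatrices and signs on an
  unordered index type.\<close>

definition adjugate_entry :: "'r::comm_ring_1 ^ 'k ^ 'k \<Rightarrow> 'k::finite \<Rightarrow> 'k \<Rightarrow> 'r" where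
  "adjugate_entry M l i = det (\<chi> p. if p = i then axis l 1 else M $ p)"

text \<open>By linearity in row \<open>j\<close> the sum is the determinant with row
  \<open>j\<close> replaced by row \<open>i\<close>, hence \<open>det M\<close> or a determinant
  with two equal rows.\<close>

lemma mult_adjugate:
  fixes M :: "'r::comm_ring_1 ^ 'k ^ 'k::finite"
  shows "(\<Sum>l\<in>UNIV. M $ i $ l * adjugate_entry M l j) = (if i = j then det M else 0)"
proof -
  have "(\<Sum>l\<in>UNIV. M $ i $ l * adjugate_entry M l j)
      = (\<Sum>l\<in>UNIV. det (\<chi> p. if p = j then M $ i $ l *s axis l 1 else M $ p))"
    by (simp add: adjugate_entry_def det_row_mul)
  also have "\<dots> = det (\<chi> p. if p = j then (\<Sum>l\<in>UNIV. M $ i $ l *s axis l 1) else M $ p)"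
    by (rule det_linear_row_sum[symmetric]) simp
  also have "\<dots> = det (\<chi> p. if p = j then M $ i else M $ p)"
    by (subst basis_expansion) simp
  also have "\<dots> = (if i = j then det M else 0)"
  proof (cases "i = j")
    case True
    then have "(\<chi> p. if p = j then M $ i else M $ p) = M" by (simp add: vec_eq_iff)
    then show ?thesis using True by simp
  next
    case False
    then show ?thesis
      by (simp only: if_False, intro det_identical_rows[OF False]) (simp add: row_def)
  qed
  finally show ?thesis .
qed

lemma subring_set_of_int:
  assumes S: "subring_set S" shows "of_int n \<in> S"
proof -
  have nat: "of_nat n \<in> S" for n
    by (induction n) (auto simp: subring_set_0[OF S] intro: subring_set_add[OF S] subring_set_1[OF S])
  show ?thesis by (cases n) (auto intro: nat subring_set_uminus[OF S] simp del: of_nat_Suc)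
qed

lemma subring_set_det:
  assumes S: "subring_set S" and "\<And>i j. M $ i $ j \<in> S" shows "det M \<in> S"
  unfolding det_def
  by (intro subring_set_sum[OF S] subring_set_mult[OF S] subring_set_of_int[OF S] subring_set_prod[OF S] assms)

lemma subring_set_adjugate_entry:
  assumes S: "subring_set S" and "\<And>i j. M $ i $ j \<in> S" shows "adjugate_entry M l i \<in> S"
  unfolding adjugate_entry_def
  by (intro subring_set_det[OF S]) (auto simp: assms axis_def subring_set_0[OF S] subring_set_1[OF S])

lemma sum_range_split:
  fixes \<sigma> :: "'k::finite \<Rightarrow> 'm::finite"
  assumes "inj \<sigma>"
  shows "sum h UNIV = (\<Sum>l\<in>UNIV. h (\<sigma> l)) + sum h (- range \<sigma>)"
proof -
  have "sum h UNIV = sum h (range \<sigma> \<union> - range \<sigma>)" by simp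
  also have "\<dots> = sum h (range \<sigma>) + sum h (- range \<sigma>)" by (rule sum.union_disjoint) auto
  finally show ?thesis by (simp add: sum.reindex[OF assms])
qed

text \<open>
  The system is completed to a square one by the coordinates outside the minor; the block matrix \<open>B\<close>
  is the resulting multiple of the inverse of the Jacobian.
\<close>

lemma minor_newton_system:
  fixes f :: "('m::finite option, 'a::field) mps ^ 'k::finite"
  assumes "is_maximal_minor g (rel_jacobian f)"
  obtains \<sigma> :: "'k \<Rightarrow> 'm" and F B where "\<And>i. F (\<sigma> i) = f $ i"
    "\<And>p. F p \<in> {mps_var (Some p)} \<union> range (\<lambda>i. f $ i)" "newton_system F B g"
    "\<forall>S. subring_set S \<longrightarrow> (\<forall>i q. mps_deriv (Some q) (f $ i) \<in> S) \<longrightarrow> g \<in> S \<and> (\<forall>q r. B q r \<in> S)"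
proof -
  obtain \<sigma> :: "'k \<Rightarrow> 'm" where \<sigma>: "inj \<sigma>" and g: "g = det (\<chi> i l. rel_jacobian f $ i $ \<sigma> l)"
    using assms by (auto simp: is_maximal_minor_def)
  define M where "M i q = mps_deriv (Some q) (f $ i)" for i q
  define D where "D = (\<chi> i l. M i (\<sigma> l))"
  have gD: "g = det D" by (simp add: g D_def M_def rel_jacobian_def)
  define A where "A = adjugate_entry D"
  define \<tau> where "\<tau> = inv \<sigma>"
  have \<tau>: "\<tau> (\<sigma> l) = l" for l using \<sigma> by (simp add: \<tau>_def)
  have DA: "(\<Sum>l\<in>UNIV. M i (\<sigma> l) * A l j) = (if i = j then g else 0)" for i j
    using mult_adjugate[of D i j] unfolding A_def gD by (simp add: D_def)
  define F where "F p = (if p \<in> range \<sigma> then f $ \<tau> p else mps_var (Some p))" for p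
  \<comment> \<open>With the columns of the minor first, the Jacobian of \<open>F\<close> is the
    block matrix (D N; 0 1), and \<open>B\<close> is (adj D, - adj D N; 0, g).\<close>
  define B where "B q r = (if r \<in> range \<sigma> then (if q \<in> range \<sigma> then A (\<tau> q) (\<tau> r) else 0)
      else (if q \<in> range \<sigma> then - (\<Sum>i\<in>UNIV. A (\<tau> q) i * M i r) else if q = r then g else 0))" for q r
  show ?thesis
  proof
    show "F (\<sigma> i) = f $ i" for i by (simp add: F_def \<tau>)
    show "F p \<in> {mps_var (Some p)} \<union> range (\<lambda>i. f $ i)" for p by (simp add: F_def)
    \<comment> \<open>The statement is kept for every subring so that it can be used with the
      subring of all series whose value on a given arc has the quality \<open>Q\<close>.\<close>
    show "\<forall>S. subring_set S \<longrightarrow> (\<forall>i q. mps_deriv (Some q) (f $ i) \<in> S) \<longrightarrow> g \<in> S \<and> (\<forall>q r. B q r \<in> S)"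
    proof (intro allI impI)
      fix S assume S: "subring_set S" and MS: "\<forall>i q. mps_deriv (Some q) (f $ i) \<in> S"
      have D: "D $ i $ l \<in> S" for i l using MS by (simp add: D_def M_def)
      have gS: "g \<in> S" unfolding gD by (intro subring_set_det[OF S] D)
      have AS: "A l i \<in> S" for l i unfolding A_def by (intro subring_set_adjugate_entry[OF S] D)
      have "B q r \<in> S" for q r
        unfolding B_def using MS gS AS subring_set_0[OF S]
        by (auto simp: M_def intro!: subring_set_uminus[OF S] subring_set_sum[OF S] subring_set_mult[OF S])
      then show "g \<in> S \<and> (\<forall>q r. B q r \<in> S)" using gS by blast
    qed
    show "newton_system F B g"
    proof
      fix p r
      have var: "mps_deriv (Some q) (mps_var (Some p) :: ('m option, 'a) mps) = (if q = p then 1 else 0)" for q p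
        by (rule mps_eqI) (auto simp: mps_nth_deriv mps_nth_var mps_nth_one)
      show "(\<Sum>q\<in>UNIV. mps_deriv (Some q) (F p) * B q r) = (if p = r then g else 0)"
      proof (cases "p \<in> range \<sigma>")
        case False
        then have "(\<Sum>q\<in>UNIV. mps_deriv (Some q) (F p) * B q r) = B p r"
          by (simp add: F_def var if_distrib[of "\<lambda>x. x * _"] cong: if_cong)
        then show ?thesis using False by (auto simp: B_def)
      next
        case True
        then obtain i where i: "p = \<sigma> i" by auto
        have Fp: "mps_deriv (Some q) (F p) = M i q" for q by (simp add: F_def i \<tau> M_def)
        show ?thesis
        proof (cases "r \<in> range \<sigma>")
          case True
          then obtain j where j: "r = \<sigma> j" by auto
          have "(\<Sum>q\<in>UNIV. mps_deriv (Some q) (F p) * B q r) = (\<Sum>l\<in>UNIV. M i (\<sigma> l) * A l j)"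
            unfolding Fp by (subst sum_range_split[OF \<sigma>]) (simp add: B_def j \<tau>)
          then show ?thesis using DA[of i j] \<sigma> by (simp add: i j inj_eq)
        next
          case False
          have "(\<Sum>l\<in>UNIV. M i (\<sigma> l) * (\<Sum>j\<in>UNIV. A l j * M j r))
              = (\<Sum>j\<in>UNIV. (\<Sum>l\<in>UNIV. M i (\<sigma> l) * A l j) * M j r)"
            unfolding sum_distrib_left sum_distrib_right by (subst sum.swap) (simp add: mult.assoc)
          also have "\<dots> = g * M i r"
            unfolding DA by (simp add: if_distrib[of "\<lambda>x. x * _"] cong: if_cong)
          finally have 1: "(\<Sum>l\<in>UNIV. M i (\<sigma> l) * B (\<sigma> l) r) = - (g * M i r)"
            using False by (simp add: B_def \<tau> sum_negf)
          have "(\<Sum>q\<in>- range \<sigma>. M i q * B q r) = (\<Sum>q\<in>- range \<sigma>. if q = r then M i r * g else 0)"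
            using False by (intro sum.cong) (auto simp: B_def)
          then have 2: "(\<Sum>q\<in>- range \<sigma>. M i q * B q r) = g * M i r"
            using False by (simp add: mult.commute)
          show ?thesis
            unfolding Fp using False by (subst sum_range_split[OF \<sigma>]) (auto simp: 1 2 i)
        qed
      qed
    qed
  qed
qed

section \<open>Regular functions\<close>

definition regular :: "('x \<Rightarrow> 'i \<Rightarrow> 'a::field) \<Rightarrow> ('x \<Rightarrow> 'a) \<Rightarrow> 'x set \<Rightarrow> ('x \<Rightarrow> 'a) \<Rightarrow> bool" where
  "regular cX q X \<phi> \<longleftrightarrow>
     (\<exists>p e. mps_is_poly p \<and> (\<forall>x\<in>X. \<phi> x = mps_poly_eval p (cX x) / q x ^ e))"

lemma textile_on_regular: "textile_on cX cY q X F \<longleftrightarrow> (\<forall>j. regular cX q X (\<lambda>x. cY (F x) j))"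
  by (simp add: textile_on_def regular_def)

lemma regular_cong: "(\<And>x. x \<in> X \<Longrightarrow> \<phi> x = \<psi> x) \<Longrightarrow> regular cX q X \<phi> \<longleftrightarrow> regular cX q X \<psi>"
  unfolding regular_def by simp

lemma hom_self: "comm_ring_hom (\<lambda>c :: 'a::comm_ring_1. c)"
  by unfold_locales auto

lemma mps_poly_eval_add: "mps_is_poly p \<Longrightarrow> mps_is_poly p' \<Longrightarrow>
    mps_poly_eval (p + p') x = mps_poly_eval p x + mps_poly_eval p' x"
  and mps_poly_eval_mult: "mps_is_poly p \<Longrightarrow> mps_is_poly p' \<Longrightarrow>
    mps_poly_eval (p * p') x = mps_poly_eval p x * mps_poly_eval p' x"
  and mps_poly_eval_const: "mps_poly_eval (mps_const c) x = c"
  and mps_poly_eval_var: "mps_poly_eval (mps_var i) x = x i"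
  by (simp_all add: mps_poly_eval_mps_eval comm_ring_hom.mps_eval_add[OF hom_self]
      comm_ring_hom.mps_eval_mult[OF hom_self] comm_ring_hom.mps_eval_const[OF hom_self]
      comm_ring_hom.mps_eval_var[OF hom_self])

text \<open>Since \<open>q\<close> is itself a polynomial function, fractions with different powers
  of \<open>q\<close> can be brought to a common denominator and added.\<close>

locale regular_functions =
  fixes cX :: "'x \<Rightarrow> 'i \<Rightarrow> 'a::field" and q :: "'x \<Rightarrow> 'a" and X :: "'x set"
  assumes q_nonzero: "x \<in> X \<Longrightarrow> q x \<noteq> 0"
    and q_poly: "\<exists>p. mps_is_poly p \<and> (\<forall>x\<in>X. q x = mps_poly_eval p (cX x))"
begin

abbreviation "reg \<equiv> regular cX q X"

lemma reg_poly: "mps_is_poly p \<Longrightarrow> reg (\<lambda>x. mps_poly_eval p (cX x))"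
  unfolding regular_def by (intro exI[of _ p] exI[of _ 0]) simp

lemma reg_const: "reg (\<lambda>_. c)"
  using reg_poly[of "mps_const c"] by (simp add: mps_poly_eval_const)

lemma reg_coord: "reg (\<lambda>x. cX x i)"
  using reg_poly[of "mps_var i"] by (simp add: mps_poly_eval_var)

lemma reg_mult:
  assumes "reg \<phi>" "reg \<psi>" shows "reg (\<lambda>x. \<phi> x * \<psi> x)"
proof -
  obtain p e where p: "mps_is_poly p" "\<And>x. x \<in> X \<Longrightarrow> \<phi> x = mps_poly_eval p (cX x) / q x ^ e"
    using assms(1) unfolding regular_def by blast
  obtain p' e' where p': "mps_is_poly p'" "\<And>x. x \<in> X \<Longrightarrow> \<psi> x = mps_poly_eval p' (cX x) / q x ^ e'"
    using assms(2) unfolding regular_def by blast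
  show ?thesis
    unfolding regular_def using p p'
    by (intro exI[of _ "p * p'"] exI[of _ "e + e'"])
       (auto simp: mps_poly_eval_mult power_add mps_is_poly_mult)
qed

lemma reg_add:
  assumes "reg \<phi>" "reg \<psi>" shows "reg (\<lambda>x. \<phi> x + \<psi> x)"
proof -
  obtain p e where p: "mps_is_poly p" "\<And>x. x \<in> X \<Longrightarrow> \<phi> x = mps_poly_eval p (cX x) / q x ^ e"
    using assms(1) unfolding regular_def by blast
  obtain p' e' where p': "mps_is_poly p'" "\<And>x. x \<in> X \<Longrightarrow> \<psi> x = mps_poly_eval p' (cX x) / q x ^ e'"
    using assms(2) unfolding regular_def by blast
  obtain r where r: "mps_is_poly r" "\<And>x. x \<in> X \<Longrightarrow> q x = mps_poly_eval r (cX x)"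
    using q_poly by blast
  have pow: "mps_is_poly (r ^ n) \<and> mps_poly_eval (r ^ n) y = mps_poly_eval r y ^ n" for n y
    using mps_poly_eval_const[of 1 y]
    by (induction n) (simp_all add: mps_is_poly_mult mps_poly_eval_mult r)
  have "\<phi> x + \<psi> x = mps_poly_eval (p * r ^ e' + p' * r ^ e) (cX x) / q x ^ (e + e')" if "x \<in> X" for x
  proof -
    have "\<phi> x + \<psi> x = (mps_poly_eval p (cX x) * q x ^ e' + mps_poly_eval p' (cX x) * q x ^ e) / (q x ^ e * q x ^ e')"
      unfolding p(2)[OF that] p'(2)[OF that] using q_nonzero[OF that] by (simp add: add_frac_eq)
    then show ?thesis
      using pow p(1) p'(1) r(2)[OF that]
      by (simp add: mps_poly_eval_add mps_poly_eval_mult mps_is_poly_mult power_add)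
  qed
  then show ?thesis
    unfolding regular_def using p p' pow
    by (intro exI[of _ "p * r ^ e' + p' * r ^ e"] exI[of _ "e + e'"])
       (auto intro!: mps_is_poly_add mps_is_poly_mult)
qed

lemma reg_uminus: "reg \<phi> \<Longrightarrow> reg (\<lambda>x. - \<phi> x)"
  using reg_mult[OF reg_const[of "- 1"]] by simp

lemma reg_diff: "reg \<phi> \<Longrightarrow> reg \<psi> \<Longrightarrow> reg (\<lambda>x. \<phi> x - \<psi> x)"
  using reg_add[of \<phi> "\<lambda>x. - \<psi> x"] reg_uminus[of \<psi>] by simp

lemma reg_sum: "(\<And>i. i \<in> I \<Longrightarrow> reg (\<phi> i)) \<Longrightarrow> reg (\<lambda>x. \<Sum>i\<in>I. \<phi> i x)"
  by (induction I rule: infinite_finite_induct) (auto intro: reg_const reg_add)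

lemma reg_divide_q:
  assumes "reg \<phi>" shows "reg (\<lambda>x. \<phi> x / q x)"
proof -
  obtain p e where p: "mps_is_poly p" "\<And>x. x \<in> X \<Longrightarrow> \<phi> x = mps_poly_eval p (cX x) / q x ^ e"
    using assms unfolding regular_def by blast
  then show ?thesis
    unfolding regular_def by (intro exI[of _ p] exI[of _ "Suc e"]) (auto simp: mult.commute)
qed

definition reg_fps :: "('x \<Rightarrow> 'a fps) \<Rightarrow> bool" where
  "reg_fps \<phi> \<longleftrightarrow> (\<forall>n. reg (\<lambda>x. fps_nth (\<phi> x) n))"

lemma reg_fps_const: "reg_fps (\<lambda>_. h)"
  by (simp add: reg_fps_def reg_const)

lemma reg_fps_add: "reg_fps \<phi> \<Longrightarrow> reg_fps \<psi> \<Longrightarrow> reg_fps (\<lambda>x. \<phi> x + \<psi> x)"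
  by (simp add: reg_fps_def reg_add)

lemma reg_fps_diff: "reg_fps \<phi> \<Longrightarrow> reg_fps \<psi> \<Longrightarrow> reg_fps (\<lambda>x. \<phi> x - \<psi> x)"
  by (simp add: reg_fps_def reg_diff)

lemma reg_fps_mult: "reg_fps \<phi> \<Longrightarrow> reg_fps \<psi> \<Longrightarrow> reg_fps (\<lambda>x. \<phi> x * \<psi> x)"
  unfolding reg_fps_def fps_mult_nth by (intro allI reg_sum reg_mult) auto

lemma reg_fps_sum: "(\<And>i. i \<in> I \<Longrightarrow> reg_fps (\<phi> i)) \<Longrightarrow> reg_fps (\<lambda>x. \<Sum>i\<in>I. \<phi> i x)"
  by (induction I rule: infinite_finite_induct) (auto intro: reg_fps_const reg_fps_add)

lemma reg_fps_shift: "reg_fps \<phi> \<Longrightarrow> reg_fps (\<lambda>x. fps_shift d (\<phi> x))"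
  by (simp add: reg_fps_def)

lemma reg_fps_prod_mset: "(\<And>v. reg_fps (\<lambda>x. s x v)) \<Longrightarrow> reg_fps (\<lambda>x. prod_mset (image_mset (s x) \<alpha>))"
  by (induction \<alpha>) (auto intro: reg_fps_const reg_fps_mult)

lemma reg_fps_at_arc:
  fixes h :: "('m::finite option, 'a) mps"
  assumes "\<And>j. reg_fps (\<lambda>x. y x $ j)"
  shows "reg_fps (\<lambda>x. at_arc h (y x))"
proof -
  have "reg_fps (\<lambda>x. case_option fps_X (\<lambda>j. y x $ j) v)" for v
    using assms reg_fps_const by (cases v) auto
  then have "reg (\<lambda>x. fps_nth (prod_mset (image_mset (case_option fps_X (\<lambda>j. y x $ j)) \<alpha>)) n)" for \<alpha> n
    using reg_fps_prod_mset[of "\<lambda>x. case_option fps_X (\<lambda>j. y x $ j)" \<alpha>] by (simp add: reg_fps_def)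
  then show ?thesis
    unfolding reg_fps_def at_arc_def mps_subst_def fps_nth_Abs_fps
    by (intro allI reg_sum reg_mult reg_const)
qed

lemma reg_fps_inverse:
  assumes u: "reg_fps u" and u0: "\<And>x. x \<in> X \<Longrightarrow> fps_nth (u x) 0 = q x"
  shows "reg_fps (\<lambda>x. inverse (u x))"
  unfolding reg_fps_def
proof
  fix n show "reg (\<lambda>x. fps_nth (inverse (u x)) n)"
  proof (induction n rule: less_induct)
    case (less n)
    have "fps_nth (inverse (u x)) n
        = ((if n = 0 then 1 else 0) - (\<Sum>i=1..n. fps_nth (u x) i * fps_nth (inverse (u x)) (n - i))) / q x"
      if x: "x \<in> X" for x
    proof -
      have "u x * inverse (u x) = 1"
        using u0[OF x] q_nonzero[OF x] by (intro inverse_mult_eq_1') simp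
      then have "fps_nth (u x * inverse (u x)) n = (if n = 0 then 1 else 0)" by simp
      then have "fps_nth (u x) 0 * fps_nth (inverse (u x)) n
          + (\<Sum>i=1..n. fps_nth (u x) i * fps_nth (inverse (u x)) (n - i)) = (if n = 0 then 1 else 0)"
        unfolding fps_mult_nth by (simp add: sum.atLeast_Suc_atMost)
      then show ?thesis using u0[OF x] q_nonzero[OF x] by (simp add: field_simps split: if_splits)
    qed
    moreover have "reg (\<lambda>x. ((if n = 0 then 1 else 0)
        - (\<Sum>i=1..n. fps_nth (u x) i * fps_nth (inverse (u x)) (n - i))) / q x)"
      using u less by (intro reg_divide_q reg_diff reg_const reg_sum reg_mult) (auto simp: reg_fps_def)
    ultimately show ?case by (subst regular_cong) auto
  qed
qed

lemma reg_fps_correction: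
  assumes sys: "newton_system F B g"
    and Z: "\<And>j. reg_fps (\<lambda>x. Z x $ j)" and W: "\<And>j. reg_fps (\<lambda>x. W x $ j)"
    and q: "\<And>x. x \<in> X \<Longrightarrow> fps_nth (at_arc g (Z x)) d = q x"
  shows "reg_fps (\<lambda>x. newton_system.correction F B g d (Z x) (W x) j)"
proof -
  interpret newton_system F B g by fact
  have ZW: "reg_fps (\<lambda>x. (Z x + W x) $ j)" for j using reg_fps_add[OF Z W] by simp
  show ?thesis
    unfolding correction_def taylor_error_def
    using q by (intro reg_fps_mult reg_fps_shift reg_fps_sum reg_fps_diff reg_fps_at_arc
        reg_fps_inverse Z W ZW) simp_all
qed

text \<open>Every iterate is regular by induction, and each coefficient of the solution belongs to a
  single iterate; no limit is involved.\<close>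

lemma reg_fps_newton_solution:
  assumes sys: "newton_system F B g"
    and Z: "\<And>j. reg_fps (\<lambda>x. Z x $ j)" and V: "\<And>j. reg_fps (\<lambda>x. V x $ j)"
    and q: "\<And>x. x \<in> X \<Longrightarrow> fps_nth (at_arc g (Z x)) d = q x"
  shows "reg_fps (\<lambda>x. newton_system.newton_solution F B g d (Z x) (V x) $ j)"
proof -
  interpret newton_system F B g by fact
  have "reg_fps (\<lambda>x. newton_iterate d (Z x) (V x) n j)" for n j
  proof (induction n arbitrary: j)
    case 0
    show ?case by (simp add: newton_iterate_def reg_fps_const)
  next
    case (Suc n)
    have "newton_iterate d z v (Suc n) j = v $ j - correction d z (\<chi> j. newton_iterate d z v n j) j" for z v
      by (simp add: newton_iterate_def)
    then show ?case
      using Suc by (simp only:) (intro reg_fps_diff V reg_fps_correction[OF sys Z _ q], simp_all)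
  qed
  then show ?thesis by (simp add: newton_solution_def reg_fps_def)
qed

end

section \<open>The chart\<close>

context newton_system
begin

definition arc_chart :: "nat \<Rightarrow> ('a fps ^ 'm) \<times> ('a fps ^ 'm) \<Rightarrow> 'a fps ^ 'm" where
  "arc_chart d = (\<lambda>(z, v). newton_solution d z v + z)"

definition arc_trunc :: "nat \<Rightarrow> 'a fps ^ 'm \<Rightarrow> 'a fps ^ 'm" where
  "arc_trunc d y = (\<chi> j. fps_cutoff (Suc d) (y $ j))"

text \<open>Since \<open>z\<close> has degree at most \<open>d\<close> and \<open>w\<close> lies in
  \<open>t^(d+1)\<close>, truncation separates the two; \<open>v\<close> is then explicit in
  \<open>z\<close> and \<open>w\<close>, so the inverse needs no iteration.\<close>

definition arc_chart_inv :: "nat \<Rightarrow> 'a fps ^ 'm \<Rightarrow> ('a fps ^ 'm) \<times> ('a fps ^ 'm)" where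
  "arc_chart_inv d y = (arc_trunc d y,
     \<chi> j. (y - arc_trunc d y) $ j + correction d (arc_trunc d y) (y - arc_trunc d y) j)"

lemma arc_trunc_dvd: "fps_X ^ Suc d dvd (y - arc_trunc d y) $ j"
  unfolding fps_X_power_dvd_iff by (simp add: arc_trunc_def)

end

lemma poly_0_iff: "h \<in> poly_0 d \<longleftrightarrow> fps_nth h 0 = 0 \<and> (\<forall>n>d. fps_nth h n = 0)"
proof
  assume "fps_nth h 0 = 0 \<and> (\<forall>n>d. fps_nth h n = 0)"
  then have h: "fps_nth h 0 = 0" "\<And>n. n > d \<Longrightarrow> fps_nth h n = 0" by auto
  define p where "p = (\<Sum>n\<le>d. monom (fps_nth h n) n)"
  have c: "coeff p n = fps_nth h n" for n using h by (auto simp: p_def coeff_sum not_le)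
  have "h = fps_of_poly p" by (rule fps_ext) (simp add: c)
  moreover have "degree p \<le> d" using c h by (intro degree_le) auto
  moreover have "coeff p 0 = 0" using h(1) by (simp add: c)
  ultimately show "h \<in> poly_0 d" unfolding poly_0_def by blast
qed (auto simp: poly_0_def coeff_eq_0)

lemma Z_set_iff: "z \<in> Z_set g d \<longleftrightarrow>
    zero_arc z \<and> (\<forall>j. \<forall>n>d. fps_nth (z $ j) n = 0) \<and> has_ord (at_arc g z) d"
  by (auto simp: Z_set_def vecs_in_def poly_0_iff zero_arc_def)

lemma S_set_iff: "y \<in> S_set Q g d \<longleftrightarrow>
    zero_arc y \<and> (\<forall>j. y $ j \<in> series1 Q) \<and> has_ord (at_arc g y) d"
  by (auto simp: S_set_def vecs_in_def series1_0_def zero_arc_def)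

text \<open>A series without constant term supplies one more factor \<open>t\<close>. For the
  converse the cofactor must have the same quality, which is division by \<open>t^d\<close>.\<close>

lemma V_set_iff:
  fixes Q :: "'a::field quality"
  assumes val: "\<forall>av. Q = Convergent av \<longrightarrow> is_valuation av"
  shows "v \<in> V_set Q d \<longleftrightarrow> (\<forall>j. v $ j \<in> series1 Q \<and> fps_X ^ Suc d dvd v $ j)"
proof -
  have X: "fps_X ^ d \<in> series1 Q"
    using fps_of_poly_in_series1[OF val, where p = "monom 1 d"] by (simp add: fps_of_poly_monom')
  have "h \<in> (\<lambda>h. fps_X ^ d * h) ` series1_0 Q \<longleftrightarrow> h \<in> series1 Q \<and> fps_X ^ Suc d dvd h" for h
  proof
    assume "h \<in> (\<lambda>h. fps_X ^ d * h) ` series1_0 Q"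
    then obtain h' where h': "h = fps_X ^ d * h'" "h' \<in> series1 Q" "fps_nth h' 0 = 0"
      by (auto simp: series1_0_def)
    have "h \<in> series1 Q"
      unfolding h'(1) by (intro subring_set_mult[OF subring_set_series1[OF val]] X h'(2))
    moreover have "fps_X ^ Suc d dvd h"
      unfolding fps_X_power_dvd_iff h'(1) using h'(3)
      by (auto simp: fps_X_power_mult_nth less_Suc_eq)
    ultimately show "h \<in> series1 Q \<and> fps_X ^ Suc d dvd h" ..
  next
    assume h: "h \<in> series1 Q \<and> fps_X ^ Suc d dvd h"
    then obtain h'' where "h = fps_X ^ Suc d * h''" by (auto elim: dvdE)
    then have h': "h = fps_X ^ d * (fps_X * h'')" by (simp add: mult_ac)
    have "fps_X * h'' \<in> series1 Q"
      by (rule series1_division[OF val X]) (use h h' in auto)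
    then show "h \<in> (\<lambda>h. fps_X ^ d * h) ` series1_0 Q"
      using h' by (auto simp: series1_0_def)
  qed
  then show ?thesis by (simp add: V_set_def vecs_in_def)
qed

text \<open>An instance of regular functions with \<open>q = 1\<close>, where the denominators
  disappear.\<close>

lemma at_arc_coeff_polynomial:
  fixes g :: "('m::finite option, 'a::field) mps" and cX :: "'x \<Rightarrow> 'i \<Rightarrow> 'a" and y :: "'x \<Rightarrow> 'a fps ^ 'm"
  assumes y: "\<And>j n. \<exists>i. \<forall>x. fps_nth (y x $ j) n = cX x i"
  shows "\<exists>p. mps_is_poly p \<and> (\<forall>x. fps_nth (at_arc g (y x)) d = mps_poly_eval p (cX x))"
proof -
  interpret r: regular_functions cX "\<lambda>_. 1" UNIV
    by unfold_locales (auto intro!: exI[of _ "mps_const 1"] simp: mps_poly_eval_const simp del: mps_const_1)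
  have "r.reg (\<lambda>x. fps_nth (y x $ j) n)" for j n
  proof -
    obtain i where "\<And>x. fps_nth (y x $ j) n = cX x i" using y[of j n] by blast
    then show ?thesis using r.reg_coord[of i] by simp
  qed
  then have "r.reg_fps (\<lambda>x. at_arc g (y x))"
    by (intro r.reg_fps_at_arc) (simp add: r.reg_fps_def)
  then show ?thesis unfolding r.reg_fps_def regular_def by simp
qed

lemma Z_set_quasi_affine:
  fixes g :: "('m::finite option, 'a::field) mps"
  shows "quasi_affine_in (vecs_in (poly_0 d)) (Z_set g d)"
proof -
  let ?X = "vecs_in (poly_0 d) :: ('a fps ^ 'm) set"
  have "\<forall>i. \<exists>p. mps_is_poly p \<and> (\<forall>z. fps_nth (at_arc g z) i = mps_poly_eval p (coeffs_vec z))"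
    by (intro allI at_arc_coeff_polynomial) (auto simp: coeffs_vec_def)
  from choice[OF this] obtain p where
    p: "\<And>i. mps_is_poly (p i)" "\<And>i z. fps_nth (at_arc g z) i = mps_poly_eval (p i) (coeffs_vec z)"
    by blast
  show ?thesis
    unfolding quasi_affine_in_def
  proof (intro exI conjI)
    show "\<forall>r\<in>p ` {..<d} \<union> {p d}. mps_is_poly r" using p by auto
    show "Z_set g d = {z \<in> ?X. (\<forall>r\<in>p ` {..<d}. mps_poly_eval r (coeffs_vec z) = 0) \<and>
        (\<exists>r\<in>{p d}. mps_poly_eval r (coeffs_vec z) \<noteq> 0)}"
      using p(2) by (auto simp: Z_set_def has_ord_iff)
  qed
qed

theorem theorem1p8:
  fixes Q :: "'a::field quality"
    and f :: "('m::finite option, 'a) mps ^ 'k::finite"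
    and g :: "('m option, 'a) mps"
  assumes "perfect_field TYPE('a)"
    and "\<And>av. Q = Convergent av \<Longrightarrow> is_valuation av"
    and "f \<in> vecs_in (series Q)"
    and "CARD('k) \<le> CARD('m)"
    and "is_maximal_minor g (rel_jacobian f)"
  shows "\<forall>d. quasi_affine_in (vecs_in (poly_0 d)) (Z_set g d) \<and>
    (\<exists>\<chi>\<^sub>d :: ('a fps ^ 'm) \<times> ('a fps ^ 'm) \<Rightarrow> 'a fps ^ 'm.
       textile_iso_on coeffs_pair coeffs_vec
         (\<lambda>(z, v). fps_nth (at_arc g z) d) (\<lambda>y. fps_nth (at_arc g y) d)
         (Z_set g d \<times> V_set Q d) (S_set Q g d) \<chi>\<^sub>d \<and>
       (\<forall>z \<in> Z_set g d. \<forall>v \<in> V_set Q d.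
          (\<exists>v' \<in> V_set Q d. \<chi>\<^sub>d (z, v) = v' + z) \<and>
          arquile f (\<chi>\<^sub>d (z, v)) = arquile f z + mat_at_arc (rel_jacobian f) z *v v))"
proof (intro allI conjI Z_set_quasi_affine)
  fix d
  have val: "\<forall>av. Q = Convergent av \<longrightarrow> is_valuation av" using assms(2) by blast
  obtain \<sigma> :: "'k \<Rightarrow> 'm" and F B where F\<sigma>: "\<And>i. F (\<sigma> i) = f $ i"
    and F_cases: "\<And>p. F p \<in> {mps_var (Some p)} \<union> range (\<lambda>i. f $ i)" and sys: "newton_system F B g"
    and gen: "\<forall>S. subring_set S \<longrightarrow> (\<forall>i q. mps_deriv (Some q) (f $ i) \<in> S) \<longrightarrow> g \<in> S \<and> (\<forall>q r. B q r \<in> S)"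
    by (rule minor_newton_system[OF assms(5)], rule that)
  interpret newton_system F B g by fact
  have f: "f $ i \<in> series Q" for i using assms(3) by (simp add: vecs_in_def)
  have F: "F p \<in> series Q" for p
    using F_cases[of p] f is_poly_in_series[OF val, where p = "mps_var (Some p)"] by auto
  note R = subring_set_series1[OF val]
  let ?Z = "Z_set g d" and ?V = "V_set Q d :: ('a fps ^ 'm) set" and ?S = "S_set Q g d"
  have Z: "zero_arc z" "\<And>j n. n > d \<Longrightarrow> fps_nth (z $ j) n = 0" "has_ord (at_arc g z) d"
    "\<And>j. z $ j \<in> series1 Q" if "z \<in> ?Z" for z
  proof -
    fix j
    have "z $ j \<in> poly_0 d" using that by (simp add: Z_set_def vecs_in_def)
    then obtain p where "z $ j = fps_of_poly p" unfolding poly_0_def by blast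
    then show "z $ j \<in> series1 Q" using fps_of_poly_in_series1[OF val, of p] by simp
  qed (use that in \<open>auto simp: Z_set_iff\<close>)
  \<comment> \<open>The series whose value at \<open>z\<close> has quality \<open>Q\<close> form a
    subring that contains the partial derivatives of \<open>f\<close>, and therefore
    \<open>g\<close> and the entries of \<open>B\<close>.\<close>
  have gB: "at_arc g z \<in> series1 Q" "\<And>q r. at_arc (B q r) z \<in> series1 Q" if z: "z \<in> ?Z" for z
  proof -
    interpret h: comm_ring_hom "\<lambda>h. at_arc h z" by (rule hom_at_arc[OF Z(1)[OF z]])
    have "subring_set {h. at_arc h z \<in> series1 Q}"
      using R by (simp add: subring_set_def h.hom_one h.hom_diff h.hom_mult)
    moreover have "mps_deriv (Some q) (f $ i) \<in> {h. at_arc h z \<in> series1 Q}" for i q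
      using at_arc_in_series1(2)[OF val f Z(1)[OF z] Z(4)[OF z]] by simp
    ultimately have "g \<in> {h. at_arc h z \<in> series1 Q} \<and> (\<forall>q r. B q r \<in> {h. at_arc h z \<in> series1 Q})"
      using gen by blast
    then show "at_arc g z \<in> series1 Q" "\<And>q r. at_arc (B q r) z \<in> series1 Q" by auto
  qed
  have V: "v \<in> ?V \<longleftrightarrow> (\<forall>j. v $ j \<in> series1 Q \<and> fps_X ^ Suc d dvd v $ j)" for v
    by (rule V_set_iff[OF val])
  have sol: "newton_solution d z v \<in> ?V" if z: "z \<in> ?Z" and v: "v \<in> ?V" for z v
  proof -
    have v': "\<And>j. v $ j \<in> series1 Q" "\<And>j. fps_X ^ Suc d dvd v $ j" using v V by auto
    note ex = newton_solution_exists[OF Z(1,3)[OF z] v'(2)]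
    have "newton_solution d z v $ j \<in> series1 Q" for j
      by (rule series1_solution[OF val sys F gB[OF z] Z(1,4,3)[OF z] v' ex])
    then show ?thesis using V ex(1) by blast
  qed
  have to_S: "arc_chart d (z, v) \<in> ?S" if z: "z \<in> ?Z" and v: "v \<in> ?V" for z v
  proof -
    have w: "\<And>j. newton_solution d z v $ j \<in> series1 Q" "\<And>j. fps_X ^ Suc d dvd newton_solution d z v $ j"
      using sol[OF z v] V by auto
    have "has_ord (at_arc g (z + newton_solution d z v)) d"
      using Z(3)[OF z] at_arc_perturb[OF Z(1,3)[OF z] w(2), of _ g] unfolding has_ord_iff by simp
    moreover have "zero_arc (newton_solution d z v + z)"
      using Z(1)[OF z] zero_arc_dvd[OF w(2)] by (simp add: zero_arc_def)
    ultimately show ?thesis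
      using w(1) Z(4)[OF z] subring_set_add[OF R] by (simp add: S_set_iff arc_chart_def add.commute)
  qed
  have trunc: "arc_trunc d y \<in> ?Z" if y: "y \<in> ?S" for y
  proof -
    have z0: "zero_arc (arc_trunc d y)" using y by (simp add: S_set_iff zero_arc_def arc_trunc_def)
    have y0: "zero_arc y" and oy: "has_ord (at_arc g y) d" using y by (auto simp: S_set_iff)
    have dvd: "fps_X ^ Suc d dvd (arc_trunc d y - y) $ j" for j
      using arc_trunc_dvd[of d y j] by (simp add: dvd_diff_commute del: power_Suc)
    \<comment> \<open>Perturbation in the opposite direction, from \<open>y\<close> to its
      truncation.\<close>
    have "has_ord (at_arc g (y + (arc_trunc d y - y))) d"
      using oy at_arc_perturb[OF y0 oy dvd, of _ g] unfolding has_ord_iff by simp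
    then show ?thesis using z0 by (simp add: Z_set_iff arc_trunc_def)
  qed
  have from_S: "arc_chart_inv d y \<in> ?Z \<times> ?V" if y: "y \<in> ?S" for y
  proof -
    note z = trunc[OF y]
    let ?w = "y - arc_trunc d y"
    have wA: "?w $ j \<in> series1 Q" for j
      using y Z(4)[OF z] subring_set_diff[OF R] by (simp add: S_set_iff)
    have zw: "zero_arc (arc_trunc d y + ?w)" using y by (simp add: S_set_iff)
    have "taylor_error (arc_trunc d y) ?w r \<in> series1 Q" for r
      unfolding taylor_error_def using y Z(4)[OF z]
      by (intro subring_set_diff[OF R] subring_set_sum[OF R] subring_set_mult[OF R] wA
          at_arc_in_series1[OF val F] zw Z(1)[OF z]) (auto simp: S_set_iff)
    \<comment> \<open>The multiple by g(z) is a sum of products within the ring; the correction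
      itself then has the quality by exact division.\<close>
    then have "at_arc g (arc_trunc d y) * correction d (arc_trunc d y) ?w q \<in> series1 Q" for q
      unfolding correction_mult[OF Z(1,3)[OF z] arc_trunc_dvd]
      by (intro subring_set_sum[OF R] subring_set_mult[OF R] gB[OF z])
    then have "correction d (arc_trunc d y) ?w q \<in> series1 Q" for q
      using series1_division[OF val gB(1)[OF z]] Z(3)[OF z] by (auto simp: has_ord_def)
    then have "(\<chi> j. ?w $ j + correction d (arc_trunc d y) ?w j) \<in> ?V"
      unfolding V using wA arc_trunc_dvd correction_dvd[OF Z(1,3)[OF z] arc_trunc_dvd]
      by (auto intro!: subring_set_add[OF R] dvd_add simp del: power_Suc vector_minus_component)
    then show ?thesis using z by (simp add: arc_chart_inv_def)
  qed
  have inv1: "arc_chart_inv d (arc_chart d x) = x" if x: "x \<in> ?Z \<times> ?V" for x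
  proof -
    obtain z v where zv: "x = (z, v)" and z: "z \<in> ?Z" and v: "v \<in> ?V" using x by auto
    have v': "\<And>j. fps_X ^ Suc d dvd v $ j" using v V by auto
    note ex = newton_solution_exists[OF Z(1,3)[OF z] v']
    have "fps_cutoff (Suc d) (newton_solution d z v $ j + z $ j) = z $ j" for j
      using ex(1)[of j] Z(2)[OF z, of _ j] unfolding fps_X_power_dvd_iff by (intro fps_ext) auto
    then have tr: "arc_trunc d (newton_solution d z v + z) = z"
      by (simp add: arc_trunc_def vec_eq_iff)
    show ?thesis
      unfolding zv arc_chart_def arc_chart_inv_def using ex(2)
      by (simp add: tr vec_eq_iff)
  qed
  have inv2: "arc_chart d (arc_chart_inv d y) = y" if y: "y \<in> ?S" for y
  proof -
    define z where "z = arc_trunc d y"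
    define v where "v = snd (arc_chart_inv d y)"
    have z: "z \<in> ?Z" and v: "v \<in> ?V" using from_S[OF y] by (auto simp: z_def v_def arc_chart_inv_def)
    have v': "\<And>j. fps_X ^ Suc d dvd v $ j" using v V by auto
    note ex = newton_solution_exists[OF Z(1,3)[OF z] v']
    \<comment> \<open>Both sides have the same sum with their correction, namely \<open>v\<close>,
      by the construction of \<open>arc_chart_inv\<close>.\<close>
    have "newton_solution d z v = y - z"
    proof (rule newton_unique[OF Z(1,3)[OF z] ex(1)])
      show "fps_X ^ Suc d dvd (y - z) $ j" for j unfolding z_def by (rule arc_trunc_dvd)
      show "newton_solution d z v $ j + correction d z (newton_solution d z v) j
          = (y - z) $ j + correction d z (y - z) j" for j
        unfolding ex(2)[symmetric] by (simp add: v_def arc_chart_inv_def z_def)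
    qed
    moreover have "arc_chart_inv d y = (z, v)" by (simp add: z_def v_def arc_chart_inv_def)
    ultimately show ?thesis by (simp add: arc_chart_def)
  qed
  have bij: "bij_betw (arc_chart d) (?Z \<times> ?V) ?S"
  proof (rule bij_betw_byWitness[where f' = "arc_chart_inv d"])
    show "arc_chart d ` (?Z \<times> ?V) \<subseteq> ?S" using to_S by auto
    show "arc_chart_inv d ` ?S \<subseteq> ?Z \<times> ?V" using from_S by blast
  qed (use inv1 inv2 in blast)+
  have inv_eq: "inv_into (?Z \<times> ?V) (arc_chart d) y = arc_chart_inv d y" if "y \<in> ?S" for y
    using bij that from_S inv2 by (intro inv_into_f_eq) (auto simp: bij_betw_def)
  define q\<^sub>1 where "q\<^sub>1 = (\<lambda>(z, v :: 'a fps ^ 'm). fps_nth (at_arc g z) d)"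
  define q\<^sub>2 where "q\<^sub>2 y = fps_nth (at_arc g y) d" for y
  have textile: "textile_on coeffs_pair coeffs_vec q\<^sub>1 (?Z \<times> ?V) (arc_chart d)"
  proof -
    have coord: "fps_nth (fst x $ j) n = coeffs_pair x (Inl (j, n))"
      "fps_nth (snd x $ j) n = coeffs_pair x (Inr (j, n))" for x :: "('a fps ^ 'm) \<times> ('a fps ^ 'm)" and j n
      by (simp_all add: coeffs_pair_def coeffs_vec_def)
    interpret r: regular_functions "coeffs_pair :: ('a fps ^ 'm) \<times> ('a fps ^ 'm) \<Rightarrow> _" q\<^sub>1 "?Z \<times> ?V"
    proof
      show "q\<^sub>1 x \<noteq> 0" if "x \<in> ?Z \<times> ?V" for x
        using that Z(3) by (auto simp: q\<^sub>1_def has_ord_iff)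
      show "\<exists>p. mps_is_poly p \<and> (\<forall>x\<in>?Z \<times> ?V. q\<^sub>1 x = mps_poly_eval p (coeffs_pair x))"
        using at_arc_coeff_polynomial[of fst coeffs_pair g d] coord(1)
        unfolding q\<^sub>1_def case_prod_unfold by blast
    qed
    have co: "r.reg_fps (\<lambda>x. fst x $ j)" "r.reg_fps (\<lambda>x. snd x $ j)" for j
      unfolding r.reg_fps_def coord by (auto intro: r.reg_coord)
    have "r.reg_fps (\<lambda>x. newton_solution d (fst x) (snd x) $ j)" for j
      by (intro r.reg_fps_newton_solution[OF sys] co) (simp add: q\<^sub>1_def case_prod_unfold)
    then have "r.reg_fps (\<lambda>x. arc_chart d x $ j)" for j
      using r.reg_fps_add co(1) by (simp add: arc_chart_def case_prod_unfold)
    then show ?thesis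
      unfolding textile_on_regular r.reg_fps_def by (auto simp: coeffs_vec_def)
  qed
  have textile_inv: "textile_on coeffs_vec coeffs_pair q\<^sub>2 ?S (inv_into (?Z \<times> ?V) (arc_chart d))"
  proof -
    have coord: "fps_nth (y $ j) n = coeffs_vec y (j, n)" for y :: "'a fps ^ 'm" and j n
      by (simp add: coeffs_vec_def)
    interpret r: regular_functions "coeffs_vec :: 'a fps ^ 'm \<Rightarrow> _" q\<^sub>2 ?S
    proof
      show "q\<^sub>2 y \<noteq> 0" if "y \<in> ?S" for y
        using that by (auto simp: q\<^sub>2_def has_ord_iff S_set_iff)
      show "\<exists>p. mps_is_poly p \<and> (\<forall>y\<in>?S. q\<^sub>2 y = mps_poly_eval p (coeffs_vec y))"
        using at_arc_coeff_polynomial[of "\<lambda>y. y" coeffs_vec g d] coord unfolding q\<^sub>2_def by blast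
    qed
    have co: "r.reg_fps (\<lambda>y. y $ j)" for j
      unfolding r.reg_fps_def coord by (auto intro: r.reg_coord)
    have tr: "r.reg_fps (\<lambda>y. arc_trunc d y $ j)" for j
      unfolding r.reg_fps_def
    proof
      fix n
      show "r.reg (\<lambda>y. fps_nth (arc_trunc d y $ j) n)"
        using r.reg_coord[of "(j, n)"] r.reg_const[of 0] by (cases "n < Suc d") (simp_all add: arc_trunc_def coord)
    qed
    have w: "r.reg_fps (\<lambda>y. (y - arc_trunc d y) $ j)" for j
      using r.reg_fps_diff[OF co tr] by simp
    \<comment> \<open>The inverse computes with g_d at the truncation; as it agrees with g_d at
      \<open>y\<close>, the denominator is a function of the argument \<open>y\<close>
      itself.\<close>
    have q: "fps_nth (at_arc g (arc_trunc d y)) d = q\<^sub>2 y" if y: "y \<in> ?S" for y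
      using at_arc_perturb[OF Z(1,3)[OF trunc[OF y]] arc_trunc_dvd[of d y], of d g]
      by (simp add: q\<^sub>2_def)
    have "r.reg_fps (\<lambda>y. fst (arc_chart_inv d y) $ j)" "r.reg_fps (\<lambda>y. snd (arc_chart_inv d y) $ j)" for j
      using tr r.reg_fps_add[OF w r.reg_fps_correction[OF sys tr w q]] by (simp_all add: arc_chart_inv_def)
    then have "r.reg (\<lambda>y. coeffs_pair (arc_chart_inv d y) i)" for i
      unfolding r.reg_fps_def by (cases i) (auto simp: coeffs_pair_def coeffs_vec_def)
    moreover have "r.reg (\<lambda>y. coeffs_pair (inv_into (?Z \<times> ?V) (arc_chart d) y) i)
        \<longleftrightarrow> r.reg (\<lambda>y. coeffs_pair (arc_chart_inv d y) i)" for i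
      by (rule regular_cong) (simp add: inv_eq)
    ultimately show ?thesis unfolding textile_on_regular by blast
  qed
  have linear: "arquile f (arc_chart d (z, v)) = arquile f z + mat_at_arc (rel_jacobian f) z *v v"
    if z: "z \<in> ?Z" and v: "v \<in> ?V" for z v
  proof -
    have v': "\<And>j. fps_X ^ Suc d dvd v $ j" using v V by auto
    note ex = newton_solution_exists[OF Z(1,3)[OF z] v']
    have "at_arc (f $ i) (z + newton_solution d z v)
        = at_arc (f $ i) z + (\<Sum>j\<in>UNIV. at_arc (mps_deriv (Some j) (f $ i)) z * v $ j)" for i
      using arc_linearised[OF Z(1,3)[OF z] ex, of "\<sigma> i"] by (simp add: F\<sigma>)
    then show ?thesis
      by (simp add: vec_eq_iff arquile_def arc_chart_def mat_at_arc_def rel_jacobian_def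
          matrix_vector_mult_def add.commute)
  qed
  show "\<exists>\<chi>\<^sub>d. textile_iso_on coeffs_pair coeffs_vec
         (\<lambda>(z, v). fps_nth (at_arc g z) d) (\<lambda>y. fps_nth (at_arc g y) d) (?Z \<times> ?V) ?S \<chi>\<^sub>d \<and>
       (\<forall>z \<in> ?Z. \<forall>v \<in> ?V. (\<exists>v' \<in> ?V. \<chi>\<^sub>d (z, v) = v' + z) \<and>
          arquile f (\<chi>\<^sub>d (z, v)) = arquile f z + mat_at_arc (rel_jacobian f) z *v v)"
  proof (intro exI[of _ "arc_chart d"] conjI ballI)
    show "textile_iso_on coeffs_pair coeffs_vec
         (\<lambda>(z, v). fps_nth (at_arc g z) d) (\<lambda>y. fps_nth (at_arc g y) d) (?Z \<times> ?V) ?S (arc_chart d)"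
      using bij textile textile_inv unfolding textile_iso_on_def q\<^sub>1_def q\<^sub>2_def by blast
    fix z v assume zv: "z \<in> ?Z" "v \<in> ?V"
    show "\<exists>v'\<in>?V. arc_chart d (z, v) = v' + z"
      using sol[OF zv] by (auto simp: arc_chart_def)
    show "arquile f (arc_chart d (z, v)) = arquile f z + mat_at_arc (rel_jacobian f) z *v v"
      by (rule linear[OF zv])
  qed
qed

end
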